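(* Let $c>0$, $\gamma>0$, $a\in\mathbb{R}$ and $p>2$, and assume that one of the following three conditions holds: (i) $a\le 0$ and $p>2$; (ii) $a>0$ and $p<4$; (iii) $a>0$, $p=4$ and $c<\dfrac{2}{aK_{GN}}$. Then the infimum $$m=\inf_{S(c)}F$$ is achieved. In addition, any minimizing sequence for $m$ has, up to translation, a subsequence converging strongly in $X$; that is, if $(u_n)\subset S(c)$ and $F(u_n)\to m$, then there exist points $x_n\in\mathbb{R}^2$ such that $(u_n(\cdot-x_n))$ has a subsequence converging strongly in $X$.
   Context: All functions are real-valued on $\mathbb{R}^2$. $X=\{u\in H^1(\mathbb{R}^2): \int_{\mathbb{R}^2}\log(1+|x|)u^2(x)\,dx<\infty\}$ is the Hilbert space with norm $\|u\|_X^2=\int_{\mathbb{R}^2}(|\nabla u|^2+u^2)\,dx+\int_{\mathbb{R}^2}\log(1+|x|)u^2(x)\,dx$. For $c>0$, $S(c)=\{u\in X:\int_{\mathbb{R}^2}u^2\,dx=c\}$. The functional $F:X\to\mathbb{R}$ (of class $C^1$) is $$F(u)=\tfrac12A(u)+\tfrac{\gamma}{4}V(u)-\tfrac{a}{p}C(u),$$ where $A(u)=\int_{\mathbb{R}^2}|\nabla u|^2dx$, $V(u)=\iint_{\mathbb{R}^2\times\mathbb{R}^2}|u(x)|^2|u(y)|^2\log(|x-y|)\,dx\,dy$, $C(u)=\int_{\mathbb{R}^2}|u|^p\,dx$. $K_{GN}$ (depending on $p$) is the best, i.e. smallest, constant in the Gagliardo–Nirenberg inequality $\|u\|_p^p\le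 K_{GN}\|\nabla u\|_2^{p-2}\|u\|_2^{2}$ for $u\in H^1(\mathbb{R}^2)$. *)

theory Defs
  imports "HOL-Analysis.Analysis"
begin

type_synonym plane = "real ^ 2"

text \<open>
  Elements of function spaces are represented by Borel measurable functions; every class of
  Lebesgue measurable functions modulo null sets has such a representative, and all notions below
  are invariant under changes on null sets.
\<close>

definition partial :: "2 \<Rightarrow> (plane \<Rightarrow> real) \<Rightarrow> plane \<Rightarrow> real" where
  "partial i f x = frechet_derivative f (at x) (axis i 1)"

primrec Ck :: "nat \<Rightarrow> (plane \<Rightarrow> real) \<Rightarrow> bool" where
  "Ck 0 f \<longleftrightarrow> continuous_on UNIV f"
| "Ck (Suc k) f \<longleftrightarrow> f differentiable_on UNIV \<and> (\<forall>i. Ck k (partial i f))"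

definition test_function :: "(plane \<Rightarrow> real) \<Rightarrow> bool" where
  "test_function \<phi> \<longleftrightarrow> (\<forall>k. Ck k \<phi>) \<and> compact (closure {x. \<phi> x \<noteq> 0})"

definition locally_integrable :: "(plane \<Rightarrow> 'b::{banach, second_countable_topology}) \<Rightarrow> bool" where
  "locally_integrable f \<longleftrightarrow>
     f \<in> borel_measurable borel \<and> (\<forall>K. compact K \<longrightarrow> set_integrable lborel K f)"

definition is_weak_gradient :: "(plane \<Rightarrow> real) \<Rightarrow> (plane \<Rightarrow> plane) \<Rightarrow> bool" where
  "is_weak_gradient u g \<longleftrightarrow> locally_integrable u \<and> locally_integrable g \<and>
     (\<forall>\<phi> i. test_function \<phi> \<longrightarrow>
        (\<integral>x. u x * partial i \<phi> x \<partial>lborel) = - (\<integral>x. g x $ i * \<phi> x \<partial>lborel))"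

text \<open>Weak gradients are unique up to null sets, so the choice is immaterial in the integrals below.\<close>

definition weak_grad :: "(plane \<Rightarrow> real) \<Rightarrow> plane \<Rightarrow> plane" where
  "weak_grad u = (SOME g. is_weak_gradient u g)"

definition H1 :: "(plane \<Rightarrow> real) set" where
  "H1 = {u. u \<in> borel_measurable borel \<and> integrable lborel (\<lambda>x. (u x)\<^sup>2) \<and>
         (\<exists>g. is_weak_gradient u g \<and> integrable lborel (\<lambda>x. (norm (g x))\<^sup>2))}"

definition X :: "(plane \<Rightarrow> real) set" where
  "X = {u \<in> H1. integrable lborel (\<lambda>x. ln (1 + norm x) * (u x)\<^sup>2)}"

definition X_norm :: "(plane \<Rightarrow> real) \<Rightarrow> real" where
  "X_norm u = sqrt ((\<integral>x. (norm (weak_grad u x))\<^sup>2 + (u x)\<^sup>2 \<partial>lborel)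
                  + (\<integral>x. ln (1 + norm x) * (u x)\<^sup>2 \<partial>lborel))"

definition S :: "real \<Rightarrow> (plane \<Rightarrow> real) set" where
  "S c = {u \<in> X. (\<integral>x. (u x)\<^sup>2 \<partial>lborel) = c}"

definition A :: "(plane \<Rightarrow> real) \<Rightarrow> real" where
  "A u = (\<integral>x. (norm (weak_grad u x))\<^sup>2 \<partial>lborel)"

text \<open>The value \<open>ln 0 = 0\<close> only matters on the diagonal, which is a null set.\<close>

definition V :: "(plane \<Rightarrow> real) \<Rightarrow> real" where
  "V u = (\<integral>(x, y). \<bar>u x\<bar>\<^sup>2 * \<bar>u y\<bar>\<^sup>2 * ln (norm (x - y)) \<partial>(lborel \<Otimes>\<^sub>M lborel))"

definition C :: "real \<Rightarrow> (plane \<Rightarrow> real) \<Rightarrow> real" where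
  "C p u = (\<integral>x. \<bar>u x\<bar> powr p \<partial>lborel)"

definition F :: "real \<Rightarrow> real \<Rightarrow> real \<Rightarrow> (plane \<Rightarrow> real) \<Rightarrow> real" where
  "F \<gamma> a p u = 1 / 2 * A u + \<gamma> / 4 * V u - a / p * C p u"

text \<open>
  Integrability of \<open>\<bar>u\<bar> powr p\<close> is part of the Gagliardo--Nirenberg inequality: without it the
  Bochner integral in \<^const>\<open>C\<close> would be \<open>0\<close> for a non-integrable function.
\<close>

definition GN_inequality :: "real \<Rightarrow> real \<Rightarrow> bool" where
  "GN_inequality p K \<longleftrightarrow> (\<forall>u \<in> H1. integrable lborel (\<lambda>x. \<bar>u x\<bar> powr p) \<and>
     (\<integral>x. \<bar>u x\<bar> powr p \<partial>lborel) \<le>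
       K * sqrt (\<integral>x. (norm (weak_grad u x))\<^sup>2 \<partial>lborel) powr (p - 2)
         * (sqrt (\<integral>x. (u x)\<^sup>2 \<partial>lborel))\<^sup>2)"

definition K_GN :: "real \<Rightarrow> real" where
  "K_GN p = Inf {K. GN_inequality p K}"

definition m :: "real \<Rightarrow> real \<Rightarrow> real \<Rightarrow> real \<Rightarrow> real" where
  "m \<gamma> a p c = (INF u \<in> S c. F \<gamma> a p u)"

definition translate :: "plane \<Rightarrow> (plane \<Rightarrow> real) \<Rightarrow> plane \<Rightarrow> real" where
  "translate z u = (\<lambda>y. u (y - z))"

definition converges_in_X :: "(nat \<Rightarrow> plane \<Rightarrow> real) \<Rightarrow> (plane \<Rightarrow> real) \<Rightarrow> bool" where
  "converges_in_X v w \<longleftrightarrow> (\<forall>n. v n \<in> X) \<and> w \<in> X \<and>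
     (\<lambda>n. X_norm (\<lambda>y. v n y - w y)) \<longlonglongrightarrow> 0"

end

theory Submission
  imports Defs
begin

text \<open>
  The theorem is proved by the direct method, with translations chosen so that no mass can escape.

  \<^bold>\<open>Coercivity.\<close> Splitting \<open>ln (norm z) = ln_pos z - ln_neg z\<close> into positive and negative part
  writes \<open>V u\<close> as \<open>energy ln_pos u - energy ln_neg u\<close> with both terms nonnegative. The square of
  \<open>ln_neg\<close> is integrable, so Young's inequality bounds \<open>energy ln_neg u\<close> by the mass times a small
  multiple of the fourth moment of \<open>u\<close>, up to a constant, and the fourth moment is at most
  \<open>4 * A u\<close> times the mass. Each of the three alternatives for \<open>a\<close>, \<open>p\<close>, \<open>c\<close> bounds
  \<open>a / p * C p u\<close> by \<open>\<theta> * A u + K\<close> with \<open>\<theta> < 1 / 2\<close>. Hence \<open>F\<close> dominates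
  \<open>\<delta> * A u + \<gamma> / 4 * energy ln_pos u - K\<close> on \<open>S c\<close> (\<open>F_coercive\<close>).

  \<^bold>\<open>Translations.\<close> Along a minimizing sequence \<open>energy ln_pos u\<close> is bounded, say by \<open>M\<close>. It is the
  average over \<open>x\<close>, with density \<open>(u x)\<^sup>2\<close> of mass \<open>c\<close>, of the potential
  \<open>\<integral>y. (u y)\<^sup>2 * ln_pos (x - y)\<close>, so that at some point the potential is at most \<open>(M + 1) / c\<close>.
  Moving this point to the origin bounds the logarithmic moment (\<open>exists_good_center\<close>). The
  translated sequence is bounded in \<open>X\<close>, and \<open>X\<close> embeds compactly into \<open>L\<^sup>2\<close>
  (\<open>bounded_in_X_L2_Cauchy_subsequence\<close>).

  \<^bold>\<open>Passage to the limit.\<close> Let a subsequence converge to \<open>w\<close> in \<open>L\<^sup>2\<close> and almost everywhere. Then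
  \<open>w\<close> has mass \<open>c\<close>, the functionals \<open>energy ln_neg\<close> and \<open>C p\<close> converge, and \<open>A\<close> and
  \<open>energy ln_pos\<close> are lower semicontinuous. As \<open>F\<close> at \<open>w\<close> is not below the infimum, no summand can
  drop in the limit: \<open>w\<close> is a minimizer, and \<open>A\<close> and \<open>energy ln_pos\<close> converge separately. Convergence
  of \<open>A\<close> turns, by the parallelogram identity, into strong convergence of the gradients
  (\<open>A_diff_tendsto_zero\<close>), and convergence of \<open>energy ln_pos\<close> into convergence of the logarithmically
  weighted integrals (\<open>log_weight_convergence\<close>).

  \<^bold>\<open>Sobolev spaces.\<close> The estimates on \<open>H1\<close> are derived from one identity: a weak gradient integrates,
  along almost every segment parallel to an axis, to the increment of the function
  (\<open>weak_gradient_shift_identity\<close>). It gives the bounds for all moments (\<open>H1_even_moments\<close>) and the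
  \<open>L\<^sup>2\<close> modulus of continuity behind compactness (\<open>cells_poincare\<close>). That \<open>H1\<close> is closed and \<open>A\<close>
  lower semicontinuous under \<open>L\<^sup>2\<close> convergence (\<open>H1_closed_lsc\<close>) is obtained without weak limits, by
  minimizing \<open>A\<close> over shrinking balls of \<open>L\<^sup>2\<close>.
\<close>

section \<open>Preliminaries\<close>

abbreviation mass :: "(plane \<Rightarrow> real) \<Rightarrow> real" where
  "mass u \<equiv> (LBINT x. (u x)\<^sup>2)"

abbreviation sqdist :: "(plane \<Rightarrow> real) \<Rightarrow> (plane \<Rightarrow> real) \<Rightarrow> real" where
  "sqdist u w \<equiv> (LBINT x. (u x - w x)\<^sup>2)"

abbreviation log_moment :: "(plane \<Rightarrow> real) \<Rightarrow> real" where
  "log_moment u \<equiv> (LBINT x. ln (1 + norm x) * (u x)\<^sup>2)"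

lemma integrable_dominated:
  fixes f :: "'a \<Rightarrow> real"
  assumes "integrable M g" "f \<in> borel_measurable M" "\<And>x. \<bar>f x\<bar> \<le> g x"
  shows "integrable M f"
  by (rule Bochner_Integration.integrable_bound[OF assms(1,2)])
    (auto intro: order.trans[OF assms(3) abs_ge_self])

lemma le_one_plus_square: "r \<le> 1 + r\<^sup>2" for r :: real
proof -
  have "0 \<le> (r - 1)\<^sup>2 + r\<^sup>2 + 1" by simp
  also have "\<dots> = 2 * (1 + r\<^sup>2 - r)" by (simp add: power2_eq_square algebra_simps)
  finally show ?thesis by simp
qed

lemma square_diff_le: "(p - q)\<^sup>2 \<le> 2 * p\<^sup>2 + 2 * q\<^sup>2" for p q :: real
  using zero_le_power2[of "p + q"] by (simp add: power2_eq_square algebra_simps)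

section \<open>Test functions and the du Bois-Reymond lemma\<close>

text \<open>
  The functions \<open>poly q (1 / t) * exp (- 1 / t)\<close>, extended by \<open>0\<close> to \<open>t \<le> 0\<close>, form a family that is
  closed under differentiation. Smoothness of \<open>exp (- 1 / t)\<close>, the case \<open>q = 1\<close>, is proved for all of
  them at once.
\<close>

definition flat :: "real poly \<Rightarrow> real \<Rightarrow> real" where
  "flat q t = (if t > 0 then poly q (1 / t) * exp (- (1 / t)) else 0)"

lemma tendsto_poly_times_exp_minus: "((\<lambda>x. poly q x * exp (- x)) \<longlongrightarrow> (0::real)) at_top"
proof -
  have "((\<lambda>x. \<Sum>i\<le>degree q. coeff q i * (x ^ i / exp x)) \<longlongrightarrow> (\<Sum>i\<le>degree q. coeff q i * (0::real))) at_top"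
    by (intro tendsto_intros tendsto_power_div_exp_0)
  then show ?thesis
    by (simp add: poly_altdef exp_minus sum_distrib_right divide_inverse mult.assoc)
qed

lemma flat_has_derivative:
  "(flat q has_real_derivative flat ([:0, 0, 1:] * (q - pderiv q)) t) (at t)"
proof (cases t "0::real" rule: linorder_cases)
  case greater
  have "((\<lambda>t. poly q (1 / t) * exp (- (1 / t))) has_real_derivative
      (poly (pderiv q) (1 / t) * (- 1 / t\<^sup>2)) * exp (- (1/t)) + poly q (1 / t) * (exp (- (1/t)) * (1 / t\<^sup>2))) (at t)"
    using greater by (auto intro!: derivative_eq_intros simp: power2_eq_square field_simps)
  also have "(poly (pderiv q) (1 / t) * (- 1 / t\<^sup>2)) * exp (- (1/t)) + poly q (1 / t) * (exp (- (1/t)) * (1 / t\<^sup>2))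
      = flat ([:0, 0, 1:] * (q - pderiv q)) t"
    using greater by (simp add: flat_def power2_eq_square algebra_simps)
  finally show ?thesis
    by (rule DERIV_cong_ev[THEN iffD1, rotated -1])
      (use greater in \<open>auto simp: flat_def intro!: eventually_mono[OF eventually_nhds_in_open[of "{0<..}" t]]\<close>)
next
  case less
  have "((\<lambda>t. 0) has_real_derivative 0) (at t)" by simp
  then have "(flat q has_real_derivative 0) (at t)"
    by (rule DERIV_cong_ev[THEN iffD1, rotated -1])
      (use less in \<open>auto simp: flat_def intro!: eventually_mono[OF eventually_nhds_in_open[of "{..<0}" t]]\<close>)
  with less show ?thesis by (simp add: flat_def)
next
  case equal
  have r: "((\<lambda>h. flat q h / h) \<longlongrightarrow> 0) (at_right 0)"
  proof -
    have "((\<lambda>h. poly (pCons 0 q) (inverse h) * exp (- (inverse h))) \<longlongrightarrow> 0) (at_right (0::real))"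
      by (rule filterlim_compose[OF tendsto_poly_times_exp_minus filterlim_inverse_at_top_right])
    then show ?thesis
      by (rule Lim_transform_eventually)
        (auto simp: eventually_at_right_less flat_def field_simps intro!: eventually_mono[OF eventually_at_right_less[of 0]])
  qed
  have l: "((\<lambda>h. flat q h / h) \<longlongrightarrow> 0) (at_left 0)"
    by (rule Lim_transform_eventually[of "\<lambda>_. 0"])
      (auto simp: flat_def intro!: eventually_mono[OF eventually_at_left_real[of "-1" 0]])
  have "((\<lambda>h. flat q h / h) \<longlongrightarrow> 0) (at 0)"
    using l r by (simp add: filterlim_split_at)
  then show ?thesis using equal by (simp add: flat_def DERIV_def)
qed

lemma partial_eq: "(f has_derivative f') (at x) \<Longrightarrow> partial i f x = f' (axis i 1)"
  by (simp add: partial_def frechet_derivative_at[symmetric])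

lemma has_derivative_frechet:
  "f differentiable_on UNIV \<Longrightarrow> (f has_derivative frechet_derivative f (at x)) (at x)"
  by (simp add: differentiable_on_def frechet_derivative_works)

lemma Ck_Suc_imp_Ck: "Ck (Suc k) f \<Longrightarrow> Ck k f"
proof (induction k arbitrary: f)
  case 0
  then show ?case by (simp add: differentiable_imp_continuous_on)
next
  case (Suc k)
  then show ?case by (metis Ck.simps(2))
qed

lemma Ck_mult: "Ck k f \<Longrightarrow> Ck k g \<Longrightarrow> Ck k (\<lambda>x. f x * g x)"
  and Ck_add: "Ck k f \<Longrightarrow> Ck k g \<Longrightarrow> Ck k (\<lambda>x. f x + g x)"
proof (induction k arbitrary: f g)
  case 0
  {
    case 1 then show ?case by (auto intro: continuous_intros)
  next
    case 2 then show ?case by (auto intro: continuous_intros)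
  }
next
  case (Suc k)
  {
    case 1
    then have D: "f differentiable_on UNIV" "g differentiable_on UNIV" by auto
    have "partial i (\<lambda>x. f x * g x) = (\<lambda>x. f x * partial i g x + partial i f x * g x)" for i
      using partial_eq[OF has_derivative_mult[OF has_derivative_frechet[OF D(1)] has_derivative_frechet[OF D(2)]]]
      by (intro ext) (simp add: partial_def)
    moreover have "Ck k f" "Ck k g" using 1 Ck_Suc_imp_Ck by auto
    ultimately show ?case using 1 Suc.IH by (auto intro!: Suc.IH differentiable_on_mult)
  next
    case 2
    then have D: "f differentiable_on UNIV" "g differentiable_on UNIV" by auto
    have "partial i (\<lambda>x. f x + g x) = (\<lambda>x. partial i f x + partial i g x)" for i
      using partial_eq[OF has_derivative_add[OF has_derivative_frechet[OF D(1)] has_derivative_frechet[OF D(2)]]]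
      by (intro ext) (simp add: partial_def)
    then show ?case using 2 by (auto intro!: Suc.IH differentiable_on_add)
  }
qed

lemma partial_shift:
  assumes "f differentiable_on UNIV"
  shows "partial i (\<lambda>x. f (x + z)) = (\<lambda>x. partial i f (x + z))"
proof
  fix x
  have "((\<lambda>x. f (x + z)) has_derivative (\<lambda>h. frechet_derivative f (at (x + z)) h)) (at x)"
    by (rule has_derivative_compose[of "\<lambda>x. x + z" "\<lambda>h. h", simplified])
      (auto intro!: derivative_eq_intros has_derivative_frechet[OF assms])
  then show "partial i (\<lambda>x. f (x + z)) x = partial i f (x + z)"
    using partial_eq by (fastforce simp: partial_def)
qed

lemma Ck_shift: "Ck k f \<Longrightarrow> Ck k (\<lambda>x. f (x + z))"
proof (induction k arbitrary: f)
  case 0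
  then show ?case by (auto intro!: continuous_on_compose2[of UNIV f UNIV "\<lambda>x. x + z"] continuous_intros)
next
  case (Suc k)
  have "(\<lambda>x. f (x + z)) differentiable_on UNIV"
    using Suc.prems differentiable_compose[of f "\<lambda>x. x + z"]
    by (auto simp: differentiable_on_def intro!: derivative_intros)
  then show ?case using Suc by (auto simp: partial_shift)
qed

text \<open>
  The polynomial is arbitrary because each differentiation replaces it by another one.
\<close>

lemma Ck_flat: "Ck k (\<lambda>x. d * flat q (\<alpha> * x $ i + \<beta>))"
proof (induction k arbitrary: d q)
  case 0
  have "continuous_on UNIV (flat q)"
    by (meson DERIV_continuous_on flat_has_derivative has_field_derivative_at_within)
  then show ?case
    by (auto intro!: continuous_intros continuous_on_compose2[of UNIV "flat q"])
next
  case (Suc k)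
  have D: "((\<lambda>x. d * flat q (\<alpha> * x $ i + \<beta>)) has_derivative
      (\<lambda>h. d * (flat ([:0, 0, 1:] * (q - pderiv q)) (\<alpha> * x $ i + \<beta>) * (\<alpha> * h $ i)))) (at x)" for x :: plane
  proof -
    have "((\<lambda>x::plane. \<alpha> * x $ i + \<beta>) has_derivative (\<lambda>h. \<alpha> * h $ i)) (at x)"
      by (auto intro!: derivative_eq_intros bounded_linear.has_derivative[OF bounded_linear_vec_nth])
    from has_derivative_compose[OF this flat_has_derivative[unfolded has_field_derivative_def]]
    show ?thesis by (intro has_derivative_mult_right) (simp add: mult_ac)
  qed
  then have "(\<lambda>x. d * flat q (\<alpha> * x $ i + \<beta>)) differentiable_on UNIV"
    by (auto simp: differentiable_on_def differentiable_def)
  moreover have "partial j (\<lambda>x. d * flat q (\<alpha> * x $ i + \<beta>)) =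
      (\<lambda>x. (d * (\<alpha> * axis j 1 $ i)) * flat ([:0, 0, 1:] * (q - pderiv q)) (\<alpha> * x $ i + \<beta>))" for j
    using partial_eq[OF D] by (intro ext) simp
  ultimately show ?case using Suc.IH by simp
qed

lemma test_functionD:
  assumes "test_function \<phi>"
  shows "\<phi> differentiable_on UNIV" "continuous_on UNIV \<phi>" "continuous_on UNIV (partial i \<phi>)"
    "\<phi> \<in> borel_measurable borel" "partial i \<phi> \<in> borel_measurable borel"
proof -
  have "Ck (Suc 0) \<phi>" using assms unfolding test_function_def by blast
  then show "\<phi> differentiable_on UNIV" "continuous_on UNIV \<phi>" "continuous_on UNIV (partial i \<phi>)"
    by (auto simp: differentiable_imp_continuous_on)
  then show "\<phi> \<in> borel_measurable borel" "partial i \<phi> \<in> borel_measurable borel"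
    by (auto intro: borel_measurable_continuous_onI)
qed

lemma test_functionI:
  assumes "\<And>k. Ck k \<phi>" "\<And>x. \<phi> x \<noteq> 0 \<Longrightarrow> norm x \<le> R"
  shows "test_function \<phi>"
proof -
  have "bounded {x. \<phi> x \<noteq> 0}" using assms(2) by (auto simp: bounded_iff)
  then show ?thesis using assms(1) by (simp add: test_function_def compact_closure)
qed

lemma test_function_bounded:
  assumes "test_function \<phi>"
  obtains K R where "\<And>x. R < norm x \<Longrightarrow> \<phi> x = 0" "\<And>x i. R < norm x \<Longrightarrow> partial i \<phi> x = 0"
    "\<And>x. \<bar>\<phi> x\<bar> \<le> K" "\<And>x i. \<bar>partial i \<phi> x\<bar> \<le> K" "0 \<le> R" "0 \<le> K"
proof -
  have "bounded {x. \<phi> x \<noteq> 0}"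
    using assms bounded_subset[OF compact_imp_bounded closure_subset] by (simp add: test_function_def)
  then obtain R where R: "0 < R" "\<And>x. \<phi> x \<noteq> 0 \<Longrightarrow> norm x \<le> R"
    by (auto simp: bounded_pos)
  have z: "\<phi> x = 0" if "R < norm x" for x using R(2)[of x] that by linarith
  have pz: "partial i \<phi> x = 0" if "R < norm x" for i x
  proof -
    have "((\<lambda>x. 0) has_derivative (\<lambda>h. 0)) (at x)" by simp
    then have "(\<phi> has_derivative (\<lambda>h. 0)) (at x)"
      by (rule has_derivative_transform_within_open[of _ _ _ _ "{x. R < norm x}"])
        (use that z in \<open>auto intro!: open_Collect_less continuous_intros\<close>)
    then show ?thesis by (simp add: partial_eq)
  qed
  have bd: "\<exists>K. \<forall>x. \<bar>f x\<bar> \<le> K" if "continuous_on UNIV f" "\<And>x. R < norm x \<Longrightarrow> f x = 0" for f :: "plane \<Rightarrow> real"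
  proof -
    have "compact (f ` cball 0 R)"
      by (intro compact_continuous_image continuous_on_subset[OF that(1)]) auto
    then obtain K where "\<forall>y\<in>f ` cball 0 R. norm y \<le> K" by (auto dest!: compact_imp_bounded simp: bounded_iff)
    then have "\<bar>f x\<bar> \<le> max K 0" for x using that(2)[of x] by (cases "norm x \<le> R") (auto simp: le_max_iff_disj)
    then show ?thesis by blast
  qed
  obtain K0 where K0: "\<And>x. \<bar>\<phi> x\<bar> \<le> K0" using bd[OF test_functionD(2)[OF assms]] z by blast
  have "\<forall>i. \<exists>K. \<forall>x. \<bar>partial i \<phi> x\<bar> \<le> K" using bd test_functionD(3)[OF assms] pz by blast
  then obtain K1 where K1: "\<And>i x. \<bar>partial i \<phi> x\<bar> \<le> K1 i" by metis
  show ?thesis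
  proof (rule that[of R "max 0 (max K0 (Max (range K1)))"])
    show "\<bar>partial i \<phi> x\<bar> \<le> max 0 (max K0 (Max (range K1)))" for i x
      using K1[of i x] Max_ge[of "range K1" "K1 i"] by (simp add: le_max_iff_disj del: Max_ge)
  qed (use R z pz K0 in \<open>auto simp: le_max_iff_disj\<close>)
qed

lemma test_function_shift:
  assumes "test_function \<phi>"
  shows "test_function (\<lambda>x. \<phi> (x + z))"
proof -
  obtain R where R: "\<And>x. R < norm x \<Longrightarrow> \<phi> x = 0" using test_function_bounded[OF assms] by metis
  show ?thesis
  proof (rule test_functionI[of _ "R + norm z"])
    show "Ck k (\<lambda>x. \<phi> (x + z))" for k using assms by (intro Ck_shift) (simp add: test_function_def)
    show "norm x \<le> R + norm z" if "\<phi> (x + z) \<noteq> 0" for x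
      using R[of "x + z"] that norm_triangle_ineq4[of "x + z" z] by fastforce
  qed
qed

text \<open>
  The factor \<open>exp (- 1 / (n * t))\<close> tends to \<open>1\<close> for \<open>t > 0\<close> and is replaced by \<open>0\<close> for \<open>t \<le> 0\<close>. The
  product of four such factors, with \<open>t\<close> the signed distances to the sides, approximates the indicator
  of the box from inside.
\<close>

lemma box_indicator_approx:
  fixes a b :: plane
  obtains \<phi> :: "nat \<Rightarrow> plane \<Rightarrow> real" where "\<And>n. test_function (\<phi> n)" "\<And>n x. 0 \<le> \<phi> n x" "\<And>n x. \<phi> n x \<le> 1"
    "\<And>n x. x \<notin> box a b \<Longrightarrow> \<phi> n x = 0" "\<And>n x. x \<in> box a b \<Longrightarrow> 0 < \<phi> n x"
    "\<And>x. (\<lambda>n. \<phi> n x) \<longlonglongrightarrow> indicator (box a b) x"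
proof -
  define h where "h n t = flat 1 (real (Suc n) * t)" for n t
  define \<phi> where "\<phi> n x = (h n (x $ 1 - a $ 1) * h n (b $ 1 - x $ 1)) * (h n (x $ 2 - a $ 2) * h n (b $ 2 - x $ 2))" for n and x :: plane
  have h01: "0 \<le> h n t" "h n t \<le> 1" for n t by (auto simp: h_def flat_def)
  have h0: "h n t = 0 \<longleftrightarrow> t \<le> 0" for n t by (auto simp: h_def flat_def zero_less_mult_iff mult_le_0_iff)
  have hlim: "(\<lambda>n. h n t) \<longlonglongrightarrow> 1" if "t > 0" for t
  proof -
    have "(\<lambda>n. exp (- (inverse (real (Suc n)) * (1 / t)))) \<longlonglongrightarrow> exp (- (0 * (1 / t)))"
      by (intro tendsto_intros LIMSEQ_inverse_real_of_nat)
    moreover have "h n t = exp (- (inverse (real (Suc n)) * (1 / t)))" for n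
      using that by (simp add: h_def flat_def zero_less_mult_iff inverse_eq_divide)
    ultimately show ?thesis by simp
  qed
  have box: "x \<in> box a b \<longleftrightarrow> a $ 1 < x $ 1 \<and> x $ 1 < b $ 1 \<and> a $ 2 < x $ 2 \<and> x $ 2 < b $ 2" for x
    by (auto simp: mem_box_cart forall_2)
  have z: "x \<notin> box a b \<Longrightarrow> \<phi> n x = 0" for n x
    by (auto simp: box \<phi>_def h0 not_less)
  have pos: "0 \<le> \<phi> n x" for n x by (simp add: \<phi>_def h01)
  show ?thesis
  proof (rule that[of \<phi>])
    fix n
    have c1: "Ck k (\<lambda>x::plane. h n (x $ i - s))" for k i s
      using Ck_flat[of k 1 1 "real (Suc n)" i "- (real (Suc n) * s)"] by (simp add: h_def algebra_simps)
    have c2: "Ck k (\<lambda>x::plane. h n (s - x $ i))" for k i s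
      using Ck_flat[of k 1 1 "- real (Suc n)" i "real (Suc n) * s"] by (simp add: h_def algebra_simps)
    obtain R where R: "\<And>x. x \<in> box a b \<Longrightarrow> norm x \<le> R" using bounded_box[of a b] by (auto simp: bounded_iff)
    show "test_function (\<phi> n)"
    proof (rule test_functionI[of _ R])
      show "Ck k (\<phi> n)" for k unfolding \<phi>_def by (intro Ck_mult c1 c2)
      show "norm x \<le> R" if "\<phi> n x \<noteq> 0" for x using z that R by blast
    qed
    show "\<phi> n x \<le> 1" for x unfolding \<phi>_def by (intro mult_le_one mult_nonneg_nonneg h01)
    show "0 < \<phi> n x" if "x \<in> box a b" for x
      using that h0 h01 unfolding \<phi>_def box by (intro mult_pos_pos) (auto simp: less_le)
  next
    fix x
    show "(\<lambda>n. \<phi> n x) \<longlonglongrightarrow> indicator (box a b) x"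
    proof (cases "x \<in> box a b")
      case True
      then have "(\<lambda>n. \<phi> n x) \<longlonglongrightarrow> (1 * 1) * (1 * 1)"
        unfolding \<phi>_def box by (intro tendsto_mult hlim) auto
      then show ?thesis using True by simp
    qed (simp add: z)
  qed (use z pos in auto)
qed

lemma set_integrable_borel_subset_ball:
  assumes "locally_integrable g" "bounded K" "K \<in> sets borel"
  shows "integrable lborel (\<lambda>x. indicator K x *\<^sub>R g x)"
proof -
  obtain R where "K \<subseteq> cball 0 R" using assms(2) by (auto simp: bounded_iff subset_iff)
  moreover have "set_integrable lborel (cball 0 R) g" using assms(1) by (simp add: locally_integrable_def)
  ultimately show ?thesis using set_integrable_subset[of lborel "cball 0 R" g K] assms(3) by (simp add: set_integrable_def)
qed

lemma integrable_times_test_function: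
  fixes g :: "plane \<Rightarrow> 'b::{banach, second_countable_topology}"
  assumes g: "locally_integrable g" and [measurable]: "f \<in> borel_measurable borel"
    and f: "\<And>x. \<bar>f x\<bar> \<le> K" "\<And>x. R < norm x \<Longrightarrow> f x = 0"
  shows "integrable lborel (\<lambda>x. f x *\<^sub>R g x)"
proof (rule Bochner_Integration.integrable_bound)
  have [measurable]: "g \<in> borel_measurable borel" using g by (simp add: locally_integrable_def)
  show "integrable lborel (\<lambda>x. K *\<^sub>R (indicator (cball 0 R) x *\<^sub>R g x))"
    by (intro integrable_scaleR_right set_integrable_borel_subset_ball[OF g]) auto
  have "\<bar>f x\<bar> * norm (g x) \<le> \<bar>K\<bar> * norm (g x)" for x using f(1)[of x] by (intro mult_right_mono) auto
  then show "AE x in lborel. norm (f x *\<^sub>R g x) \<le> norm (K *\<^sub>R (indicator (cball 0 R) x *\<^sub>R g x))"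
    using f by (intro AE_I2) (auto simp: indicator_def not_le)
  show "(\<lambda>x. f x *\<^sub>R g x) \<in> borel_measurable lborel" by measurable
qed

text \<open>
  Testing with smooth approximations of a box shows that \<open>g\<close> has integral zero over every box. The boxes
  are stable under intersection and generate the Borel sets, so by Dynkin's argument \<open>g\<close> has integral
  zero over every Borel subset of a large box.
\<close>

theorem du_Bois_Reymond:
  fixes g :: "plane \<Rightarrow> real"
  assumes g: "locally_integrable g"
    and 0: "\<And>\<phi>. test_function \<phi> \<Longrightarrow> (LBINT x. g x * \<phi> x) = 0"
  shows "AE x in lborel. g x = 0"
proof -
  have [measurable]: "g \<in> borel_measurable borel" using g by (simp add: locally_integrable_def)
  have box0: "(LBINT x. indicator (box a b) x * g x) = 0" for a b
  proof -
    obtain \<phi> where \<phi>: "\<And>n. test_function (\<phi> n)" "\<And>n x. 0 \<le> \<phi> n x" "\<And>n x. \<phi> n x \<le> 1"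
      "\<And>n x. x \<notin> box a b \<Longrightarrow> \<phi> n x = 0" "\<And>x. (\<lambda>n. \<phi> n x) \<longlonglongrightarrow> indicator (box a b) x"
      using box_indicator_approx[of a b] by metis
    have [measurable]: "\<phi> n \<in> borel_measurable borel" for n using \<phi>(1) test_functionD(4) by blast
    have "(\<lambda>n. LBINT x. g x * \<phi> n x) \<longlonglongrightarrow> (LBINT x. indicator (box a b) x * g x)"
    proof (rule integral_dominated_convergence)
      show "integrable lborel (\<lambda>x. indicator (box a b) x *\<^sub>R norm (g x))"
        using integrable_norm[OF set_integrable_borel_subset_ball[OF g, of "box a b"]] bounded_box
        by (simp add: abs_mult)
      show "AE x in lborel. (\<lambda>n. g x * \<phi> n x) \<longlonglongrightarrow> indicator (box a b) x * g x"
        using tendsto_mult[OF \<phi>(5) tendsto_const] by (intro AE_I2) (simp add: mult.commute)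
      show "AE x in lborel. norm (g x * \<phi> n x) \<le> indicator (box a b) x *\<^sub>R norm (g x)" for n
      proof (intro AE_I2)
        fix x
        have "\<bar>g x\<bar> * \<phi> n x \<le> \<bar>g x\<bar> * 1" using \<phi>(3) by (intro mult_left_mono) auto
        then show "norm (g x * \<phi> n x) \<le> indicator (box a b) x *\<^sub>R norm (g x)"
          using \<phi>(2,4) by (auto simp: indicator_def abs_mult)
      qed
    qed auto
    then show ?thesis using 0[OF \<phi>(1)] by (simp add: LIMSEQ_const_iff)
  qed
  have "AE x in lborel. indicator (box (- (real N *\<^sub>R One)) (real N *\<^sub>R One)) x * g x = 0" for N
  proof (rule sigma_finite_measure.density_zero[OF sigma_finite_lborel])
    define B :: "plane set" where "B = box (- (real N *\<^sub>R One)) (real N *\<^sub>R One)"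
    have int: "integrable lborel (\<lambda>x. indicator B x * g x)"
      using set_integrable_borel_subset_ball[OF g, of B] bounded_box by (simp add: B_def)
    then show "integrable lborel (\<lambda>x. indicator (box (- (real N *\<^sub>R One)) (real N *\<^sub>R One)) x * g x)" by (simp add: B_def)
    let ?E = "range (\<lambda>(a, b). box a b::plane set)"
    fix Q assume "Q \<in> sets (lborel::plane measure)"
    then have "Q \<in> sigma_sets UNIV ?E" by (simp add: borel_eq_box)
    then have Q: "Q \<in> sigma_sets UNIV ?E" .
    have "Int_stable ?E" "?E \<subseteq> Pow UNIV" by (auto simp: Int_stable_def box_Int_box)
    from this Q have "(LBINT x. indicator Q x * (indicator B x * g x)) = 0"
    proof (induct rule: sigma_sets_induct_disjoint)
      case (basic D)
      then obtain a b where "D = box a b" by auto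
      moreover obtain a' b' where "box a b \<inter> B = box a' b'" unfolding B_def box_Int_box by blast
      ultimately have "\<And>x. indicator D x * (indicator B x * g x) = indicator (box a' b') x * g x"
        by (metis indicator_inter_arith mult.assoc)
      then show ?case using box0[of a' b'] by presburger
    next
      case empty then show ?case by simp
    next
      case (compl D)
      then have [measurable]: "D \<in> sets borel" by (simp add: borel_eq_box)
      have "(LBINT x. indicator (UNIV - D) x * (indicator B x * g x)) =
        (LBINT x. (indicator B x * g x) - indicator D x * (indicator B x * g x))"
        by (intro Bochner_Integration.integral_cong) (auto simp: indicator_def)
      also have "\<dots> = 0 - 0"
        using compl(2) box0[of "- (real N *\<^sub>R One)" "real N *\<^sub>R One"] int integrable_mult_indicator[OF _ int, of D]
        by (subst Bochner_Integration.integral_diff) (auto simp: B_def)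
      finally show ?case by simp
    next
      case (union D)
      then have [measurable]: "D i \<in> sets borel" for i by (auto simp: borel_eq_box)
      have "(LINT x:(\<Union>i. D i)|lborel. indicator B x * g x) = (\<Sum>i. (LINT x:D i|lborel. indicator B x * g x))"
        by (rule lebesgue_integral_countable_add)
          (use union(1) integrable_mult_indicator[OF _ int, of "\<Union>i. D i"] in \<open>auto simp: disjoint_family_on_def set_integrable_def\<close>)
      then show ?case using union(3) by (simp add: set_lebesgue_integral_def)
    qed
    then show "set_lebesgue_integral lborel Q (\<lambda>x. indicator (box (- (real N *\<^sub>R One)) (real N *\<^sub>R One)) x * g x) = 0"
      by (simp add: set_lebesgue_integral_def B_def)
  qed
  then have "AE x in lborel. \<forall>N. indicator (box (- (real N *\<^sub>R One)) (real N *\<^sub>R One)) x * g x = 0"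
    unfolding AE_all_countable by blast
  then show ?thesis
  proof eventually_elim
    case (elim x)
    have "x \<in> (\<Union>N. box (- (real N *\<^sub>R One)) (real N *\<^sub>R One))" by (simp only: UN_box_eq_UNIV UNIV_I)
    then obtain N where N: "x \<in> box (- (real N *\<^sub>R One)) (real N *\<^sub>R One)" by blast
    show ?case using elim[rule_format, of N] N by simp
  qed
qed

section \<open>Translations, products and local integrability\<close>

lemma borel_measurable_vec_nth [measurable (raw)]:
  fixes f :: "'a \<Rightarrow> real ^ 'n"
  assumes "f \<in> borel_measurable M"
  shows "(\<lambda>x. f x $ i) \<in> borel_measurable M"
  using measurable_compose[OF assms, of "\<lambda>x. x $ i" borel]
  by (simp add: borel_measurable_continuous_onI continuous_on_component continuous_on_id)

lemma lborel_distr_shift: "distr lborel borel (\<lambda>x. x + z) = (lborel :: 'a::euclidean_space measure)"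
proof -
  have "(\<lambda>x. x + z) = (+) z" by (auto simp: add.commute)
  then show ?thesis using lborel_distr_plus[of z] by simp
qed

lemma nn_integral_shift:
  fixes f :: "'a::euclidean_space \<Rightarrow> ennreal"
  assumes "f \<in> borel_measurable borel"
  shows "(\<integral>\<^sup>+x. f (x + z) \<partial>lborel) = (\<integral>\<^sup>+x. f x \<partial>lborel)"
  using nn_integral_distr[of "\<lambda>x. x + z" lborel borel f] assms by (simp add: lborel_distr_shift)

lemma integral_shift:
  fixes f :: "'a::euclidean_space \<Rightarrow> 'b::{banach, second_countable_topology}"
  assumes "f \<in> borel_measurable borel"
  shows "(LBINT x. f (x + z)) = (LBINT x. f x)"
  using integral_distr[of "\<lambda>x. x + z" lborel borel f] assms by (simp add: lborel_distr_shift)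

lemma integrable_shift:
  fixes f :: "'a::euclidean_space \<Rightarrow> 'b::{banach, second_countable_topology}"
  assumes "integrable lborel f"
  shows "integrable lborel (\<lambda>x. f (x + z))"
  using integrable_distr[of "\<lambda>x. x + z" lborel borel f] assms by (simp add: lborel_distr_shift)

lemma integrable_tensor:
  fixes f :: "'a::euclidean_space \<Rightarrow> real" and h :: "'b::euclidean_space \<Rightarrow> real"
  assumes "integrable lborel f" "integrable lborel h"
  shows "integrable (lborel \<Otimes>\<^sub>M lborel) (\<lambda>(x, y). f x * h y)"
    and "(\<integral>(x, y). f x * h y \<partial>(lborel \<Otimes>\<^sub>M lborel)) = (LBINT x. f x) * (LBINT y. h y)"
proof -
  have [measurable]: "f \<in> borel_measurable borel" "h \<in> borel_measurable borel" using assms by auto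
  show *: "integrable (lborel \<Otimes>\<^sub>M lborel) (\<lambda>(x, y). f x * h y)"
    by (rule lborel_pair.Fubini_integrable) (use assms in \<open>auto simp: abs_mult\<close>)
  show "(\<integral>(x, y). f x * h y \<partial>(lborel \<Otimes>\<^sub>M lborel)) = (LBINT x. f x) * (LBINT y. h y)"
    using lborel_pair.integral_fst'[OF *] by simp
qed

lemma locally_integrable_measurable: "locally_integrable g \<Longrightarrow> g \<in> borel_measurable borel"
  by (simp add: locally_integrable_def)

lemma locally_integrableI:
  assumes "g \<in> borel_measurable borel" "\<And>R. integrable lborel (\<lambda>x. indicator (cball 0 R) x *\<^sub>R g x)"
  shows "locally_integrable g"
  unfolding locally_integrable_def
proof (intro conjI allI impI)
  fix K :: "plane set" assume "compact K"
  then obtain R where "\<forall>x\<in>K. norm x \<le> R" by (meson bounded_iff compact_imp_bounded)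
  then have "K \<subseteq> cball 0 R" by auto
  then show "set_integrable lborel K g"
    using set_integrable_subset[of lborel "cball 0 R" g K] assms(2) \<open>compact K\<close>
    by (simp add: set_integrable_def borel_compact)
qed fact

lemma continuous_imp_locally_integrable:
  fixes g :: "plane \<Rightarrow> 'b::{banach, second_countable_topology}"
  assumes "continuous_on UNIV g"
  shows "locally_integrable g"
  unfolding locally_integrable_def set_integrable_def
proof (intro conjI allI impI)
  show "g \<in> borel_measurable borel" by (rule borel_measurable_continuous_onI[OF assms])
  show "integrable lborel (\<lambda>x. indicator K x *\<^sub>R g x)" if "compact K" for K
    by (rule borel_integrable_compact[OF that continuous_on_subset[OF assms]]) simp
qed

lemma locally_integrable_add:
  "locally_integrable f \<Longrightarrow> locally_integrable g \<Longrightarrow> locally_integrable (\<lambda>x. f x + g x)"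
  by (auto simp: locally_integrable_def intro!: set_integral_add)

lemma locally_integrable_scaleR: "locally_integrable g \<Longrightarrow> locally_integrable (\<lambda>x. c *\<^sub>R g x)"
  by (auto simp: locally_integrable_def intro!: set_integrable_scaleR_right)

lemma locally_integrable_component:
  fixes g :: "plane \<Rightarrow> plane"
  assumes "locally_integrable g"
  shows "locally_integrable (\<lambda>x. g x $ i)"
proof (rule locally_integrableI)
  have [measurable]: "g \<in> borel_measurable borel" using assms by (rule locally_integrable_measurable)
  show m: "(\<lambda>x. g x $ i) \<in> borel_measurable borel" by measurable
  fix R
  have "integrable lborel (\<lambda>x. norm (indicator (cball 0 R) x *\<^sub>R g x))"
    using set_integrable_borel_subset_ball[OF assms, of "cball 0 R"] by (intro integrable_norm) auto
  then show "integrable lborel (\<lambda>x. indicator (cball 0 R) x *\<^sub>R g x $ i)"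
    by (rule Bochner_Integration.integrable_bound)
      (use m in \<open>auto simp: indicator_def component_le_norm_cart\<close>)
qed

lemma locally_integrable_shift:
  assumes "locally_integrable g"
  shows "locally_integrable (\<lambda>x. g (x + z))"
proof (rule locally_integrableI)
  have [measurable]: "g \<in> borel_measurable borel" using assms by (rule locally_integrable_measurable)
  show "(\<lambda>x. g (x + z)) \<in> borel_measurable borel" by measurable
  fix R
  have "integrable lborel (\<lambda>x. indicator (cball z R) x *\<^sub>R g x)"
    by (rule set_integrable_borel_subset_ball[OF assms]) auto
  from integrable_shift[OF this, of z]
  show "integrable lborel (\<lambda>x. indicator (cball 0 R) x *\<^sub>R g (x + z))"
    by (rule Bochner_Integration.integrable_cong[THEN iffD1, rotated 2])
      (auto simp: indicator_def dist_norm norm_minus_commute)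
qed

text \<open>
  On a ball, \<open>norm (g x)\<close> is dominated by \<open>1 + (norm (g x))\<^sup>2\<close>.
\<close>

lemma locally_integrable_L2:
  fixes g :: "plane \<Rightarrow> 'b::{banach, second_countable_topology}"
  assumes [measurable]: "g \<in> borel_measurable borel" and "integrable lborel (\<lambda>x. (norm (g x))\<^sup>2)"
  shows "locally_integrable g"
proof (rule locally_integrableI)
  fix R :: real
  have "integrable lborel (\<lambda>x. indicator (cball 0 R) x + (norm (g x))\<^sup>2 :: real)"
    using assms(2) emeasure_bounded_finite[of "cball 0 R :: plane set"]
    by (intro Bochner_Integration.integrable_add integrable_real_indicator) auto
  then show "integrable lborel (\<lambda>x. indicator (cball 0 R) x *\<^sub>R g x)"
  proof (rule Bochner_Integration.integrable_bound)
    show "AE x in lborel. norm (indicator (cball 0 R) x *\<^sub>R g x) \<le> norm (indicator (cball 0 R) x + (norm (g x))\<^sup>2 :: real)"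
      by (intro AE_I2) (auto simp: indicator_def le_one_plus_square)
    show "(\<lambda>x. indicator (cball 0 R) x *\<^sub>R g x) \<in> borel_measurable lborel"
      by (intro borel_measurable_scaleR borel_measurable_indicator) (use assms in auto)
  qed
qed fact

section \<open>Weak gradients\<close>

lemma is_weak_gradientD:
  assumes "is_weak_gradient u g" "test_function \<phi>"
  shows "(LBINT x. u x * partial i \<phi> x) = - (LBINT x. g x $ i * \<phi> x)"
  using assms by (simp add: is_weak_gradient_def)

lemma is_weak_gradient_integrable:
  assumes "is_weak_gradient u g" "test_function \<phi>"
  shows "integrable lborel (\<lambda>x. u x * partial i \<phi> x)" "integrable lborel (\<lambda>x. g x $ i * \<phi> x)"
proof -
  obtain K R where *: "\<And>x. R < norm x \<Longrightarrow> \<phi> x = 0" "\<And>x i. R < norm x \<Longrightarrow> partial i \<phi> x = 0"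
    "\<And>x. \<bar>\<phi> x\<bar> \<le> K" "\<And>x i. \<bar>partial i \<phi> x\<bar> \<le> K"
    using test_function_bounded[OF assms(2)] by metis
  have l: "locally_integrable u" "locally_integrable g" using assms by (auto simp: is_weak_gradient_def)
  show "integrable lborel (\<lambda>x. u x * partial i \<phi> x)"
    using integrable_times_test_function[OF l(1) test_functionD(5)[OF assms(2)] *(4,2)] by (simp add: mult.commute)
  show "integrable lborel (\<lambda>x. g x $ i * \<phi> x)"
    using integrable_times_test_function[OF locally_integrable_component[OF l(2)] test_functionD(4)[OF assms(2)] *(3,1)]
    by (simp add: mult.commute)
qed

lemma is_weak_gradient_unique:
  assumes "is_weak_gradient u g" "is_weak_gradient u h"
  shows "AE x in lborel. g x = h x"
proof -
  have l: "locally_integrable g" "locally_integrable h" using assms by (auto simp: is_weak_gradient_def)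
  have "AE x in lborel. g x $ i + (-1) *\<^sub>R h x $ i = 0" for i
  proof (rule du_Bois_Reymond)
    show "locally_integrable (\<lambda>x. g x $ i + (-1) *\<^sub>R h x $ i)"
      by (intro locally_integrable_add locally_integrable_scaleR locally_integrable_component l)
    fix \<phi> assume t: "test_function \<phi>"
    have "(LBINT x. (g x $ i + (-1) *\<^sub>R h x $ i) * \<phi> x) = (LBINT x. g x $ i * \<phi> x - h x $ i * \<phi> x)"
      by (simp add: algebra_simps)
    also have "\<dots> = (LBINT x. g x $ i * \<phi> x) - (LBINT x. h x $ i * \<phi> x)"
      by (intro Bochner_Integration.integral_diff is_weak_gradient_integrable(2)[OF assms(1) t]
          is_weak_gradient_integrable(2)[OF assms(2) t])
    also have "\<dots> = 0"
      using is_weak_gradientD[OF assms(1) t, of i] is_weak_gradientD[OF assms(2) t, of i] by simp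
    finally show "(LBINT x. (g x $ i + (-1) *\<^sub>R h x $ i) * \<phi> x) = 0" .
  qed
  from this[of 1] this[of 2] show ?thesis
    by eventually_elim (simp add: vec_eq_iff forall_2)
qed

lemma is_weak_gradient_add:
  assumes "is_weak_gradient u g" "is_weak_gradient v h"
  shows "is_weak_gradient (\<lambda>x. u x + v x) (\<lambda>x. g x + h x)"
  unfolding is_weak_gradient_def
proof (intro conjI allI impI)
  show "locally_integrable (\<lambda>x. u x + v x)" "locally_integrable (\<lambda>x. g x + h x)"
    using assms by (auto simp: is_weak_gradient_def intro: locally_integrable_add)
  fix \<phi> i assume t: "test_function \<phi>"
  show "(LBINT x. (u x + v x) * partial i \<phi> x) = - (LBINT x. (g x + h x) $ i * \<phi> x)"
    using assms[THEN is_weak_gradientD, OF t, of i] assms[THEN is_weak_gradient_integrable(1), OF t, of i]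
      assms[THEN is_weak_gradient_integrable(2), OF t, of i]
    by (simp add: algebra_simps)
qed

lemma is_weak_gradient_scaleR:
  assumes "is_weak_gradient u g"
  shows "is_weak_gradient (\<lambda>x. c * u x) (\<lambda>x. c *\<^sub>R g x)"
  unfolding is_weak_gradient_def
proof (intro conjI allI impI)
  show "locally_integrable (\<lambda>x. c * u x)" "locally_integrable (\<lambda>x. c *\<^sub>R g x)"
    using assms locally_integrable_scaleR[of u c] by (auto simp: is_weak_gradient_def intro: locally_integrable_scaleR)
  fix \<phi> i assume t: "test_function \<phi>"
  show "(LBINT x. (c * u x) * partial i \<phi> x) = - (LBINT x. (c *\<^sub>R g x) $ i * \<phi> x)"
    using is_weak_gradientD[OF assms t, of i]
    by (simp add: mult.assoc)
qed

lemma is_weak_gradient_shift: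
  assumes "is_weak_gradient u g"
  shows "is_weak_gradient (\<lambda>x. u (x + z)) (\<lambda>x. g (x + z))"
  unfolding is_weak_gradient_def
proof (intro conjI allI impI)
  show "locally_integrable (\<lambda>x. u (x + z))" "locally_integrable (\<lambda>x. g (x + z))"
    using assms by (auto simp: is_weak_gradient_def intro: locally_integrable_shift)
  have [measurable]: "u \<in> borel_measurable borel" "g \<in> borel_measurable borel"
    using assms by (auto simp: is_weak_gradient_def intro: locally_integrable_measurable)
  fix \<phi> i assume t: "test_function \<phi>"
  have t': "test_function (\<lambda>x. \<phi> (x + - z))" using t by (rule test_function_shift)
  note [measurable] = test_functionD(4,5)[OF t]
  have "(LBINT x. u (x + z) * partial i \<phi> x) = (LBINT x. u x * partial i \<phi> (x + - z))"
    using integral_shift[of "\<lambda>x. u x * partial i \<phi> (x + - z)" z] by simp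
  also have "\<dots> = (LBINT x. u x * partial i (\<lambda>x. \<phi> (x + - z)) x)"
    by (simp only: partial_shift[OF test_functionD(1)[OF t]])
  also have "\<dots> = - (LBINT x. g x $ i * \<phi> (x + - z))"
    using is_weak_gradientD[OF assms t'] .
  also have "(LBINT x. g x $ i * \<phi> (x + - z)) = (LBINT x. g (x + z) $ i * \<phi> x)"
    using integral_shift[of "\<lambda>x. g x $ i * \<phi> (x + - z)" z] by simp
  finally show "(LBINT x. u (x + z) * partial i \<phi> x) = - (LBINT x. g (x + z) $ i * \<phi> x)" .
qed

lemma test_function_line_integral:
  assumes "test_function \<phi>" "0 \<le> t"
  shows "\<phi> (x + (- t) *\<^sub>R axis i 1) - \<phi> x = - (LBINT s. indicator {0..t} s * partial i \<phi> (x + (- s) *\<^sub>R axis i 1))"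
proof -
  have "((\<lambda>s. \<phi> (x + (- s) *\<^sub>R axis i 1)) has_vector_derivative - partial i \<phi> (x + (- s) *\<^sub>R axis i 1)) (at s within {0..t})" for s
  proof -
    have "((\<lambda>s. x + (- s) *\<^sub>R axis i (1::real)) has_derivative (\<lambda>h. (- h) *\<^sub>R axis i 1)) (at s within {0..t})"
      by (auto intro!: derivative_eq_intros)
    from has_derivative_compose[OF this has_derivative_frechet[OF test_functionD(1)[OF assms(1)]]]
    have "((\<lambda>s. \<phi> (x + (- s) *\<^sub>R axis i 1)) has_derivative
        (\<lambda>h. frechet_derivative \<phi> (at (x + (- s) *\<^sub>R axis i 1)) ((- h) *\<^sub>R axis i 1))) (at s within {0..t})" .
    moreover have "frechet_derivative \<phi> (at y) ((- h) *\<^sub>R axis i 1) = h *\<^sub>R (- partial i \<phi> y)" for y h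
      using linear_scale[OF has_derivative_linear[OF has_derivative_frechet[OF test_functionD(1)[OF assms(1)]]], of y "- h" "axis i 1"]
      by (simp add: partial_def)
    ultimately show ?thesis by (simp add: has_vector_derivative_def)
  qed
  moreover have "continuous_on {0..t} (\<lambda>s. - partial i \<phi> (x + (- s) *\<^sub>R axis i 1))"
    by (intro continuous_intros continuous_on_compose2[OF test_functionD(3)[OF assms(1)]]) auto
  ultimately have "(LBINT s. indicator {0..t} s *\<^sub>R - partial i \<phi> (x + (- s) *\<^sub>R axis i 1)) =
      \<phi> (x + (- t) *\<^sub>R axis i 1) - \<phi> (x + (- 0) *\<^sub>R axis i 1)"
    using assms(2) by (intro integral_FTC_atLeastAtMost)
  then show ?thesis by simp
qed

text \<open>
  The integrand vanishes unless \<open>norm x \<le> R + t\<close>, hence it is dominated by a product of a function of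
  \<open>s\<close> and a function of \<open>x\<close>. This and the next lemma justify Fubini's theorem for integrals along
  segments.
\<close>

lemma integrable_segments_kernel:
  fixes u :: "plane \<Rightarrow> real"
  assumes u: "locally_integrable u" and [measurable]: "\<psi> \<in> borel_measurable borel"
    and \<psi>: "\<And>x. \<bar>\<psi> x\<bar> \<le> K" "\<And>x. R < norm x \<Longrightarrow> \<psi> x = 0"
  shows "integrable (lborel \<Otimes>\<^sub>M lborel) (\<lambda>(s, x). indicator {0..t} s * (u x * \<psi> (x + (- s) *\<^sub>R axis i 1)))"
proof (rule Bochner_Integration.integrable_bound)
  have [measurable]: "u \<in> borel_measurable borel" using u by (rule locally_integrable_measurable)
  show "integrable (lborel \<Otimes>\<^sub>M lborel) (\<lambda>(s, x). indicator {0..t} s * (K * norm (indicator (cball 0 (R + t)) x *\<^sub>R u x)))"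
    by (intro integrable_tensor integrable_real_indicator integrable_mult_right integrable_norm
        set_integrable_borel_subset_ball[OF u]) (auto simp: emeasure_lborel_Icc_eq)
  show "(\<lambda>(s, x). indicator {0..t} s * (u x * \<psi> (x + (- s) *\<^sub>R axis i 1))) \<in> borel_measurable (lborel \<Otimes>\<^sub>M lborel)"
    by measurable
  have "\<bar>u x * \<psi> (x + (- s) *\<^sub>R axis i 1)\<bar> \<le> \<bar>K * norm (indicator (cball 0 (R + t)) x *\<^sub>R u x)\<bar>" if "s \<in> {0..t}" for s x
  proof (cases "norm x \<le> R + t")
    case True
    have "\<bar>u x\<bar> * \<bar>\<psi> (x + (- s) *\<^sub>R axis i 1)\<bar> \<le> \<bar>u x\<bar> * \<bar>K\<bar>"
      using \<psi>(1)[of "x + (- s) *\<^sub>R axis i 1"] by (intro mult_left_mono) auto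
    then show ?thesis using True by (simp add: abs_mult mult.commute)
  next
    case False
    have "norm ((- s) *\<^sub>R axis i (1::real)) \<le> t" using that by simp
    then have "R < norm (x + (- s) *\<^sub>R axis i 1)"
      using False norm_triangle_ineq4[of "x + (- s) *\<^sub>R axis i 1" "(- s) *\<^sub>R axis i 1"] by (simp del: norm_scaleR)
    then show ?thesis using \<psi>(2) by simp
  qed
  then show "AE p in lborel \<Otimes>\<^sub>M lborel. norm (case p of (s, x) \<Rightarrow> indicator {0..t} s * (u x * \<psi> (x + (- s) *\<^sub>R axis i 1))) \<le>
      norm (case p of (s, x) \<Rightarrow> indicator {0..t} s * (K * norm (indicator (cball 0 (R + t)) x *\<^sub>R u x)))"
    by (intro AE_I2) (auto simp: indicator_def)
qed

lemma integrable_segments: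
  fixes f :: "plane \<Rightarrow> real"
  assumes f: "locally_integrable f" and [measurable]: "\<psi> \<in> borel_measurable borel"
    and \<psi>: "\<And>x. \<bar>\<psi> x\<bar> \<le> K" "\<And>x. R < norm x \<Longrightarrow> \<psi> x = 0"
  shows "integrable (lborel \<Otimes>\<^sub>M lborel) (\<lambda>(s, x). indicator {0..t} s * (f (x + s *\<^sub>R axis i 1) * \<psi> x))"
proof -
  have [measurable]: "f \<in> borel_measurable borel" using f by (rule locally_integrable_measurable)
  have i: "integrable (lborel \<Otimes>\<^sub>M lborel) (\<lambda>(s, x). indicator {0..t} s * (f x * \<psi> (x + (- s) *\<^sub>R axis i 1)))"
    by (rule integrable_segments_kernel[OF assms])
  show ?thesis
  proof (rule lborel_pair.Fubini_integrable)
    show "AE s in lborel. integrable lborel (\<lambda>x. case (s, x) of (s, x) \<Rightarrow> indicator {0..t} s * (f (x + s *\<^sub>R axis i 1) * \<psi> x))"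
      using lborel_pair.AE_integrable_fst'[OF i]
    proof eventually_elim
      case (elim s)
      from integrable_shift[OF this, of "s *\<^sub>R axis i 1"] show ?case by simp
    qed
    have "(LBINT x. norm (indicator {0..t} s * (f x * \<psi> (x + (- s) *\<^sub>R axis i 1)))) =
        (LBINT x. norm (indicator {0..t} s * (f (x + s *\<^sub>R axis i 1) * \<psi> x)))" for s :: real
      using integral_shift[of "\<lambda>x. norm (indicator {0..t} s * (f x * \<psi> (x + (- s) *\<^sub>R axis i 1)))" "s *\<^sub>R axis i 1"]
      by simp
    then show "integrable lborel (\<lambda>s. LBINT x. norm (case (s, x) of (s, x) \<Rightarrow> indicator {0..t} s * (f (x + s *\<^sub>R axis i 1) * \<psi> x)))"
      using lborel_pair.integrable_fst'[OF integrable_norm[OF i]] by simp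
  qed measurable
qed

text \<open>
  Both sides agree when tested with \<open>\<phi>\<close>: shifting the increment of \<open>u\<close> over to \<open>\<phi>\<close> turns it into
  the integral of \<open>partial i \<phi>\<close> along the segment, the definition of the weak gradient moves the
  derivative back to \<open>u\<close>, and Fubini's theorem collects the terms. The Sobolev inequalities and the
  compactness argument start from this identity.
\<close>

theorem weak_gradient_shift_identity:
  assumes wg: "is_weak_gradient u g" and t: "0 \<le> t"
  shows "AE x in lborel. u (x + t *\<^sub>R axis i 1) - u x = (LBINT s. indicator {0..t} s * g (x + s *\<^sub>R axis i 1) $ i)"
proof -
  define G where "G x = (LBINT s. indicator {0..t} s * g (x + s *\<^sub>R axis i 1) $ i)" for x
  let ?e = "axis i (1::real) :: plane"
  have lu: "locally_integrable u" and lg: "locally_integrable (\<lambda>x. g x $ i)"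
    using wg by (auto simp: is_weak_gradient_def intro: locally_integrable_component)
  have [measurable]: "u \<in> borel_measurable borel" "(\<lambda>x. g x $ i) \<in> borel_measurable borel" "g \<in> borel_measurable borel"
    using lu lg wg by (auto intro: locally_integrable_measurable simp: is_weak_gradient_def)
  have G_int: "integrable lborel (\<lambda>x. G x * \<psi> x)" "(LBINT x. G x * \<psi> x) = (LBINT s. LBINT x. indicator {0..t} s * (g (x + s *\<^sub>R ?e) $ i * \<psi> x))"
    if [measurable]: "\<psi> \<in> borel_measurable borel" and \<psi>: "\<And>x. \<bar>\<psi> x\<bar> \<le> K" "\<And>x. R < norm x \<Longrightarrow> \<psi> x = 0" for \<psi> K R
  proof -
    note i = integrable_segments[OF lg that, where t = t and i = i]
    have "(LBINT s. indicator {0..t} s * (g (x + s *\<^sub>R ?e) $ i * \<psi> x)) = G x * \<psi> x" for x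
      unfolding G_def integral_mult_left_zero[symmetric] by (simp add: mult.assoc)
    then show "integrable lborel (\<lambda>x. G x * \<psi> x)" "(LBINT x. G x * \<psi> x) = (LBINT s. LBINT x. indicator {0..t} s * (g (x + s *\<^sub>R ?e) $ i * \<psi> x))"
      using lborel_pair.integrable_snd[OF i] lborel_pair.integral_snd[OF i] lborel_pair.integral_fst[OF i]
      by (simp_all add: mult.assoc)
  qed
  have lG: "locally_integrable G"
  proof (rule locally_integrableI)
    show "G \<in> borel_measurable borel" unfolding G_def by measurable
    show "integrable lborel (\<lambda>x. indicator (cball 0 R) x *\<^sub>R G x)" for R
    proof -
      have "(indicator (cball 0 R) :: plane \<Rightarrow> real) \<in> borel_measurable borel"
        by (rule borel_measurable_indicator) simp
      from G_int(1)[OF this, of 1 R] show ?thesis by (simp add: indicator_def mult.commute)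
    qed
  qed
  have "AE x in lborel. (u (x + t *\<^sub>R ?e) + (-1) *\<^sub>R u x) + (-1) *\<^sub>R G x = 0"
  proof (rule du_Bois_Reymond)
    show "locally_integrable (\<lambda>x. (u (x + t *\<^sub>R ?e) + (-1) *\<^sub>R u x) + (-1) *\<^sub>R G x)"
      by (intro locally_integrable_add locally_integrable_scaleR lu lG locally_integrable_shift)
    fix \<phi> assume tf: "test_function \<phi>"
    note [measurable] = test_functionD(4,5)[OF tf]
    obtain K R where *: "\<And>x. R < norm x \<Longrightarrow> \<phi> x = 0" "\<And>x. R < norm x \<Longrightarrow> partial i \<phi> x = 0"
      "\<And>x. \<bar>\<phi> x\<bar> \<le> K" "\<And>x. \<bar>partial i \<phi> x\<bar> \<le> K"
      using test_function_bounded[OF tf] by metis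
    note i2 = integrable_segments_kernel[OF lu test_functionD(5)[OF tf] *(4,2), where t = t and i = i]
    have il: "integrable lborel (\<lambda>x. u (x + t *\<^sub>R ?e) * \<phi> x)" "integrable lborel (\<lambda>x. u x * \<phi> x)"
      using integrable_times_test_function[OF locally_integrable_shift[OF lu] test_functionD(4)[OF tf] *(3,1)]
        integrable_times_test_function[OF lu test_functionD(4)[OF tf] *(3,1)] by (simp_all add: mult.commute)
    have il2: "integrable lborel (\<lambda>x. u x * \<phi> (x + (- t) *\<^sub>R ?e))"
      using integrable_shift[OF il(1), of "(- t) *\<^sub>R ?e"] by simp
    have "(LBINT x. u (x + t *\<^sub>R ?e) * \<phi> x) - (LBINT x. u x * \<phi> x) =
        (LBINT x. u x * \<phi> (x + (- t) *\<^sub>R ?e)) - (LBINT x. u x * \<phi> x)"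
      using integral_shift[of "\<lambda>x. u x * \<phi> (x + (- t) *\<^sub>R ?e)" "t *\<^sub>R ?e"] by simp
    also have "\<dots> = (LBINT x. u x * (\<phi> (x + (- t) *\<^sub>R ?e) - \<phi> x))"
      using il2 il(2) by (simp add: right_diff_distrib)
    also have "\<dots> = (LBINT x. - (LBINT s. indicator {0..t} s * (u x * partial i \<phi> (x + (- s) *\<^sub>R ?e))))"
      unfolding test_function_line_integral[OF tf t]
      by (intro Bochner_Integration.integral_cong refl) (simp flip: integral_mult_right_zero add: mult.left_commute)
    also have "\<dots> = - (LBINT s. LBINT x. indicator {0..t} s * (u x * partial i \<phi> (x + (- s) *\<^sub>R ?e)))"
      using lborel_pair.integral_snd[OF i2] lborel_pair.integral_fst[OF i2] by simp
    also have "\<dots> = (LBINT s. LBINT x. indicator {0..t} s * (g (x + s *\<^sub>R ?e) $ i * \<phi> x))"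
    proof -
      have "(LBINT x. u x * partial i \<phi> (x + (- s) *\<^sub>R ?e)) = - (LBINT x. g (x + s *\<^sub>R ?e) $ i * \<phi> x)" for s
        using is_weak_gradientD[OF is_weak_gradient_shift[OF wg, of "s *\<^sub>R ?e"] tf, of i]
          integral_shift[of "\<lambda>x. u x * partial i \<phi> (x + (- s) *\<^sub>R ?e)" "s *\<^sub>R ?e"] by simp
      then show ?thesis by simp
    qed
    also have "\<dots> = (LBINT x. G x * \<phi> x)"
      using G_int(2)[OF test_functionD(4)[OF tf] *(3,1)] by simp
    finally show "(LBINT x. ((u (x + t *\<^sub>R ?e) + (-1) *\<^sub>R u x) + (-1) *\<^sub>R G x) * \<phi> x) = 0"
      using il G_int(1)[OF test_functionD(4)[OF tf] *(3,1)] by (simp add: left_diff_distrib)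
  qed
  then show ?thesis by eventually_elim (simp add: G_def)
qed

text \<open>
  Translation invariance makes the integral over \<open>x\<close> independent of \<open>s\<close>.
\<close>

lemma nn_integral_segments:
  fixes f :: "plane \<Rightarrow> ennreal"
  assumes [measurable]: "f \<in> borel_measurable borel" and t: "0 \<le> t"
  shows "(\<integral>\<^sup>+x. \<integral>\<^sup>+s. indicator {0..t} s * f (x + s *\<^sub>R axis i 1) \<partial>lborel \<partial>lborel) = ennreal t * (\<integral>\<^sup>+x. f x \<partial>lborel)"
proof -
  have "(\<integral>\<^sup>+x. \<integral>\<^sup>+s. indicator {0..t} s * f (x + s *\<^sub>R axis i 1) \<partial>lborel \<partial>lborel) =
     (\<integral>\<^sup>+s. \<integral>\<^sup>+x. indicator {0..t} s * f (x + s *\<^sub>R axis i 1) \<partial>lborel \<partial>lborel)"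
    by (rule lborel_pair.Fubini') measurable
  also have "\<dots> = (\<integral>\<^sup>+s. indicator {0..t} s * (\<integral>\<^sup>+x. f x \<partial>lborel) \<partial>lborel)"
    by (simp add: nn_integral_cmult nn_integral_shift)
  also have "\<dots> = ennreal t * (\<integral>\<^sup>+x. f x \<partial>lborel)"
    using t by (simp add: nn_integral_multc)
  finally show ?thesis .
qed

text \<open>
  The shift identity and the Cauchy--Schwarz inequality on the segment bound the squared increment by
  \<open>t\<close> times the integral of \<open>(norm g)\<^sup>2\<close> along the segment, which contributes another factor \<open>t\<close> after
  integration over \<open>x\<close>.
\<close>

lemma weak_gradient_L2_shift:
  assumes wg: "is_weak_gradient u g" and t: "0 \<le> t"
  shows "(\<integral>\<^sup>+x. ennreal ((u (x + t *\<^sub>R axis i 1) - u x)\<^sup>2) \<partial>lborel) \<le> ennreal (t\<^sup>2) * (\<integral>\<^sup>+x. ennreal ((norm (g x))\<^sup>2) \<partial>lborel)"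
proof -
  have [measurable]: "u \<in> borel_measurable borel" "g \<in> borel_measurable borel"
    using wg by (auto intro: locally_integrable_measurable simp: is_weak_gradient_def)
  have "AE x in lborel. ennreal ((u (x + t *\<^sub>R axis i 1) - u x)\<^sup>2) \<le>
      ennreal t * (\<integral>\<^sup>+s. indicator {0..t} s * ennreal ((norm (g (x + s *\<^sub>R axis i 1)))\<^sup>2) \<partial>lborel)"
    using weak_gradient_shift_identity[OF assms, of i]
  proof eventually_elim
    case (elim x)
    let ?I = "\<integral>\<^sup>+s. indicator {0..t} s * ennreal (norm (g (x + s *\<^sub>R axis i 1))) \<partial>lborel"
    have "ennreal \<bar>u (x + t *\<^sub>R axis i 1) - u x\<bar> \<le> (\<integral>\<^sup>+s. ennreal (norm (indicator {0..t} s * g (x + s *\<^sub>R axis i 1) $ i)) \<partial>lborel)"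
    proof (cases "integrable lborel (\<lambda>s. indicator {0..t} s * g (x + s *\<^sub>R axis i 1) $ i)")
      case True
      then show ?thesis unfolding elim using integral_norm_bound_ennreal[OF True] by simp
    next
      case False
      then show ?thesis unfolding elim by (simp add: not_integrable_integral_eq)
    qed
    also have "\<dots> \<le> ?I"
      by (intro nn_integral_mono) (auto simp: indicator_def component_le_norm_cart ennreal_leI)
    finally have "ennreal \<bar>u (x + t *\<^sub>R axis i 1) - u x\<bar> ^ 2 \<le> ?I ^ 2" by (rule power_mono) simp
    also have "\<dots> \<le> (\<integral>\<^sup>+s. (indicator {0..t} s)\<^sup>2 \<partial>lborel) * (\<integral>\<^sup>+s. (indicator {0..t} s * ennreal (norm (g (x + s *\<^sub>R axis i 1))))\<^sup>2 \<partial>lborel)"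
    proof -
      have "?I = (\<integral>\<^sup>+s. indicator {0..t} s * (indicator {0..t} s * ennreal (norm (g (x + s *\<^sub>R axis i 1)))) \<partial>lborel)"
        by (intro nn_integral_cong) (auto simp: indicator_def)
      then show ?thesis by (simp only:) (rule Cauchy_Schwarz_nn_integral; measurable)
    qed
    also have "(\<integral>\<^sup>+s. (indicator {0..t} s)\<^sup>2 \<partial>lborel) = (\<integral>\<^sup>+s. indicator {0..t} s \<partial>lborel)"
      by (intro nn_integral_cong) (auto simp: indicator_def)
    also have "\<dots> = ennreal t" using t by simp
    also have "(\<integral>\<^sup>+s. (indicator {0..t} s * ennreal (norm (g (x + s *\<^sub>R axis i 1))))\<^sup>2 \<partial>lborel) =
       (\<integral>\<^sup>+s. indicator {0..t} s * ennreal ((norm (g (x + s *\<^sub>R axis i 1)))\<^sup>2) \<partial>lborel)"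
      by (intro nn_integral_cong) (auto simp: indicator_def ennreal_power)
    finally show ?case by (simp add: ennreal_power)
  qed
  then have "(\<integral>\<^sup>+x. ennreal ((u (x + t *\<^sub>R axis i 1) - u x)\<^sup>2) \<partial>lborel) \<le>
     (\<integral>\<^sup>+x. ennreal t * (\<integral>\<^sup>+s. indicator {0..t} s * ennreal ((norm (g (x + s *\<^sub>R axis i 1)))\<^sup>2) \<partial>lborel) \<partial>lborel)"
    by (rule nn_integral_mono_AE)
  also have "\<dots> = ennreal t * (ennreal t * (\<integral>\<^sup>+x. ennreal ((norm (g x))\<^sup>2) \<partial>lborel))"
    using t by (subst nn_integral_cmult) (simp_all add: nn_integral_segments[where f = "\<lambda>x. ennreal ((norm (g x))\<^sup>2)"])
  finally show ?thesis using t by (simp add: mult.assoc[symmetric] ennreal_mult[symmetric] power2_eq_square)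
qed

text \<open>
  The integral of \<open>\<phi> (x - e) - \<phi> x\<close> over \<open>x\<close> is zero by translation invariance. Written as an integral
  along unit segments, it is minus the integral of the derivative.
\<close>

lemma test_function_integral_partial:
  assumes "test_function \<phi>"
  shows "(LBINT x. partial i \<phi> x) = 0"
proof -
  note [measurable] = test_functionD(4,5)[OF assms]
  obtain K R where *: "\<And>x. R < norm x \<Longrightarrow> \<phi> x = 0" "\<And>x. R < norm x \<Longrightarrow> partial i \<phi> x = 0"
      "\<And>x. \<bar>\<phi> x\<bar> \<le> K" "\<And>x. \<bar>partial i \<phi> x\<bar> \<le> K"
    using test_function_bounded[OF assms] by metis
  have one: "locally_integrable (\<lambda>x. 1 :: real)"
    by (intro continuous_imp_locally_integrable continuous_intros)
  have i: "integrable lborel \<phi>"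
    using integrable_times_test_function[OF one test_functionD(4)[OF assms] *(3,1)] by simp
  let ?e = "axis i (1::real) :: plane"
  note i2 = integrable_segments_kernel[OF one test_functionD(5)[OF assms] *(4,2), where t = 1 and i = i]
  have "0 = (LBINT x. \<phi> (x + (- 1) *\<^sub>R ?e) - \<phi> x)"
    using integrable_shift[OF i, of "(- 1) *\<^sub>R ?e"] i integral_shift[of \<phi> "(- 1) *\<^sub>R ?e"] by simp
  also have "\<dots> = - (LBINT x. LBINT s. indicator {0..1} s * partial i \<phi> (x + (- s) *\<^sub>R ?e))"
    by (subst test_function_line_integral[OF assms]) auto
  also have "\<dots> = - (LBINT s. LBINT x. indicator {0..1} s * partial i \<phi> (x + (- s) *\<^sub>R ?e))"
    using lborel_pair.integral_snd[OF i2] lborel_pair.integral_fst[OF i2] by simp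
  also have "\<dots> = - (\<integral>s. indicator {0..1} s * (LBINT x. partial i \<phi> x) \<partial>(lborel::real measure))"
    by (simp only: integral_mult_right_zero integral_shift[OF test_functionD(5)[OF assms]])
  finally show ?thesis by simp
qed

lemma test_function_weak_gradient:
  assumes "test_function u"
  shows "is_weak_gradient u (\<lambda>x. \<chi> i. partial i u x)"
  unfolding is_weak_gradient_def
proof (intro conjI allI impI)
  note [measurable] = test_functionD(4,5)[OF assms]
  have c: "continuous_on UNIV (\<lambda>x. \<chi> i. partial i u x)"
    by (intro continuous_on_vec_lambda test_functionD(3)[OF assms])
  show "locally_integrable u" "locally_integrable (\<lambda>x. \<chi> i. partial i u x)"
    by (intro continuous_imp_locally_integrable c test_functionD(2)[OF assms])+
  fix \<phi> i assume t: "test_function \<phi>"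
  note [measurable] = test_functionD(4,5)[OF t]
  obtain K R where *: "\<And>x. R < norm x \<Longrightarrow> \<phi> x = 0" "\<And>x i. R < norm x \<Longrightarrow> partial i \<phi> x = 0"
      "\<And>x. \<bar>\<phi> x\<bar> \<le> K" "\<And>x i. \<bar>partial i \<phi> x\<bar> \<le> K"
    using test_function_bounded[OF t] by metis
  have lu: "locally_integrable u" "locally_integrable (partial i u)"
    by (intro continuous_imp_locally_integrable test_functionD(2,3)[OF assms])+
  have prod: "test_function (\<lambda>x. u x * \<phi> x)"
    using assms t *(1) by (intro test_functionI[of _ R] Ck_mult) (auto simp: test_function_def not_less[symmetric])
  have p: "partial i (\<lambda>x. u x * \<phi> x) = (\<lambda>x. u x * partial i \<phi> x + partial i u x * \<phi> x)"
    using partial_eq[OF has_derivative_mult[OF has_derivative_frechet[OF test_functionD(1)[OF assms]] has_derivative_frechet[OF test_functionD(1)[OF t]]]]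
    by (intro ext) (simp add: partial_def)
  have "integrable lborel (\<lambda>x. u x * partial i \<phi> x)" "integrable lborel (\<lambda>x. partial i u x * \<phi> x)"
    using integrable_times_test_function[OF lu(1) test_functionD(5)[OF t] *(4,2)]
      integrable_times_test_function[OF lu(2) test_functionD(4)[OF t] *(3,1)] by (simp_all add: mult.commute)
  then have "(LBINT x. u x * partial i \<phi> x) + (LBINT x. partial i u x * \<phi> x) = 0"
    using test_function_integral_partial[OF prod, of i] unfolding p by simp
  then show "(LBINT x. u x * partial i \<phi> x) = - (LBINT x. (\<chi> i. partial i u x) $ i * \<phi> x)" by simp
qed

section \<open>The space H1 and the Dirichlet energy\<close>

lemma weak_grad_eqI:
  assumes "is_weak_gradient u g"
  shows "is_weak_gradient u (weak_grad u)" "AE x in lborel. weak_grad u x = g x"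
proof -
  show "is_weak_gradient u (weak_grad u)"
    unfolding weak_grad_def using someI[of "is_weak_gradient u" g] assms by simp
  then show "AE x in lborel. weak_grad u x = g x" using assms by (rule is_weak_gradient_unique)
qed

lemma is_weak_gradient_measurable:
  assumes "is_weak_gradient u g"
  shows "u \<in> borel_measurable borel" "g \<in> borel_measurable borel"
  using assms by (auto intro: locally_integrable_measurable simp: is_weak_gradient_def)

text \<open>
  By uniqueness, \<open>A u\<close> can be computed from any weak gradient, not only from the chosen one.
\<close>

lemma H1_I:
  assumes "u \<in> borel_measurable borel" "integrable lborel (\<lambda>x. (u x)\<^sup>2)" "is_weak_gradient u g"
    "integrable lborel (\<lambda>x. (norm (g x))\<^sup>2)"
  shows "u \<in> H1" "A u = (LBINT x. (norm (g x))\<^sup>2)"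
proof -
  show "u \<in> H1" using assms unfolding H1_def by blast
  note [measurable] = is_weak_gradient_measurable[OF assms(3)] is_weak_gradient_measurable[OF weak_grad_eqI(1)[OF assms(3)]]
  show "A u = (LBINT x. (norm (g x))\<^sup>2)"
    unfolding A_def by (rule integral_cong_AE) (use weak_grad_eqI(2)[OF assms(3)] in \<open>auto elim: eventually_mono\<close>)
qed

lemma H1_D:
  assumes "u \<in> H1"
  shows "u \<in> borel_measurable borel" "integrable lborel (\<lambda>x. (u x)\<^sup>2)" "is_weak_gradient u (weak_grad u)"
    "integrable lborel (\<lambda>x. (norm (weak_grad u x))\<^sup>2)" "weak_grad u \<in> borel_measurable borel"
proof -
  show "u \<in> borel_measurable borel" "integrable lborel (\<lambda>x. (u x)\<^sup>2)" using assms by (auto simp: H1_def)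
  obtain g where g: "is_weak_gradient u g" "integrable lborel (\<lambda>x. (norm (g x))\<^sup>2)" using assms by (auto simp: H1_def)
  show w: "is_weak_gradient u (weak_grad u)" using weak_grad_eqI[OF g(1)] by simp
  note [measurable] = is_weak_gradient_measurable[OF g(1)] is_weak_gradient_measurable[OF w]
  show "weak_grad u \<in> borel_measurable borel" by measurable
  show "integrable lborel (\<lambda>x. (norm (weak_grad u x))\<^sup>2)"
    by (rule integrable_cong_AE_imp[OF g(2)]) (use weak_grad_eqI(2)[OF g(1)] in \<open>auto elim: eventually_mono\<close>)
qed

lemma parallelogram_identity:
  fixes a b :: "'a::real_inner"
  shows "(norm (a + b))\<^sup>2 + (norm (a - b))\<^sup>2 = 2 * (norm a)\<^sup>2 + 2 * (norm b)\<^sup>2"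
  by (simp add: power2_norm_eq_inner inner_simps)

lemma integrable_square_add:
  fixes f g :: "'a \<Rightarrow> 'b::{banach, real_inner, second_countable_topology}"
  assumes [measurable]: "f \<in> borel_measurable M" "g \<in> borel_measurable M"
    and i: "integrable M (\<lambda>x. (norm (f x))\<^sup>2)" "integrable M (\<lambda>x. (norm (g x))\<^sup>2)"
  shows "integrable M (\<lambda>x. (norm (f x + g x))\<^sup>2)"
proof (rule integrable_dominated)
  show "integrable M (\<lambda>x. 2 * (norm (f x))\<^sup>2 + 2 * (norm (g x))\<^sup>2)" using i by simp
  show "\<bar>(norm (f x + g x))\<^sup>2\<bar> \<le> 2 * (norm (f x))\<^sup>2 + 2 * (norm (g x))\<^sup>2" for x
    using parallelogram_identity[of "f x" "g x"] zero_le_power2[of "norm (f x - g x)"]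
    by (simp only: abs_power2)
qed measurable

lemma H1_add:
  assumes "u \<in> H1" "v \<in> H1"
  shows "(\<lambda>x. u x + v x) \<in> H1"
    and "A (\<lambda>x. u x + v x) = (LBINT x. (norm (weak_grad u x + weak_grad v x))\<^sup>2)"
proof -
  note [measurable] = H1_D(1,5)[OF assms(1)] H1_D(1,5)[OF assms(2)]
  show "(\<lambda>x. u x + v x) \<in> H1" "A (\<lambda>x. u x + v x) = (LBINT x. (norm (weak_grad u x + weak_grad v x))\<^sup>2)"
    using H1_D[OF assms(1)] H1_D[OF assms(2)] integrable_square_add[of u lborel v]
    by (auto intro!: H1_I is_weak_gradient_add integrable_square_add)
qed

lemma H1_scale:
  assumes "u \<in> H1"
  shows "(\<lambda>x. c * u x) \<in> H1" "A (\<lambda>x. c * u x) = c\<^sup>2 * A u"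
proof -
  note [measurable] = H1_D(1,5)[OF assms]
  have *: "integrable lborel (\<lambda>x. (norm (c *\<^sub>R weak_grad u x))\<^sup>2)"
    using H1_D(4)[OF assms] by (simp add: power_mult_distrib)
  show "(\<lambda>x. c * u x) \<in> H1"
    using H1_D[OF assms] * by (intro H1_I(1)[where g = "\<lambda>x. c *\<^sub>R weak_grad u x"] is_weak_gradient_scaleR) (auto simp: power_mult_distrib)
  have "A (\<lambda>x. c * u x) = (LBINT x. (norm (c *\<^sub>R weak_grad u x))\<^sup>2)"
    using H1_D[OF assms] * by (intro H1_I(2) is_weak_gradient_scaleR) (auto simp: power_mult_distrib)
  then show "A (\<lambda>x. c * u x) = c\<^sup>2 * A u" by (simp add: power_mult_distrib A_def)
qed

lemma H1_shift:
  assumes "u \<in> H1"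
  shows "(\<lambda>x. u (x + z)) \<in> H1" "A (\<lambda>x. u (x + z)) = A u"
proof -
  note [measurable] = H1_D(1,5)[OF assms]
  have *: "integrable lborel (\<lambda>x. (u (x + z))\<^sup>2)" "integrable lborel (\<lambda>x. (norm (weak_grad u (x + z)))\<^sup>2)"
    using integrable_shift[OF H1_D(2)[OF assms]] integrable_shift[OF H1_D(4)[OF assms]] by auto
  note wg = is_weak_gradient_shift[OF H1_D(3)[OF assms], of z]
  show "(\<lambda>x. u (x + z)) \<in> H1" by (rule H1_I(1)[OF _ *(1) wg *(2)]) measurable
  have "A (\<lambda>x. u (x + z)) = (LBINT x. (norm (weak_grad u (x + z)))\<^sup>2)" by (rule H1_I(2)[OF _ *(1) wg *(2)]) measurable
  then show "A (\<lambda>x. u (x + z)) = A u"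
    using integral_shift[of "\<lambda>x. (norm (weak_grad u x))\<^sup>2" z] by (simp add: A_def)
qed

lemma H1_diff:
  assumes "u \<in> H1" "v \<in> H1"
  shows "(\<lambda>x. u x - v x) \<in> H1"
    and "A (\<lambda>x. u x - v x) = (LBINT x. (norm (weak_grad u x - weak_grad v x))\<^sup>2)"
    and "integrable lborel (\<lambda>x. (norm (weak_grad u x - weak_grad v x))\<^sup>2)"
proof -
  note [measurable] = H1_D(1,5)[OF assms(1)] H1_D(1,5)[OF assms(2)]
  show *: "(\<lambda>x. u x - v x) \<in> H1"
    using H1_add(1)[OF assms(1) H1_scale(1)[OF assms(2), of "-1"]] by simp
  have wg: "is_weak_gradient (\<lambda>x. u x - v x) (\<lambda>x. weak_grad u x - weak_grad v x)"
    using is_weak_gradient_add[OF H1_D(3)[OF assms(1)] is_weak_gradient_scaleR[OF H1_D(3)[OF assms(2)], of "-1"]] by simp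
  show i: "integrable lborel (\<lambda>x. (norm (weak_grad u x - weak_grad v x))\<^sup>2)"
    using integrable_square_add[of "weak_grad u" lborel "\<lambda>x. - weak_grad v x"] H1_D[OF assms(1)] H1_D[OF assms(2)] by auto
  show "A (\<lambda>x. u x - v x) = (LBINT x. (norm (weak_grad u x - weak_grad v x))\<^sup>2)"
    by (rule H1_I(2)[OF H1_D(1,2)[OF *] wg i])
qed

lemma A_nonneg: "0 \<le> A u"
  by (simp add: A_def)

lemma A_parallelogram:
  assumes "u \<in> H1" "v \<in> H1"
  shows "A (\<lambda>x. u x + v x) + A (\<lambda>x. u x - v x) = 2 * A u + 2 * A v"
proof -
  have "integrable lborel (\<lambda>x. (norm (weak_grad u x + weak_grad v x))\<^sup>2)"
    using H1_D[OF assms(1)] H1_D[OF assms(2)] by (intro integrable_square_add) auto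
  then have "A (\<lambda>x. u x + v x) + A (\<lambda>x. u x - v x) =
     (LBINT x. (norm (weak_grad u x + weak_grad v x))\<^sup>2 + (norm (weak_grad u x - weak_grad v x))\<^sup>2)"
    using H1_add(2)[OF assms] H1_diff(2,3)[OF assms] by simp
  also have "\<dots> = (LBINT x. 2 * (norm (weak_grad u x))\<^sup>2 + 2 * (norm (weak_grad v x))\<^sup>2)"
    by (simp add: parallelogram_identity)
  also have "\<dots> = 2 * A u + 2 * A v"
    using H1_D(4)[OF assms(1)] H1_D(4)[OF assms(2)] by (simp add: A_def)
  finally show ?thesis .
qed

section \<open>Moments of functions in H1\<close>

definition vec2 :: "real \<Rightarrow> real \<Rightarrow> plane" where
  "vec2 a b = (\<chi> i. if i = 1 then a else b)"

lemma vec2_nth [simp]: "vec2 a b $ 1 = a" "vec2 a b $ 2 = b"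
  by (auto simp: vec2_def)

lemma vec2_measurable [measurable]: "(\<lambda>(a, b). vec2 a b) \<in> borel_measurable (borel \<Otimes>\<^sub>M borel)"
proof -
  have "continuous_on UNIV (\<lambda>p::real \<times> real. \<chi> i. if i = (1::2) then fst p else snd p)"
  proof (rule continuous_on_vec_lambda)
    show "continuous_on UNIV (\<lambda>p::real \<times> real. if i = (1::2) then fst p else snd p)" for i
      by (cases "i = 1") (auto intro: continuous_intros)
  qed
  then show ?thesis
    unfolding borel_prod by (intro borel_measurable_continuous_onI) (simp add: vec2_def case_prod_unfold)
qed

lemma vec2_shift: "vec2 a b + s *\<^sub>R axis 1 1 = vec2 (a + s) b" "vec2 a b + s *\<^sub>R axis 2 1 = vec2 a (b + s)"
  by (auto simp: vec_eq_iff forall_2 axis_def)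

text \<open>
  Transports Lebesgue measure from the product of two lines to the plane, so that Fubini's theorem can be
  applied in coordinates.
\<close>

lemma lborel_vec2: "distr (lborel \<Otimes>\<^sub>M lborel) borel (\<lambda>(a, b). vec2 a b) = lborel"
proof (rule lborel_eqI[symmetric])
  fix l u :: plane
  assume *: "\<And>b. b \<in> Basis \<Longrightarrow> l \<bullet> b \<le> u \<bullet> b"
  have B: "(Basis :: plane set) = {axis 1 1, axis 2 1}"
    by (auto simp: Basis_vec_def) (metis exhaust_2)
  have le: "l $ 1 \<le> u $ 1" "l $ 2 \<le> u $ 2" using *[of "axis 1 1"] *[of "axis 2 1"] by (auto simp: B inner_axis)
  have "emeasure (distr (lborel \<Otimes>\<^sub>M lborel) borel (\<lambda>(a, b). vec2 a b)) (box l u) =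
      emeasure (lborel \<Otimes>\<^sub>M lborel) ((\<lambda>(a, b). vec2 a b) -` box l u \<inter> space (lborel \<Otimes>\<^sub>M lborel))"
    by (subst emeasure_distr) auto
  also have "(\<lambda>(a, b). vec2 a b) -` box l u \<inter> space (lborel \<Otimes>\<^sub>M lborel) = {l $ 1<..<u $ 1} \<times> {l $ 2<..<u $ 2}"
    by (auto simp: mem_box_cart forall_2 space_pair_measure)
  also have "emeasure (lborel \<Otimes>\<^sub>M lborel) \<dots> = ennreal (u $ 1 - l $ 1) * ennreal (u $ 2 - l $ 2)"
    using le by (subst lborel.emeasure_pair_measure_Times) auto
  also have "\<dots> = ennreal (\<Prod>b\<in>Basis. (u - l) \<bullet> b)"
    using le by (simp add: B inner_axis ennreal_mult axis_eq_axis)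
  finally show "emeasure (distr (lborel \<Otimes>\<^sub>M lborel) borel (\<lambda>(a, b). vec2 a b)) (box l u) = ennreal (\<Prod>b\<in>Basis. (u - l) \<bullet> b)" .
qed simp

lemma nn_integral_vec2:
  assumes [measurable]: "f \<in> borel_measurable borel"
  shows "(\<integral>\<^sup>+x. f x \<partial>lborel) = (\<integral>\<^sup>+a. \<integral>\<^sup>+b. f (vec2 a b) \<partial>lborel \<partial>lborel)"
proof -
  have "(\<integral>\<^sup>+x. f x \<partial>lborel) = (\<integral>\<^sup>+p. f (case p of (a, b) \<Rightarrow> vec2 a b) \<partial>(lborel \<Otimes>\<^sub>M lborel))"
    by (subst lborel_vec2[symmetric], subst nn_integral_distr) auto
  also have "\<dots> = (\<integral>\<^sup>+a. \<integral>\<^sup>+b. f (vec2 a b) \<partial>lborel \<partial>lborel)"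
    by (subst lborel.nn_integral_fst[symmetric]) auto
  finally show ?thesis .
qed

lemma emeasure_rectangle:
  assumes [measurable]: "I \<in> sets borel" "J \<in> sets borel"
  shows "emeasure lborel {x::plane. x $ 1 \<in> I \<and> x $ 2 \<in> J} = emeasure lborel I * emeasure lborel J"
proof -
  have [measurable]: "{x::plane. x $ 1 \<in> I \<and> x $ 2 \<in> J} \<in> sets borel" by measurable
  have "emeasure lborel {x::plane. x $ 1 \<in> I \<and> x $ 2 \<in> J} =
      (\<integral>\<^sup>+a. \<integral>\<^sup>+b. indicator {x::plane. x $ 1 \<in> I \<and> x $ 2 \<in> J} (vec2 a b) \<partial>lborel \<partial>lborel)"
    by (subst nn_integral_vec2[symmetric]) auto
  also have "\<dots> = (\<integral>\<^sup>+a. \<integral>\<^sup>+b. indicator I a * indicator J b \<partial>lborel \<partial>lborel)"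
    by (intro nn_integral_cong) (auto simp: indicator_def)
  also have "\<dots> = emeasure lborel I * emeasure lborel J"
    by (simp add: nn_integral_cmult nn_integral_multc)
  finally show ?thesis .
qed

lemma vec2_measurable_curried [measurable (raw)]:
  "f \<in> borel_measurable M \<Longrightarrow> g \<in> borel_measurable M \<Longrightarrow> (\<lambda>x. vec2 (f x) (g x)) \<in> borel_measurable M"
  using measurable_compose[of "\<lambda>x. (f x, g x)" M "borel \<Otimes>\<^sub>M borel" "\<lambda>(a, b). vec2 a b" borel] by simp

text \<open>
  The Loomis--Whitney inequality in dimension two: the bound for the first direction does not depend on
  the first coordinate and that for the second direction not on the second, so the integral of their
  product factorizes.
\<close>

theorem plane_product_bound:
  fixes U W :: "plane \<Rightarrow> ennreal"
  assumes [measurable]: "U \<in> borel_measurable borel" "W \<in> borel_measurable borel"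
    and U: "\<And>i. AE x in lborel. U x \<le> (\<integral>\<^sup>+s. W (x + s *\<^sub>R axis i 1) \<partial>lborel)"
  shows "(\<integral>\<^sup>+x. (U x)\<^sup>2 \<partial>lborel) \<le> (\<integral>\<^sup>+x. W x \<partial>lborel)\<^sup>2"
proof -
  define W1 W2 where "W1 b = (\<integral>\<^sup>+a. W (vec2 a b) \<partial>lborel)" and "W2 a = (\<integral>\<^sup>+b. W (vec2 a b) \<partial>lborel)" for a b
  have [measurable]: "W1 \<in> borel_measurable borel" "W2 \<in> borel_measurable borel"
    unfolding W1_def W2_def by measurable
  have "AE x in lborel. (U x)\<^sup>2 \<le> (\<integral>\<^sup>+s. W (x + s *\<^sub>R axis 1 1) \<partial>lborel) * (\<integral>\<^sup>+s. W (x + s *\<^sub>R axis 2 1) \<partial>lborel)"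
    using U[of 1] U[of 2] by eventually_elim (auto simp: power2_eq_square intro!: mult_mono)
  then have "(\<integral>\<^sup>+x. (U x)\<^sup>2 \<partial>lborel) \<le> (\<integral>\<^sup>+x. (\<integral>\<^sup>+s. W (x + s *\<^sub>R axis 1 1) \<partial>lborel) * (\<integral>\<^sup>+s. W (x + s *\<^sub>R axis 2 1) \<partial>lborel) \<partial>lborel)"
    by (rule nn_integral_mono_AE)
  also have "\<dots> = (\<integral>\<^sup>+a. \<integral>\<^sup>+b. (\<integral>\<^sup>+s. W (vec2 (s + a) b) \<partial>lborel) * (\<integral>\<^sup>+s. W (vec2 a (s + b)) \<partial>lborel) \<partial>lborel \<partial>lborel)"
    by (subst nn_integral_vec2) (auto simp: vec2_shift add.commute)
  also have "\<dots> = (\<integral>\<^sup>+a. \<integral>\<^sup>+b. W1 b * W2 a \<partial>lborel \<partial>lborel)"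
    using nn_integral_shift[of "\<lambda>s. W (vec2 s _)"] nn_integral_shift[of "\<lambda>s. W (vec2 _ s)"]
    by (simp add: W1_def W2_def)
  also have "\<dots> = (\<integral>\<^sup>+b. W1 b \<partial>lborel) * (\<integral>\<^sup>+a. W2 a \<partial>lborel)"
    by (simp add: nn_integral_multc nn_integral_cmult)
  also have "(\<integral>\<^sup>+a. W2 a \<partial>lborel) = (\<integral>\<^sup>+x. W x \<partial>lborel)"
    unfolding W2_def by (rule nn_integral_vec2[symmetric]) simp
  also have "(\<integral>\<^sup>+b. W1 b \<partial>lborel) = (\<integral>\<^sup>+x. W x \<partial>lborel)"
    unfolding W1_def by (subst lborel_pair.Fubini') (auto simp: nn_integral_vec2)
  finally show ?thesis by (simp add: power2_eq_square)
qed

lemma power_diff_le: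
  fixes y z :: real
  assumes "0 \<le> y" "y \<le> z"
  shows "z ^ k - y ^ k \<le> real k * z ^ (k - 1) * (z - y)"
proof (induction k)
  case (Suc k)
  have "z ^ Suc k - y ^ Suc k = z * (z ^ k - y ^ k) + y ^ k * (z - y)" by (simp add: algebra_simps)
  also have "\<dots> \<le> z * (real k * z ^ (k - 1) * (z - y)) + z ^ k * (z - y)"
    using assms Suc by (intro add_mono mult_left_mono mult_right_mono power_mono) auto
  also have "\<dots> = real (Suc k) * z ^ (Suc k - 1) * (z - y)"
    by (cases k) (auto simp: algebra_simps)
  finally show ?case .
qed simp

text \<open>
  Since \<open>h\<close> is merely integrable, \<open>f\<close> is a primitive in the sense of absolute continuity. The
  fundamental theorem for \<open>\<bar>f\<bar> ^ k\<close> is replaced by continuous induction: near any point the weight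
  \<open>k * \<bar>f\<bar> ^ (k - 1)\<close> is constant up to \<open>\<epsilon>\<close>, which gives the inequality on short intervals with an
  error \<open>\<epsilon>\<close> times the integral of \<open>\<bar>h\<bar>\<close>, and these inequalities add up.
\<close>

lemma abs_power_line_bound:
  fixes h :: "real \<Rightarrow> real"
  assumes h: "set_integrable lborel {0..T} h" and T: "0 \<le> T"
    and f: "\<And>s. f s = c0 + integral {0..s} h"
  shows "\<bar>c0\<bar> ^ k \<le> \<bar>f T\<bar> ^ k + integral {0..T} (\<lambda>s. real k * \<bar>f s\<bar> ^ (k - 1) * \<bar>h s\<bar>)"
    and "set_integrable lborel {0..T} (\<lambda>s. real k * \<bar>f s\<bar> ^ (k - 1) * \<bar>h s\<bar>)"
proof -
  have hi: "h integrable_on {0..T}" and ha: "(\<lambda>s. \<bar>h s\<bar>) integrable_on {0..T}"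
    using set_borel_integral_eq_integral(1)[OF h] set_borel_integral_eq_integral(1)[OF set_integrable_abs[OF h]] by auto
  have cf: "continuous_on {0..T} f"
    unfolding f by (intro continuous_intros indefinite_integral_continuous_1 hi)
  define w where "w s = real k * \<bar>f s\<bar> ^ (k - 1)" for s
  have cw: "continuous_on {0..T} w" unfolding w_def by (intro continuous_intros cf)
  obtain Kw where Kw: "\<And>s. s \<in> {0..T} \<Longrightarrow> \<bar>w s\<bar> \<le> Kw"
  proof -
    obtain Kw where "\<forall>y\<in>w ` {0..T}. norm y \<le> Kw"
      using compact_imp_bounded[OF compact_continuous_image[OF cw]] by (auto simp: bounded_iff)
    then show ?thesis by (intro that[of Kw]) auto
  qed
  have w0: "0 \<le> w s" for s by (simp add: w_def)
  show wh: "set_integrable lborel {0..T} (\<lambda>s. real k * \<bar>f s\<bar> ^ (k - 1) * \<bar>h s\<bar>)"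
    unfolding set_integrable_def w_def[symmetric]
  proof (rule Bochner_Integration.integrable_bound)
    show "integrable lborel (\<lambda>x. Kw * (indicator {0..T} x *\<^sub>R \<bar>h x\<bar>))"
      using set_integrable_abs[OF h] unfolding set_integrable_def by (rule integrable_mult_right)
    have "(\<lambda>x. indicator {0..T} x *\<^sub>R w x) \<in> borel_measurable lborel"
      using borel_measurable_continuous_on_indicator[OF _ cw] by simp
    moreover have "(\<lambda>x. indicator {0..T} x *\<^sub>R \<bar>h x\<bar>) \<in> borel_measurable lborel"
      using set_integrable_abs[OF h] unfolding set_integrable_def by (rule borel_measurable_integrable)
    ultimately have "(\<lambda>x. (indicator {0..T} x *\<^sub>R w x) * (indicator {0..T} x *\<^sub>R \<bar>h x\<bar>)) \<in> borel_measurable lborel"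
      by (rule borel_measurable_times)
    then show "(\<lambda>x. indicator {0..T} x *\<^sub>R (w x * \<bar>h x\<bar>)) \<in> borel_measurable lborel"
      by (rule measurable_cong[THEN iffD1, rotated]) (auto simp: indicator_def)
    have "w x * \<bar>h x\<bar> \<le> \<bar>Kw\<bar> * \<bar>h x\<bar>" if "x \<in> {0..T}" for x using Kw[OF that] by (intro mult_right_mono) auto
    then show "AE x in lborel. norm (indicator {0..T} x *\<^sub>R (w x * \<bar>h x\<bar>)) \<le> norm (Kw * (indicator {0..T} x *\<^sub>R \<bar>h x\<bar>))"
      by (intro AE_I2) (auto simp: indicator_def abs_mult w0)
  qed
  have whi: "(\<lambda>s. w s * \<bar>h s\<bar>) integrable_on {0..T}"
    using set_borel_integral_eq_integral(1)[OF wh] by (simp add: w_def)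
  have sub: "(\<lambda>s. w s * \<bar>h s\<bar>) integrable_on {a..b}" "(\<lambda>s. \<bar>h s\<bar>) integrable_on {a..b}" "h integrable_on {a..b}"
    if "0 \<le> a" "b \<le> T" for a b
    using that whi ha hi by (auto elim!: integrable_on_subinterval)
  have fd: "\<bar>f a\<bar> - \<bar>f b\<bar> \<le> integral {a..b} (\<lambda>s. \<bar>h s\<bar>)" if "0 \<le> a" "a \<le> b" "b \<le> T" for a b
  proof -
    have "f b - f a = integral {a..b} h"
      using Henstock_Kurzweil_Integration.integral_combine[of 0 a b h] that sub(3)[of 0 b] by (simp add: f)
    moreover have "\<bar>integral {a..b} h\<bar> \<le> integral {a..b} (\<lambda>s. \<bar>h s\<bar>)"
      using integral_norm_bound_integral[of h "{a..b}" "\<lambda>s. \<bar>h s\<bar>"] sub[of a b] that by simp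
    ultimately show ?thesis by linarith
  qed
  have "\<bar>f 0\<bar> ^ k \<le> \<bar>f T\<bar> ^ k + integral {0..T} (\<lambda>s. w s * \<bar>h s\<bar>) + \<epsilon> * integral {0..T} (\<lambda>s. \<bar>h s\<bar>)" if "\<epsilon> > 0" for \<epsilon>
  proof -
    \<comment> \<open>The error term \<open>\<epsilon>\<close> is charged to the integral of \<open>\<bar>h\<bar>\<close>, so that it is additive over adjacent intervals.\<close>
    define P where "P a b \<longleftrightarrow> (0 \<le> a \<and> a \<le> b \<and> b \<le> T \<longrightarrow>
       \<bar>f a\<bar> ^ k \<le> \<bar>f b\<bar> ^ k + integral {a..b} (\<lambda>s. w s * \<bar>h s\<bar>) + \<epsilon> * integral {a..b} (\<lambda>s. \<bar>h s\<bar>))" for a b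
    have "P 0 T"
      using T
    proof (induct rule: Bolzano)
      case (trans a b c)
      show ?case unfolding P_def
      proof
        assume *: "0 \<le> a \<and> a \<le> c \<and> c \<le> T"
        have "integral {a..b} (\<lambda>s. w s * \<bar>h s\<bar>) + integral {b..c} (\<lambda>s. w s * \<bar>h s\<bar>) = integral {a..c} (\<lambda>s. w s * \<bar>h s\<bar>)"
          using trans * by (intro Henstock_Kurzweil_Integration.integral_combine sub) auto
        moreover have "integral {a..b} (\<lambda>s. \<bar>h s\<bar>) + integral {b..c} (\<lambda>s. \<bar>h s\<bar>) = integral {a..c} (\<lambda>s. \<bar>h s\<bar>)"
          using trans * by (intro Henstock_Kurzweil_Integration.integral_combine sub) auto
        then have "\<epsilon> * integral {a..b} (\<lambda>s. \<bar>h s\<bar>) + \<epsilon> * integral {b..c} (\<lambda>s. \<bar>h s\<bar>) = \<epsilon> * integral {a..c} (\<lambda>s. \<bar>h s\<bar>)"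
          by (metis distrib_left)
        ultimately show "\<bar>f a\<bar> ^ k \<le> \<bar>f c\<bar> ^ k + integral {a..c} (\<lambda>s. w s * \<bar>h s\<bar>) + \<epsilon> * integral {a..c} (\<lambda>s. \<bar>h s\<bar>)"
          using trans * by (simp add: P_def)
      qed
    next
      case (local x)
      then have "\<exists>d>0. \<forall>s\<in>{0..T}. dist s x < d \<longrightarrow> dist (w s) (w x) < \<epsilon> / 2"
        using cw that unfolding continuous_on_iff by (metis atLeastAtMost_iff half_gt_zero)
      then obtain d where d: "d > 0" "\<And>s. s \<in> {0..T} \<Longrightarrow> \<bar>s - x\<bar> < d \<Longrightarrow> \<bar>w s - w x\<bar> < \<epsilon> / 2"
        unfolding dist_real_def by blast
      have "P a b" if ab: "a \<le> x" "x \<le> b" "b - a < d" for a b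
        unfolding P_def
      proof
        assume *: "0 \<le> a \<and> a \<le> b \<and> b \<le> T"
        have wa: "w a \<le> w s + \<epsilon>" if "s \<in> {a..b}" for s
        proof -
          \<comment> \<open>Both \<open>w a\<close> and \<open>w s\<close> are within \<open>\<epsilon> / 2\<close> of \<open>w x\<close>.\<close>
          have "\<bar>s - x\<bar> < d" "\<bar>a - x\<bar> < d" "s \<in> {0..T}" "a \<in> {0..T}" using that ab * by auto
          then show ?thesis using d(2)[of a] d(2)[of s] by linarith
        qed
        have nn: "0 \<le> integral {a..b} (\<lambda>s. w s * \<bar>h s\<bar>)" "0 \<le> integral {a..b} (\<lambda>s. \<bar>h s\<bar>)"
          using * by (auto intro!: integral_nonneg sub mult_nonneg_nonneg w0)
        show "\<bar>f a\<bar> ^ k \<le> \<bar>f b\<bar> ^ k + integral {a..b} (\<lambda>s. w s * \<bar>h s\<bar>) + \<epsilon> * integral {a..b} (\<lambda>s. \<bar>h s\<bar>)"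
        proof (cases "\<bar>f a\<bar> \<le> \<bar>f b\<bar>")
          case True
          then have "\<bar>f a\<bar> ^ k \<le> \<bar>f b\<bar> ^ k" by (intro power_mono) auto
          then show ?thesis using nn \<open>\<epsilon> > 0\<close> by (simp add: add_increasing2)
        next
          case False
          then have "\<bar>f a\<bar> ^ k - \<bar>f b\<bar> ^ k \<le> w a * (\<bar>f a\<bar> - \<bar>f b\<bar>)"
            unfolding w_def by (intro power_diff_le) auto
          also have "\<dots> \<le> w a * integral {a..b} (\<lambda>s. \<bar>h s\<bar>)" using * by (intro mult_left_mono fd w0) auto
          also have "\<dots> = integral {a..b} (\<lambda>s. w a * \<bar>h s\<bar>)" by simp
          also have "\<dots> \<le> integral {a..b} (\<lambda>s. w s * \<bar>h s\<bar> + \<epsilon> * \<bar>h s\<bar>)"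
          proof (intro integral_le integrable_add integrable_on_mult_right sub)
            show "w a * \<bar>h s\<bar> \<le> w s * \<bar>h s\<bar> + \<epsilon> * \<bar>h s\<bar>" if "s \<in> {a..b}" for s
              using mult_right_mono[OF wa[OF that], of "\<bar>h s\<bar>"] by (simp add: distrib_right)
          qed (use * in auto)
          also have "\<dots> = integral {a..b} (\<lambda>s. w s * \<bar>h s\<bar>) + \<epsilon> * integral {a..b} (\<lambda>s. \<bar>h s\<bar>)"
            using * sub[of a b]
            by (subst Henstock_Kurzweil_Integration.integral_add) (auto intro: integrable_on_mult_right)
          finally show ?thesis by simp
        qed
      qed
      with d(1) show ?case by blast
    qed
    then show ?thesis using T by (simp add: P_def)
  qed
  then have *: "\<bar>f 0\<bar> ^ k - \<bar>f T\<bar> ^ k - integral {0..T} (\<lambda>s. w s * \<bar>h s\<bar>) \<le> \<epsilon> * integral {0..T} (\<lambda>s. \<bar>h s\<bar>)" if "\<epsilon> > 0" for \<epsilon>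
    using that by (simp add: algebra_simps)
  have "((\<lambda>\<epsilon>. \<epsilon> * integral {0..T} (\<lambda>s. \<bar>h s\<bar>)) \<longlongrightarrow> 0 * integral {0..T} (\<lambda>s. \<bar>h s\<bar>)) (at_right 0)"
    by (intro tendsto_intros)
  then have "\<bar>f 0\<bar> ^ k - \<bar>f T\<bar> ^ k - integral {0..T} (\<lambda>s. w s * \<bar>h s\<bar>) \<le> 0 * integral {0..T} (\<lambda>s. \<bar>h s\<bar>)"
    by (rule tendsto_lowerbound) (auto intro!: eventually_mono[OF eventually_at_right_less] *)
  then show "\<bar>c0\<bar> ^ k \<le> \<bar>f T\<bar> ^ k + integral {0..T} (\<lambda>s. real k * \<bar>f s\<bar> ^ (k - 1) * \<bar>h s\<bar>)"
    by (simp add: f w_def)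
qed

text \<open>
  The shift identity holds for each \<open>T\<close> and almost every \<open>x\<close>. Exchanging the quantifiers gives a
  statement about almost every line.
\<close>

lemma AE_line_representation:
  assumes wg: "is_weak_gradient u g"
  shows "AE x in lborel. AE T in lborel. 0 \<le> T \<longrightarrow>
    u (x + T *\<^sub>R axis i 1) - u x = (LBINT s. indicator {0..T} s * g (x + s *\<^sub>R axis i 1) $ i)"
proof -
  note [measurable] = is_weak_gradient_measurable[OF wg]
  have ind: "indicator {0..T} s = (if 0 \<le> s \<and> s \<le> T then 1 else 0 :: real)" for s T :: real by (auto simp: indicator_def)
  have "AE T in lborel. AE x in lborel. 0 \<le> T \<longrightarrow>
    u (x + T *\<^sub>R axis i 1) - u x = (LBINT s. indicator {0..T} s * g (x + s *\<^sub>R axis i 1) $ i)"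
  proof (rule AE_I2)
    fix T :: real
    show "AE x in lborel. 0 \<le> T \<longrightarrow>
      u (x + T *\<^sub>R axis i 1) - u x = (LBINT s. indicator {0..T} s * g (x + s *\<^sub>R axis i 1) $ i)"
      using weak_gradient_shift_identity[OF wg, of T i] by (cases "0 \<le> T") auto
  qed
  then show ?thesis
    by (subst lborel_pair.AE_commute) (unfold ind, measurable)
qed

text \<open>
  The integral of \<open>(norm g)\<^sup>2\<close> along segments of length \<open>N\<close> has a finite integral over the plane, so it is
  finite on almost every line.
\<close>

lemma AE_line_square_integrable:
  fixes g :: "plane \<Rightarrow> plane"
  assumes [measurable]: "g \<in> borel_measurable borel" and g2: "integrable lborel (\<lambda>x. (norm (g x))\<^sup>2)"
  shows "AE x in lborel. \<forall>N::nat. set_integrable lborel {0..real N} (\<lambda>s. g (x + s *\<^sub>R axis i 1) $ i)"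
  unfolding AE_all_countable
proof
  fix N :: nat
  have "(\<integral>\<^sup>+x. \<integral>\<^sup>+s. indicator {0..real N} s * ennreal ((norm (g (x + s *\<^sub>R axis i 1)))\<^sup>2) \<partial>lborel \<partial>lborel) =
      ennreal (real N) * (\<integral>\<^sup>+x. ennreal ((norm (g x))\<^sup>2) \<partial>lborel)"
    by (rule nn_integral_segments) auto
  also have "\<dots> \<noteq> \<infinity>"
    using g2 by (simp add: integrable_iff_bounded ennreal_mult_eq_top_iff less_top[symmetric])
  finally have "AE x in lborel. (\<integral>\<^sup>+s. indicator {0..real N} s * ennreal ((norm (g (x + s *\<^sub>R axis i 1)))\<^sup>2) \<partial>lborel) \<noteq> \<infinity>"
    by (intro nn_integral_PInf_AE) auto
  then show "AE x in lborel. set_integrable lborel {0..real N} (\<lambda>s. g (x + s *\<^sub>R axis i 1) $ i)"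
  proof eventually_elim
    case (elim x)
    have "integrable lborel (\<lambda>s. indicator {0..real N} s * (norm (g (x + s *\<^sub>R axis i 1)))\<^sup>2)"
    proof (rule integrableI_bounded)
      have "(\<integral>\<^sup>+s. ennreal (norm (indicator {0..real N} s * (norm (g (x + s *\<^sub>R axis i 1)))\<^sup>2)) \<partial>lborel) =
         (\<integral>\<^sup>+s. indicator {0..real N} s * ennreal ((norm (g (x + s *\<^sub>R axis i 1)))\<^sup>2) \<partial>lborel)"
        by (intro nn_integral_cong) (auto simp: indicator_def)
      then show "(\<integral>\<^sup>+s. ennreal (norm (indicator {0..real N} s * (norm (g (x + s *\<^sub>R axis i 1)))\<^sup>2)) \<partial>lborel) < \<infinity>"
        using elim by (simp add: less_top)
    qed measurable
    then have i: "integrable lborel (\<lambda>s. indicator {0..real N} s + indicator {0..real N} s * (norm (g (x + s *\<^sub>R axis i 1)))\<^sup>2)"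
      by (intro Bochner_Integration.integrable_add integrable_real_indicator) (auto simp: emeasure_lborel_Icc_eq)
    show ?case unfolding set_integrable_def
    proof (rule integrable_dominated[OF i])
      have "\<bar>y $ i\<bar> \<le> 1 + (norm y)\<^sup>2" for y :: plane
        using component_le_norm_cart[of y i] le_one_plus_square[of "norm y"] by simp
      then show "\<bar>indicator {0..real N} s *\<^sub>R g (x + s *\<^sub>R axis i 1) $ i\<bar> \<le>
        indicator {0..real N} s + indicator {0..real N} s * (norm (g (x + s *\<^sub>R axis i 1)))\<^sup>2" for s
        by (auto simp: indicator_def)
    qed measurable
  qed
qed

text \<open>
  On almost every line \<open>u\<close> agrees with a primitive \<open>f\<close> of the derivative. The one-dimensional
  inequality between \<open>x\<close> and \<open>x + T\<close> is averaged over \<open>T\<close> in \<open>[0, N]\<close>. The right-hand side is an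
  integral over the whole line, so it does not depend on the coordinate in direction \<open>i\<close>; its first
  summand will disappear as \<open>N\<close> tends to infinity.
\<close>

lemma weak_gradient_power_line_bound:
  assumes wg: "is_weak_gradient u g" and g2: "integrable lborel (\<lambda>x. (norm (g x))\<^sup>2)" and N: "0 < N"
  shows "AE x in lborel. ennreal (\<bar>u x\<bar> ^ k) \<le>
    (\<integral>\<^sup>+s. ennreal (\<bar>u (x + s *\<^sub>R axis i 1)\<bar> ^ k / real N +
       real k * \<bar>u (x + s *\<^sub>R axis i 1)\<bar> ^ (k - 1) * norm (g (x + s *\<^sub>R axis i 1))) \<partial>lborel)"
  using AE_line_representation[OF wg, of i] AE_line_square_integrable[OF is_weak_gradient_measurable(2)[OF wg] g2, of i]
proof eventually_elim
  case (elim x)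
  note [measurable] = is_weak_gradient_measurable[OF wg]
  define h where "h s = g (x + s *\<^sub>R axis i 1) $ i" for s
  define f where "f s = u x + integral {0..s} h" for s
  have hi: "set_integrable lborel {0..T} h" for T
  proof -
    obtain n :: nat where "T \<le> real n" using real_arch_simple by blast
    then show ?thesis
      using elim(2)[rule_format, of n] set_integrable_subset[of lborel "{0..real n}" h "{0..T}"]
      by (simp add: h_def[abs_def])
  qed
  have fu: "AE s in lborel. 0 \<le> s \<longrightarrow> f s = u (x + s *\<^sub>R axis i 1)"
    using elim(1)
  proof eventually_elim
    case (elim s)
    have "(LBINT r. indicator {0..s} r * h r) = integral {0..s} h"
      using set_borel_integral_eq_integral(2)[OF hi[of s]] by (simp add: set_lebesgue_integral_def)
    then show ?case using elim unfolding f_def h_def by linarith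
  qed
  let ?U = "\<lambda>s. u (x + s *\<^sub>R axis i 1)" and ?G = "\<lambda>s. norm (g (x + s *\<^sub>R axis i 1))"
  define \<Psi> where "\<Psi> = (\<integral>\<^sup>+s. ennreal (real k * \<bar>?U s\<bar> ^ (k - 1) * ?G s) \<partial>lborel)"
  have le: "ennreal (\<bar>u x\<bar> ^ k) \<le> ennreal (\<bar>f T\<bar> ^ k) + \<Psi>" if T: "0 \<le> T" for T
  proof -
    note b = abs_power_line_bound[OF hi T f_def, of k]
    have "ennreal (\<bar>u x\<bar> ^ k) \<le> ennreal (\<bar>f T\<bar> ^ k) + ennreal (integral {0..T} (\<lambda>s. real k * \<bar>f s\<bar> ^ (k - 1) * \<bar>h s\<bar>))"
      using b by (subst ennreal_plus[symmetric]) (auto intro!: integral_nonneg ennreal_leI set_borel_integral_eq_integral(1))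
    also have "ennreal (integral {0..T} (\<lambda>s. real k * \<bar>f s\<bar> ^ (k - 1) * \<bar>h s\<bar>)) =
       ennreal (LBINT s. indicator {0..T} s *\<^sub>R (real k * \<bar>f s\<bar> ^ (k - 1) * \<bar>h s\<bar>))"
      using set_borel_integral_eq_integral(2)[OF b(2)] by (simp add: set_lebesgue_integral_def)
    also have "\<dots> = (\<integral>\<^sup>+s. ennreal (indicator {0..T} s *\<^sub>R (real k * \<bar>f s\<bar> ^ (k - 1) * \<bar>h s\<bar>)) \<partial>lborel)"
      using b(2) by (intro nn_integral_eq_integral[symmetric]) (auto simp: set_integrable_def)
    also have "\<dots> \<le> \<Psi>" unfolding \<Psi>_def
    proof (rule nn_integral_mono_AE)
      show "AE s in lborel. ennreal (indicator {0..T} s *\<^sub>R (real k * \<bar>f s\<bar> ^ (k - 1) * \<bar>h s\<bar>)) \<le> ennreal (real k * \<bar>?U s\<bar> ^ (k - 1) * ?G s)"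
        using fu
      proof eventually_elim
        case (elim s)
        have "\<bar>h s\<bar> \<le> ?G s" by (simp add: h_def component_le_norm_cart)
        then show ?case using elim by (auto simp: indicator_def intro!: ennreal_leI mult_left_mono)
      qed
    qed
    finally show ?thesis by (simp add: add_left_mono)
  qed
  have ind: "indicator {0..real N} s * c = c * indicator {0..real N} s" for s and c :: ennreal by (simp add: mult.commute)
  have "ennreal (\<bar>u x\<bar> ^ k) = ennreal (1 / real N) * (\<integral>\<^sup>+s. indicator {0..real N} s * ennreal (\<bar>u x\<bar> ^ k) \<partial>lborel)"
    using N by (simp add: nn_integral_multc mult.assoc[symmetric] ennreal_mult[symmetric])
  also have "\<dots> \<le> ennreal (1 / real N) * (\<integral>\<^sup>+s. ennreal (\<bar>?U s\<bar> ^ k) + indicator {0..real N} s * \<Psi> \<partial>lborel)"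
  proof (intro mult_left_mono nn_integral_mono_AE)
    show "AE s in lborel. indicator {0..real N} s * ennreal (\<bar>u x\<bar> ^ k) \<le> ennreal (\<bar>?U s\<bar> ^ k) + indicator {0..real N} s * \<Psi>"
      using fu
    proof eventually_elim
      case (elim s)
      then show ?case using le[of s] by (auto simp: indicator_def)
    qed
  qed simp
  also have "\<dots> = ennreal (1 / real N) * (\<integral>\<^sup>+s. ennreal (\<bar>?U s\<bar> ^ k) \<partial>lborel) + \<Psi>"
    using N by (simp add: nn_integral_add nn_integral_multc distrib_left mult.assoc[symmetric] ennreal_mult[symmetric])
  also have "\<dots> = (\<integral>\<^sup>+s. ennreal (\<bar>?U s\<bar> ^ k / real N) \<partial>lborel) + \<Psi>"
    by (subst nn_integral_cmult[symmetric]) (auto simp: ennreal_mult'[symmetric])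
  also have "\<dots> = (\<integral>\<^sup>+s. ennreal (\<bar>?U s\<bar> ^ k / real N + real k * \<bar>?U s\<bar> ^ (k - 1) * ?G s) \<partial>lborel)"
    unfolding \<Psi>_def by (subst nn_integral_add[symmetric]) (auto simp: ennreal_plus[symmetric] simp del: ennreal_plus)
  finally show ?case .
qed

text \<open>
  Combine the bounds in both directions by the Loomis--Whitney inequality, let \<open>N\<close> tend to infinity, and
  separate \<open>u\<close> from \<open>g\<close> by the Cauchy--Schwarz inequality.
\<close>

lemma power_moment_step:
  assumes wg: "is_weak_gradient u g" and g2: "integrable lborel (\<lambda>x. (norm (g x))\<^sup>2)"
    and uk: "integrable lborel (\<lambda>x. \<bar>u x\<bar> ^ k)"
  shows "(\<integral>\<^sup>+x. ennreal (\<bar>u x\<bar> ^ (2 * k)) \<partial>lborel) \<le>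
    ennreal ((real k)\<^sup>2) * (\<integral>\<^sup>+x. ennreal (\<bar>u x\<bar> ^ (2 * (k - 1))) \<partial>lborel) * (\<integral>\<^sup>+x. ennreal ((norm (g x))\<^sup>2) \<partial>lborel)"
proof -
  note [measurable] = is_weak_gradient_measurable[OF wg]
  define c where "c = (\<integral>\<^sup>+x. ennreal (\<bar>u x\<bar> ^ k) \<partial>lborel)"
  define d where "d = (\<integral>\<^sup>+x. ennreal (real k * \<bar>u x\<bar> ^ (k - 1) * norm (g x)) \<partial>lborel)"
  have c: "c \<noteq> \<infinity>" using uk by (simp add: c_def integrable_iff_bounded)
  have b: "(\<integral>\<^sup>+x. ennreal (\<bar>u x\<bar> ^ (2 * k)) \<partial>lborel) \<le> (ennreal (1 / real (Suc n)) * c + d)\<^sup>2" for n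
  proof -
    have "(\<integral>\<^sup>+x. ennreal (\<bar>u x\<bar> ^ (2 * k)) \<partial>lborel) = (\<integral>\<^sup>+x. (ennreal (\<bar>u x\<bar> ^ k))\<^sup>2 \<partial>lborel)"
      by (intro nn_integral_cong) (simp add: ennreal_power power_mult[symmetric] mult.commute)
    also have "\<dots> \<le> (\<integral>\<^sup>+x. ennreal (\<bar>u x\<bar> ^ k / real (Suc n) + real k * \<bar>u x\<bar> ^ (k - 1) * norm (g x)) \<partial>lborel)\<^sup>2"
      by (rule plane_product_bound, measurable)
        (rule weak_gradient_power_line_bound[OF wg g2], simp)
    also have "(\<integral>\<^sup>+x. ennreal (\<bar>u x\<bar> ^ k / real (Suc n) + real k * \<bar>u x\<bar> ^ (k - 1) * norm (g x)) \<partial>lborel) =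
       (\<integral>\<^sup>+x. ennreal (1 / real (Suc n)) * ennreal (\<bar>u x\<bar> ^ k) + ennreal (real k * \<bar>u x\<bar> ^ (k - 1) * norm (g x)) \<partial>lborel)"
      by (intro nn_integral_cong) (simp add: ennreal_mult'[symmetric])
    also have "\<dots> = ennreal (1 / real (Suc n)) * c + d"
      unfolding c_def d_def by (subst nn_integral_add) (auto simp: nn_integral_cmult)
    finally show ?thesis .
  qed
  have "(\<integral>\<^sup>+x. ennreal (\<bar>u x\<bar> ^ (2 * k)) \<partial>lborel) \<le> d\<^sup>2"
  proof (cases "d = \<infinity>")
    case True then show ?thesis by simp
  next
    case False
    then obtain c' d' where cd: "c = ennreal c'" "d = ennreal d'" "0 \<le> c'" "0 \<le> d'" using c by (metis ennreal_cases infinity_ennreal_def)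
    have lim: "(\<lambda>n. ennreal ((inverse (real (Suc n)) * c' + d')\<^sup>2)) \<longlonglongrightarrow> ennreal ((0 * c' + d')\<^sup>2)"
      by (intro tendsto_intros LIMSEQ_inverse_real_of_nat)
    have "(ennreal (1 / real (Suc n)) * c + d)\<^sup>2 = ennreal ((inverse (real (Suc n)) * c' + d')\<^sup>2)" for n
      using cd by (simp add: ennreal_mult[symmetric] ennreal_plus[symmetric] ennreal_power inverse_eq_divide del: ennreal_plus)
    then have "\<forall>n. (\<integral>\<^sup>+x. ennreal (\<bar>u x\<bar> ^ (2 * k)) \<partial>lborel) \<le> ennreal ((inverse (real (Suc n)) * c' + d')\<^sup>2)"
      using b by (simp only:) blast
    then have "(\<integral>\<^sup>+x. ennreal (\<bar>u x\<bar> ^ (2 * k)) \<partial>lborel) \<le> ennreal ((0 * c' + d')\<^sup>2)"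
      by (intro LIMSEQ_le_const[OF lim]) blast
    then show ?thesis using cd by (simp add: ennreal_power)
  qed
  also have "d = (\<integral>\<^sup>+x. ennreal (real k * \<bar>u x\<bar> ^ (k - 1)) * ennreal (norm (g x)) \<partial>lborel)"
    unfolding d_def by (simp add: ennreal_mult)
  also have "\<dots>\<^sup>2 \<le> (\<integral>\<^sup>+x. (ennreal (real k * \<bar>u x\<bar> ^ (k - 1)))\<^sup>2 \<partial>lborel) * (\<integral>\<^sup>+x. (ennreal (norm (g x)))\<^sup>2 \<partial>lborel)"
    by (rule Cauchy_Schwarz_nn_integral) auto
  also have "(\<integral>\<^sup>+x. (ennreal (real k * \<bar>u x\<bar> ^ (k - 1)))\<^sup>2 \<partial>lborel) = ennreal ((real k)\<^sup>2) * (\<integral>\<^sup>+x. ennreal (\<bar>u x\<bar> ^ (2 * (k - 1))) \<partial>lborel)"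
    by (subst nn_integral_cmult[symmetric])
      (auto simp: ennreal_power power_mult_distrib power_mult[symmetric] mult.commute ennreal_mult[symmetric] intro!: nn_integral_cong)
  finally show ?thesis by (simp add: ennreal_power)
qed

text \<open>
  Each application of the previous lemma raises the exponent by two at the cost of a factor \<open>A u\<close>. The
  moment of order \<open>k + 2\<close> that it requires to be finite lies between orders already known.
\<close>

theorem H1_even_moments:
  assumes u: "u \<in> H1"
  shows "integrable lborel (\<lambda>x. \<bar>u x\<bar> ^ (2 * Suc k)) \<and>
    (LBINT x. \<bar>u x\<bar> ^ (2 * Suc k)) \<le> (fact (Suc k))\<^sup>2 * A u ^ k * mass u"
proof (induction k)
  case 0
  then show ?case using H1_D(2)[OF u] by simp
next
  case (Suc k)
  note [measurable] = H1_D(1)[OF u]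
  have i2: "integrable lborel (\<lambda>x. \<bar>u x\<bar> ^ 2)" using H1_D(2)[OF u] by simp
  have "integrable lborel (\<lambda>x. \<bar>u x\<bar> ^ 2 + \<bar>u x\<bar> ^ (2 * Suc k))" using i2 Suc by auto
  then have i: "integrable lborel (\<lambda>x. \<bar>u x\<bar> ^ Suc (Suc k))"
  proof (rule integrable_dominated)
    have "y ^ Suc (Suc k) \<le> y ^ 2 + y ^ (2 * Suc k)" if "0 \<le> y" for y :: real
    proof (cases "y \<le> 1")
      case True
      then have "y ^ Suc (Suc k) \<le> y ^ 2" using that by (intro power_decreasing) auto
      then show ?thesis using that by (simp add: add_increasing2)
    next
      case False
      then have "y ^ Suc (Suc k) \<le> y ^ (2 * Suc k)" by (intro power_increasing) auto
      then show ?thesis using that by (simp add: add_increasing)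
    qed
    then show "\<bar>\<bar>u x\<bar> ^ Suc (Suc k)\<bar> \<le> \<bar>u x\<bar> ^ 2 + \<bar>u x\<bar> ^ (2 * Suc k)" for x
      by (metis abs_ge_zero abs_idempotent power_abs)
  qed measurable
  have "(\<integral>\<^sup>+x. ennreal (\<bar>u x\<bar> ^ (2 * Suc (Suc k))) \<partial>lborel) \<le>
     ennreal ((real (Suc (Suc k)))\<^sup>2) * (\<integral>\<^sup>+x. ennreal (\<bar>u x\<bar> ^ (2 * Suc k)) \<partial>lborel) * (\<integral>\<^sup>+x. ennreal ((norm (weak_grad u x))\<^sup>2) \<partial>lborel)"
    using power_moment_step[OF H1_D(3,4)[OF u] i] by simp
  also have "(\<integral>\<^sup>+x. ennreal ((norm (weak_grad u x))\<^sup>2) \<partial>lborel) = ennreal (A u)"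
    unfolding A_def by (rule nn_integral_eq_integral[OF H1_D(4)[OF u]]) simp
  also have "(\<integral>\<^sup>+x. ennreal (\<bar>u x\<bar> ^ (2 * Suc k)) \<partial>lborel) = ennreal (LBINT x. \<bar>u x\<bar> ^ (2 * Suc k))"
    using Suc by (intro nn_integral_eq_integral) auto
  also have "ennreal ((real (Suc (Suc k)))\<^sup>2) * ennreal (LBINT x. \<bar>u x\<bar> ^ (2 * Suc k)) * ennreal (A u) =
     ennreal ((real (Suc (Suc k)))\<^sup>2 * (LBINT x. \<bar>u x\<bar> ^ (2 * Suc k)) * A u)"
    by (simp add: ennreal_mult A_nonneg del: power_Suc mult_Suc_right)
  also have "\<dots> \<le> ennreal ((real (Suc (Suc k)))\<^sup>2 * ((fact (Suc k))\<^sup>2 * A u ^ k * mass u) * A u)"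
    using Suc by (intro ennreal_leI mult_right_mono mult_left_mono) (auto simp: A_nonneg)
  also have "(real (Suc (Suc k)))\<^sup>2 * ((fact (Suc k))\<^sup>2 * A u ^ k * mass u) * A u =
     (fact (Suc (Suc k)))\<^sup>2 * A u ^ Suc k * mass u"
    unfolding fact_Suc[of "Suc k"] power_mult_distrib by (simp only: power_Suc mult_ac of_nat_Suc)
  finally have le: "(\<integral>\<^sup>+x. ennreal (\<bar>u x\<bar> ^ (2 * Suc (Suc k))) \<partial>lborel) \<le> ennreal ((fact (Suc (Suc k)))\<^sup>2 * A u ^ Suc k * mass u)" .
  have int: "integrable lborel (\<lambda>x. \<bar>u x\<bar> ^ (2 * Suc (Suc k)))"
    by (rule integrableI_bounded) (use le in \<open>auto simp: less_top[symmetric] top_unique\<close>)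
  moreover have "(LBINT x. \<bar>u x\<bar> ^ (2 * Suc (Suc k))) \<le> (fact (Suc (Suc k)))\<^sup>2 * A u ^ Suc k * mass u"
  proof -
    have "ennreal (LBINT x. \<bar>u x\<bar> ^ (2 * Suc (Suc k))) = (\<integral>\<^sup>+x. ennreal (\<bar>u x\<bar> ^ (2 * Suc (Suc k))) \<partial>lborel)"
      using int by (intro nn_integral_eq_integral[symmetric]) auto
    moreover have "0 \<le> (fact (Suc (Suc k)))\<^sup>2 * A u ^ Suc k * mass u"
      by (intro mult_nonneg_nonneg zero_le_power A_nonneg) auto
    ultimately show ?thesis using le by (metis ennreal_le_iff)
  qed
  ultimately show ?case by blast
qed

lemma powr_le_square_plus_power:
  fixes y p :: real
  assumes "2 \<le> p" "p \<le> 2 * real (Suc k)"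
  shows "\<bar>y\<bar> powr p \<le> y\<^sup>2 + \<bar>y\<bar> ^ (2 * Suc k)"
proof (cases "\<bar>y\<bar> \<le> 1")
  case True
  have "\<bar>y\<bar> powr p \<le> \<bar>y\<bar> powr 2"
    using True assms by (cases "y = 0") (auto simp del: powr_numeral intro!: powr_mono')
  also have "\<dots> = y\<^sup>2" by (cases "y = 0") (auto simp: powr_numeral)
  finally show ?thesis by (simp add: add_increasing2)
next
  case False
  then have "\<bar>y\<bar> powr p \<le> \<bar>y\<bar> powr real (2 * Suc k)" using assms by (intro powr_mono) auto
  also have "\<dots> = \<bar>y\<bar> ^ (2 * Suc k)" using False by (intro powr_realpow) auto
  finally show ?thesis by (simp add: add_increasing)
qed

text \<open>
  Every power of order at least two is dominated by the square plus a high even power. The bound has the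
  mass as a factor, so that it also shows convergence to zero of moments when only the mass tends to
  zero and \<open>A\<close> stays bounded.
\<close>

lemma H1_powr_moment:
  assumes u: "u \<in> H1" and p: "2 \<le> p" "p \<le> 2 * real (Suc k)"
  shows "integrable lborel (\<lambda>x. \<bar>u x\<bar> powr p)"
    and "C p u \<le> (1 + (fact (Suc k))\<^sup>2 * A u ^ k) * mass u"
proof -
  note [measurable] = H1_D(1)[OF u]
  have i: "integrable lborel (\<lambda>x. (u x)\<^sup>2 + \<bar>u x\<bar> ^ (2 * Suc k))"
    using H1_D(2)[OF u] H1_even_moments[OF u, of k] by auto
  show int: "integrable lborel (\<lambda>x. \<bar>u x\<bar> powr p)"
    by (rule integrable_dominated[OF i]) (use powr_le_square_plus_power[OF p] in auto)
  have "C p u \<le> (LBINT x. (u x)\<^sup>2 + \<bar>u x\<bar> ^ (2 * Suc k))"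
    unfolding C_def by (intro integral_mono int i powr_le_square_plus_power p)
  also have "\<dots> \<le> (1 + (fact (Suc k))\<^sup>2 * A u ^ k) * mass u"
    using H1_D(2)[OF u] H1_even_moments[OF u, of k]
    by (subst Bochner_Integration.integral_add) (auto simp: algebra_simps)
  finally show "C p u \<le> (1 + (fact (Suc k))\<^sup>2 * A u ^ k) * mass u" .
qed

lemma exists_even_exponent: "\<exists>k. p \<le> 2 * real (Suc k)"
proof -
  obtain n :: nat where "p \<le> real n" using real_arch_simple by blast
  then show ?thesis by (intro exI[of _ n]) auto
qed

lemma H1_fourth_moment:
  assumes u: "u \<in> H1"
  shows "integrable lborel (\<lambda>x. (u x) ^ 4)" "(LBINT x. (u x) ^ 4) \<le> 4 * A u * mass u"
proof -
  have "\<bar>y\<bar> ^ (2 * Suc 1) = y ^ 4" for y :: real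
  proof -
    have "2 * Suc 1 = 4" by simp
    then show ?thesis by (metis power_even_abs_numeral even_numeral)
  qed
  then have *: "integrable lborel (\<lambda>x. (u x) ^ 4) \<and> (LBINT x. (u x) ^ 4) \<le> (fact (Suc 1))\<^sup>2 * A u ^ 1 * mass u"
    using H1_even_moments[OF u, of 1] by (simp only:)
  have "(fact (Suc 1))\<^sup>2 * A u ^ 1 = 4 * A u" by (simp add: power2_eq_square)
  with * show "integrable lborel (\<lambda>x. (u x) ^ 4)" "(LBINT x. (u x) ^ 4) \<le> 4 * A u * mass u"
    by metis+
qed

text \<open>
  Ladyzhenskaya's inequality. It shows that the set whose infimum is \<open>K_GN 4\<close> is not empty.
\<close>

lemma GN_inequality_4: "GN_inequality 4 4"
  unfolding GN_inequality_def
proof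
  fix u assume u: "u \<in> H1"
  have p: "\<bar>y\<bar> powr 4 = y ^ 4" for y :: real
    by (cases "y = 0") (auto simp: powr_numeral)
  have "sqrt (A u) powr (4 - 2) = A u"
    using A_nonneg[of u] by (cases "A u = 0") (auto simp: powr_numeral)
  then show "integrable lborel (\<lambda>x. \<bar>u x\<bar> powr 4) \<and> (LBINT x. \<bar>u x\<bar> powr 4) \<le>
       4 * sqrt (LBINT x. (norm (weak_grad u x))\<^sup>2) powr (4 - 2) * (sqrt (mass u))\<^sup>2"
    using H1_fourth_moment[OF u] unfolding p A_def by simp
qed

section \<open>Convergence theorems and completeness of L2\<close>

lemma Fatou_integrable:
  fixes f :: "nat \<Rightarrow> 'a \<Rightarrow> real"
  assumes f: "\<And>n. integrable M (f n)" "\<And>n x. 0 \<le> f n x" and [measurable]: "w \<in> borel_measurable M"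
    and lim: "AE x in M. (\<lambda>n. f n x) \<longlonglongrightarrow> w x"
    and B: "eventually (\<lambda>n. (\<integral>x. f n x \<partial>M) \<le> B) sequentially"
  shows "integrable M w" "(\<integral>x. w x \<partial>M) \<le> B"
proof -
  have [measurable]: "f n \<in> borel_measurable M" for n using f by auto
  have w0: "AE x in M. 0 \<le> w x"
    using lim by eventually_elim (auto intro: LIMSEQ_le_const f)
  have "(\<integral>\<^sup>+x. ennreal (w x) \<partial>M) = (\<integral>\<^sup>+x. liminf (\<lambda>n. ennreal (f n x)) \<partial>M)"
  proof (rule nn_integral_cong_AE)
    show "AE x in M. ennreal (w x) = liminf (\<lambda>n. ennreal (f n x))"
      using lim
    proof eventually_elim
      case (elim x)
      then have "(\<lambda>n. ennreal (f n x)) \<longlonglongrightarrow> ennreal (w x)" by (rule tendsto_ennrealI)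
      from lim_imp_Liminf[OF _ this] show ?case by simp
    qed
  qed
  also have "\<dots> \<le> liminf (\<lambda>n. \<integral>\<^sup>+x. ennreal (f n x) \<partial>M)"
    by (rule nn_integral_liminf) measurable
  also have "\<dots> = liminf (\<lambda>n. ennreal (\<integral>x. f n x \<partial>M))"
    using f by (simp add: nn_integral_eq_integral)
  also have "\<dots> \<le> ennreal B"
  proof -
    have "eventually (\<lambda>n. ennreal (\<integral>x. f n x \<partial>M) \<le> ennreal B) sequentially"
      using B by eventually_elim (rule ennreal_leI)
    then show ?thesis
      using Liminf_mono[of "\<lambda>n. ennreal (\<integral>x. f n x \<partial>M)" "\<lambda>_. ennreal B" sequentially] by (simp add: Liminf_const)
  qed
  finally have *: "(\<integral>\<^sup>+x. ennreal (w x) \<partial>M) \<le> ennreal B" .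
  have B0: "0 \<le> B"
  proof -
    obtain n where "(\<integral>x. f n x \<partial>M) \<le> B" using B unfolding eventually_sequentially by blast
    moreover have "0 \<le> (\<integral>x. f n x \<partial>M)" using f by simp
    ultimately show ?thesis by linarith
  qed
  show i: "integrable M w"
  proof (rule integrableI_nonneg[OF _ w0])
    show "(\<integral>\<^sup>+x. ennreal (w x) \<partial>M) < \<infinity>" using le_less_trans[OF * ennreal_less_top] by simp
  qed measurable
  show "(\<integral>x. w x \<partial>M) \<le> B"
    using * nn_integral_eq_integral[OF i w0] B0 by simp
qed

lemma not_eventually_subsequence:
  assumes "\<not> eventually P sequentially"
  obtains r where "strict_mono (r :: nat \<Rightarrow> nat)" "\<And>n. \<not> P (r n)"
proof -
  have "infinite {n. \<not> P n}"
    using assms by (simp add: INFM_iff_infinite[symmetric] cofinite_eq_sequentially frequently_def)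
  then show ?thesis using infinite_enumerate that by blast
qed

lemma Fatou_lower:
  fixes f :: "nat \<Rightarrow> 'a \<Rightarrow> real"
  assumes f: "\<And>n. integrable M (f n)" "\<And>n x. 0 \<le> f n x" and w: "w \<in> borel_measurable M"
    and lim: "AE x in M. (\<lambda>n. f n x) \<longlonglongrightarrow> w x" and e: "0 < e"
  shows "eventually (\<lambda>n. (\<integral>x. w x \<partial>M) - e < (\<integral>x. f n x \<partial>M)) sequentially"
proof (rule ccontr)
  assume "\<not> ?thesis"
  then obtain r where r: "strict_mono (r :: nat \<Rightarrow> nat)" "\<And>n. \<not> (\<integral>x. w x \<partial>M) - e < (\<integral>x. f (r n) x \<partial>M)"
    using not_eventually_subsequence by metis
  have "(\<integral>x. w x \<partial>M) \<le> (\<integral>x. w x \<partial>M) - e"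
  proof (rule Fatou_integrable(2)[of M "\<lambda>n. f (r n)"])
    show "AE x in M. (\<lambda>n. f (r n) x) \<longlonglongrightarrow> w x"
      using lim by eventually_elim (use LIMSEQ_subseq_LIMSEQ[OF _ r(1)] in \<open>auto simp: comp_def\<close>)
  qed (use f w r(2) in \<open>auto simp: not_less\<close>)
  with e show False by simp
qed

text \<open>
  Dominated convergence with a varying majorant whose integrals converge: Fatou's lemma is applied to
  \<open>h n + f n\<close> and to \<open>h n - f n\<close>.
\<close>

theorem Pratt_convergence:
  fixes f h :: "nat \<Rightarrow> 'a \<Rightarrow> real"
  assumes f: "\<And>n. f n \<in> borel_measurable M" "w \<in> borel_measurable M"
    and le: "\<And>n x. \<bar>f n x\<bar> \<le> h n x" and h: "\<And>n. integrable M (h n)" "integrable M H"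
    and lim: "AE x in M. (\<lambda>n. f n x) \<longlonglongrightarrow> w x" "AE x in M. (\<lambda>n. h n x) \<longlonglongrightarrow> H x"
    and hlim: "(\<lambda>n. \<integral>x. h n x \<partial>M) \<longlonglongrightarrow> (\<integral>x. H x \<partial>M)"
  shows "\<And>n. integrable M (f n)" "integrable M w" "(\<lambda>n. \<integral>x. f n x \<partial>M) \<longlonglongrightarrow> (\<integral>x. w x \<partial>M)"
proof -
  note [measurable] = f
  show fi: "integrable M (f n)" for n
    by (rule integrable_dominated[OF h(1)[of n] f(1) le])
  have "AE x in M. norm (w x) \<le> norm (H x)"
    using lim
  proof eventually_elim
    case (elim x)
    have "\<bar>w x\<bar> \<le> H x" by (rule tendsto_le[OF _ elim(2) tendsto_rabs[OF elim(1)]]) (auto simp: le)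
    then show ?case by simp
  qed
  then show wi: "integrable M w" by (rule Bochner_Integration.integrable_bound[OF h(2) f(2)])
  have one: "eventually (\<lambda>n. s * (\<integral>x. w x \<partial>M) - e < s * (\<integral>x. f n x \<partial>M)) sequentially" if "e > 0" "s = 1 \<or> s = -1" for e s :: real
  proof -
    have "eventually (\<lambda>n. (\<integral>x. H x + s * w x \<partial>M) - e / 2 < (\<integral>x. h n x + s * f n x \<partial>M)) sequentially"
    proof (rule Fatou_lower)
      show "0 \<le> h n x + s * f n x" for n x using le[of n x] that by auto
      show "AE x in M. (\<lambda>n. h n x + s * f n x) \<longlonglongrightarrow> H x + s * w x"
        using lim by eventually_elim (intro tendsto_intros)
    qed (use h fi wi that in auto)
    moreover have "eventually (\<lambda>n. \<bar>(\<integral>x. h n x \<partial>M) - (\<integral>x. H x \<partial>M)\<bar> < e / 2) sequentially"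
      using hlim that(1) by (auto simp: tendsto_iff dist_real_def dest!: spec[of _ "e / 2"])
    ultimately show ?thesis
    proof eventually_elim
      case (elim n)
      have "(\<integral>x. H x + s * w x \<partial>M) = (\<integral>x. H x \<partial>M) + s * (\<integral>x. w x \<partial>M)"
        "(\<integral>x. h n x + s * f n x \<partial>M) = (\<integral>x. h n x \<partial>M) + s * (\<integral>x. f n x \<partial>M)"
        using h fi wi by simp_all
      with elim show ?case by linarith
    qed
  qed
  show "(\<lambda>n. \<integral>x. f n x \<partial>M) \<longlonglongrightarrow> (\<integral>x. w x \<partial>M)"
  proof (rule tendstoI)
    fix e :: real assume "0 < e"
    from one[OF this disjI1[OF refl]] one[OF this disjI2[OF refl]]
    show "\<forall>\<^sub>F n in sequentially. dist (\<integral>x. f n x \<partial>M) (\<integral>x. w x \<partial>M) < e"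
    proof eventually_elim
      case (elim n)
      then show ?case by (simp add: dist_real_def abs_less_iff)
    qed
  qed
qed

lemma Cauchy_Schwarz_integral:
  fixes f g :: "'a \<Rightarrow> real"
  assumes [measurable]: "f \<in> borel_measurable M" "g \<in> borel_measurable M"
    and i: "integrable M (\<lambda>x. (f x)\<^sup>2)" "integrable M (\<lambda>x. (g x)\<^sup>2)"
  shows "integrable M (\<lambda>x. f x * g x)" "(\<integral>x. f x * g x \<partial>M)\<^sup>2 \<le> (\<integral>x. (f x)\<^sup>2 \<partial>M) * (\<integral>x. (g x)\<^sup>2 \<partial>M)"
proof -
  show int: "integrable M (\<lambda>x. f x * g x)"
  proof (rule integrable_dominated)
    show "integrable M (\<lambda>x. (f x)\<^sup>2 + (g x)\<^sup>2)" using i by simp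
    have "\<bar>a * b\<bar> \<le> a\<^sup>2 + b\<^sup>2" for a b :: real
    proof -
      have "0 \<le> (\<bar>a\<bar> - \<bar>b\<bar>)\<^sup>2 + a\<^sup>2 + b\<^sup>2" by simp
      also have "\<dots> = 2 * (a\<^sup>2 + b\<^sup>2 - \<bar>a * b\<bar>)" by (simp add: power2_diff abs_mult)
      finally show ?thesis by simp
    qed
    then show "\<bar>f x * g x\<bar> \<le> (f x)\<^sup>2 + (g x)\<^sup>2" for x .
  qed measurable
  have sq: "(ennreal \<bar>a\<bar>)\<^sup>2 = ennreal (a\<^sup>2)" for a :: real by (simp add: ennreal_power)
  have "ennreal ((\<integral>x. f x * g x \<partial>M)\<^sup>2) = (ennreal \<bar>\<integral>x. f x * g x \<partial>M\<bar>)\<^sup>2" by (simp add: ennreal_power)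
  also have "\<dots> \<le> (\<integral>\<^sup>+x. ennreal \<bar>f x\<bar> * ennreal \<bar>g x\<bar> \<partial>M)\<^sup>2"
    using integral_norm_bound_ennreal[OF int] by (intro power_mono) (auto simp: abs_mult ennreal_mult)
  also have "\<dots> \<le> (\<integral>\<^sup>+x. (ennreal \<bar>f x\<bar>)\<^sup>2 \<partial>M) * (\<integral>\<^sup>+x. (ennreal \<bar>g x\<bar>)\<^sup>2 \<partial>M)"
    by (rule Cauchy_Schwarz_nn_integral) auto
  also have "\<dots> = ennreal ((\<integral>x. (f x)\<^sup>2 \<partial>M) * (\<integral>x. (g x)\<^sup>2 \<partial>M))"
    unfolding sq using i by (simp add: nn_integral_eq_integral ennreal_mult)
  finally show "(\<integral>x. f x * g x \<partial>M)\<^sup>2 \<le> (\<integral>x. (f x)\<^sup>2 \<partial>M) * (\<integral>x. (g x)\<^sup>2 \<partial>M)"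
    by simp
qed

lemma square_add_integrable:
  fixes f g :: "'a \<Rightarrow> real"
  assumes "f \<in> borel_measurable M" "g \<in> borel_measurable M"
    and "integrable M (\<lambda>x. (f x)\<^sup>2)" "integrable M (\<lambda>x. (g x)\<^sup>2)"
  shows "integrable M (\<lambda>x. (f x + g x)\<^sup>2)" "integrable M (\<lambda>x. (f x - g x)\<^sup>2)"
  using integrable_square_add[of f M g] integrable_square_add[of f M "\<lambda>x. - g x"] assms by auto

text \<open>
  The Riesz--Fischer theorem. Along a subsequence with rapidly decreasing distances the weighted squared
  increments have a finite sum almost everywhere, so the subsequence converges pointwise; Fatou's lemma
  shows that the limit is attained in the mean by the whole sequence.
\<close>

theorem L2_complete:
  fixes f :: "nat \<Rightarrow> 'a \<Rightarrow> real"
  assumes [measurable]: "\<And>n. f n \<in> borel_measurable M" and f2: "\<And>n. integrable M (\<lambda>x. (f n x)\<^sup>2)"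
    and Cauchy: "\<And>e. 0 < e \<Longrightarrow> \<exists>N. \<forall>m\<ge>N. \<forall>n\<ge>N. (\<integral>x. (f m x - f n x)\<^sup>2 \<partial>M) < e"
  obtains w r where "w \<in> borel_measurable M" "integrable M (\<lambda>x. (w x)\<^sup>2)" "strict_mono (r :: nat \<Rightarrow> nat)"
    "AE x in M. (\<lambda>k. f (r k) x) \<longlonglongrightarrow> w x" "(\<lambda>n. \<integral>x. (f n x - w x)\<^sup>2 \<partial>M) \<longlonglongrightarrow> 0"
proof -
  \<comment> \<open>The rate \<open>1/8\<close> leaves a summable \<open>1/4\<close> after the weight \<open>2\<close> in \<open>D\<close>, which in turn forces pointwise geometric decay.\<close>
  have "\<exists>N. \<forall>m\<ge>N. \<forall>n\<ge>N. (\<integral>x. (f m x - f n x)\<^sup>2 \<partial>M) < (1/8) ^ k" for k :: nat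
    by (rule Cauchy) simp
  then have "\<forall>k. \<exists>N. \<forall>m\<ge>N. \<forall>n\<ge>N. (\<integral>x. (f m x - f n x)\<^sup>2 \<partial>M) < (1/8) ^ k" by blast
  from choice[OF this] obtain N
    where N: "\<And>k m n. m \<ge> N k \<Longrightarrow> n \<ge> N k \<Longrightarrow> (\<integral>x. (f m x - f n x)\<^sup>2 \<partial>M) < (1/8) ^ k" by blast
  define r where "r k = (\<Sum>i\<le>k. Suc (N i))" for k
  have r: "strict_mono r" by (auto simp: strict_mono_Suc_iff r_def)
  have rN: "N k \<le> r k" for k
    using member_le_sum[of k "{..k}" "\<lambda>i. Suc (N i)"] by (simp add: r_def)
  have fd: "integrable M (\<lambda>x. (f m x - f n x)\<^sup>2)" for m n
    by (intro square_add_integrable f2) measurable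
  define D where "D k x = 2 ^ k * (f (r (Suc k)) x - f (r k) x)\<^sup>2" for k x
  have [measurable]: "D k \<in> borel_measurable M" for k unfolding D_def by measurable
  have D0: "0 \<le> D k x" for k x by (simp add: D_def)
  have "(\<integral>\<^sup>+x. ennreal (D k x) \<partial>M) \<le> ennreal ((1/4) ^ k)" for k
  proof -
    have "(\<integral>\<^sup>+x. ennreal (D k x) \<partial>M) = ennreal (\<integral>x. D k x \<partial>M)"
      unfolding D_def using fd by (intro nn_integral_eq_integral) auto
    also have "(\<integral>x. D k x \<partial>M) = 2 ^ k * (\<integral>x. (f (r (Suc k)) x - f (r k) x)\<^sup>2 \<partial>M)" by (simp add: D_def)
    also have "\<dots> \<le> 2 ^ k * (1/8) ^ k"
    proof -
      have "N k \<le> r (Suc k)" using rN[of k] strict_monoD[OF r, of k "Suc k"] by simp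
      from N[OF this rN] show ?thesis by (intro mult_left_mono) auto
    qed
    also have "\<dots> = (1/4) ^ k" by (simp flip: power_mult_distrib)
    finally show ?thesis by (simp add: ennreal_leI)
  qed
  then have "(\<integral>\<^sup>+x. (\<Sum>k. ennreal (D k x)) \<partial>M) \<le> (\<Sum>k. ennreal ((1/4) ^ k))"
    by (subst nn_integral_suminf) (auto intro!: suminf_le)
  also have "\<dots> = ennreal (\<Sum>k. (1/4) ^ k)" by (rule suminf_ennreal2) (auto intro: summable_geometric)
  finally have "(\<integral>\<^sup>+x. (\<Sum>k. ennreal (D k x)) \<partial>M) \<noteq> \<infinity>" using le_less_trans[OF _ ennreal_less_top] by fastforce
  then have "AE x in M. (\<Sum>k. ennreal (D k x)) \<noteq> \<infinity>"
    by (intro nn_integral_PInf_AE) auto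
  then have conv: "AE x in M. convergent (\<lambda>k. f (r k) x)"
  proof eventually_elim
    case (elim x)
    have sD: "summable (\<lambda>k. D k x)" using elim D0 by (intro summable_suminf_not_top) auto
    define K where "K = (\<Sum>k. D k x)"
    have "\<bar>f (r (Suc k)) x - f (r k) x\<bar> \<le> sqrt K * (1 / sqrt 2) ^ k" for k
    proof -
      have "2 ^ k * (f (r (Suc k)) x - f (r k) x)\<^sup>2 \<le> K"
        using sum_le_suminf[OF sD, of "{k}"] D0 by (auto simp: K_def D_def)
      then have "(f (r (Suc k)) x - f (r k) x)\<^sup>2 \<le> K * (1/2) ^ k" by (simp add: field_simps power_divide)
      then have "\<bar>f (r (Suc k)) x - f (r k) x\<bar> \<le> sqrt (K * (1/2) ^ k)"
        by (metis real_sqrt_abs real_sqrt_le_mono)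
      then show ?thesis by (simp add: real_sqrt_mult real_sqrt_power real_sqrt_divide)
    qed
    moreover have "summable (\<lambda>k. sqrt K * (1 / sqrt 2) ^ k)"
      by (intro summable_mult summable_geometric) simp
    ultimately have "summable (\<lambda>k. f (r (Suc k)) x - f (r k) x)"
      using summable_comparison_test'[of "\<lambda>k. sqrt K * (1 / sqrt 2) ^ k" 0 "\<lambda>k. f (r (Suc k)) x - f (r k) x"] by simp
    then have "(\<lambda>n. (\<Sum>k<n. f (r (Suc k)) x - f (r k) x) + f (r 0) x) \<longlonglongrightarrow> (\<Sum>k. f (r (Suc k)) x - f (r k) x) + f (r 0) x"
      by (intro tendsto_add summable_LIMSEQ tendsto_const)
    moreover have "(\<Sum>k<n. f (r (Suc k)) x - f (r k) x) + f (r 0) x = f (r n) x" for n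
      using sum_lessThan_telescope[of "\<lambda>k. f (r k) x" n] by linarith
    ultimately show ?case by (simp only:) (rule convergentI)
  qed
  define w where "w x = lim (\<lambda>k. f (r k) x)" for x
  have w[measurable]: "w \<in> borel_measurable M" unfolding w_def by measurable
  have lim: "AE x in M. (\<lambda>k. f (r k) x) \<longlonglongrightarrow> w x"
    using conv by eventually_elim (simp add: w_def convergent_LIMSEQ_iff)
  have est: "integrable M (\<lambda>x. (f n x - w x)\<^sup>2) \<and> (\<integral>x. (f n x - w x)\<^sup>2 \<partial>M) \<le> e" 
    if *: "\<And>m n. m \<ge> N' \<Longrightarrow> n \<ge> N' \<Longrightarrow> (\<integral>x. (f m x - f n x)\<^sup>2 \<partial>M) < e" and "n \<ge> N'" for e N' n
  proof -
    have lim': "AE x in M. (\<lambda>k. (f n x - f (r k) x)\<^sup>2) \<longlonglongrightarrow> (f n x - w x)\<^sup>2"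
      using lim by eventually_elim (intro tendsto_intros)
    have bd: "eventually (\<lambda>k. (\<integral>x. (f n x - f (r k) x)\<^sup>2 \<partial>M) \<le> e) sequentially"
      using eventually_ge_at_top[of N']
    proof eventually_elim
      case (elim k)
      have "N' \<le> r k" using elim seq_suble[OF r, of k] by simp
      then show ?case using *[OF \<open>n \<ge> N'\<close>, of "r k"] by simp
    qed
    have m: "(\<lambda>x. (f n x - w x)\<^sup>2) \<in> borel_measurable M" by measurable
    show ?thesis
      using Fatou_integrable[OF fd zero_le_power2 m lim' bd] by blast
  qed
  have wi: "integrable M (\<lambda>x. (w x)\<^sup>2)"
  proof -
    have *: "integrable M (\<lambda>x. (f (N 0) x - w x)\<^sup>2)" using est[of "N 0" "(1/8)^0" "N 0"] N[of 0] by auto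
    have "integrable M (\<lambda>x. (f (N 0) x - (f (N 0) x - w x))\<^sup>2)"
      by (rule square_add_integrable(2)[OF _ _ f2 *]) measurable
    then show ?thesis by simp
  qed
  have "(\<lambda>n. \<integral>x. (f n x - w x)\<^sup>2 \<partial>M) \<longlonglongrightarrow> 0"
  proof (rule LIMSEQ_I)
    fix e :: real assume "0 < e"
    then obtain N' where N': "\<forall>m\<ge>N'. \<forall>n\<ge>N'. (\<integral>x. (f m x - f n x)\<^sup>2 \<partial>M) < e / 2" using Cauchy[of "e / 2"] by auto
    have "norm ((\<integral>x. (f n x - w x)\<^sup>2 \<partial>M) - 0) < e" if "n \<ge> N'" for n
    proof -
      have "0 \<le> (\<integral>x. (f n x - w x)\<^sup>2 \<partial>M)" by simp
      moreover have "(\<integral>x. (f n x - w x)\<^sup>2 \<partial>M) \<le> e / 2" using est[of N' "e/2" n] N' that by blast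
      ultimately show ?thesis using \<open>0 < e\<close> by simp
    qed
    then show "\<exists>no. \<forall>n\<ge>no. norm ((\<integral>x. (f n x - w x)\<^sup>2 \<partial>M) - 0) < e" by blast
  qed
  then show ?thesis using that[OF w wi r lim] by blast
qed

lemma L2_limit_integral_mult:
  fixes f :: "nat \<Rightarrow> 'a \<Rightarrow> real"
  assumes [measurable]: "\<And>n. f n \<in> borel_measurable M" "w \<in> borel_measurable M" "\<psi> \<in> borel_measurable M"
    and i: "\<And>n. integrable M (\<lambda>x. (f n x)\<^sup>2)" "integrable M (\<lambda>x. (w x)\<^sup>2)" "integrable M (\<lambda>x. (\<psi> x)\<^sup>2)"
    and lim: "(\<lambda>n. \<integral>x. (f n x - w x)\<^sup>2 \<partial>M) \<longlonglongrightarrow> 0"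
  shows "(\<lambda>n. \<integral>x. f n x * \<psi> x \<partial>M) \<longlonglongrightarrow> (\<integral>x. w x * \<psi> x \<partial>M)"
proof -
  have d: "integrable M (\<lambda>x. (f n x - w x)\<^sup>2)" for n by (intro square_add_integrable i) measurable
  have eq: "(\<integral>x. f n x * \<psi> x \<partial>M) - (\<integral>x. w x * \<psi> x \<partial>M) = (\<integral>x. (f n x - w x) * \<psi> x \<partial>M)" for n
    using Cauchy_Schwarz_integral(1)[of "f n" M \<psi>] Cauchy_Schwarz_integral(1)[of w M \<psi>] i
    by (simp add: left_diff_distrib)
  have "(\<lambda>n. (\<integral>x. (f n x - w x)\<^sup>2 \<partial>M) * (\<integral>x. (\<psi> x)\<^sup>2 \<partial>M)) \<longlonglongrightarrow> 0 * (\<integral>x. (\<psi> x)\<^sup>2 \<partial>M)"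
    by (intro tendsto_intros lim)
  then have up: "(\<lambda>n. (\<integral>x. (f n x - w x)\<^sup>2 \<partial>M) * (\<integral>x. (\<psi> x)\<^sup>2 \<partial>M)) \<longlonglongrightarrow> 0" by simp
  have "(\<integral>x. (f n x - w x) * \<psi> x \<partial>M)\<^sup>2 \<le> (\<integral>x. (f n x - w x)\<^sup>2 \<partial>M) * (\<integral>x. (\<psi> x)\<^sup>2 \<partial>M)" for n
    by (rule Cauchy_Schwarz_integral(2)[OF _ _ d i(3)]) measurable
  then have "(\<lambda>n. (\<integral>x. (f n x - w x) * \<psi> x \<partial>M)\<^sup>2) \<longlonglongrightarrow> 0"
    by (intro tendsto_sandwich[OF _ _ tendsto_const up] always_eventually allI zero_le_power2)
  then have "(\<lambda>n. sqrt ((\<integral>x. (f n x - w x) * \<psi> x \<partial>M)\<^sup>2)) \<longlonglongrightarrow> sqrt 0" by (rule tendsto_real_sqrt)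
  then have "(\<lambda>n. (\<integral>x. f n x * \<psi> x \<partial>M) - (\<integral>x. w x * \<psi> x \<partial>M)) \<longlonglongrightarrow> 0"
    by (simp add: eq tendsto_rabs_zero_iff)
  then show ?thesis by (rule Lim_null[THEN iffD2])
qed

lemma L2_limit_integral_square:
  fixes f :: "nat \<Rightarrow> 'a \<Rightarrow> real"
  assumes [measurable]: "\<And>n. f n \<in> borel_measurable M" "w \<in> borel_measurable M"
    and i: "\<And>n. integrable M (\<lambda>x. (f n x)\<^sup>2)" "integrable M (\<lambda>x. (w x)\<^sup>2)"
    and lim: "(\<lambda>n. \<integral>x. (f n x - w x)\<^sup>2 \<partial>M) \<longlonglongrightarrow> 0"
  shows "(\<lambda>n. \<integral>x. (f n x)\<^sup>2 \<partial>M) \<longlonglongrightarrow> (\<integral>x. (w x)\<^sup>2 \<partial>M)"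
proof -
  have d: "integrable M (\<lambda>x. (f n x - w x)\<^sup>2)" for n by (intro square_add_integrable i) measurable
  have fw: "integrable M (\<lambda>x. f n x * w x)" for n by (intro Cauchy_Schwarz_integral i) measurable
  have "(\<integral>x. (f n x)\<^sup>2 \<partial>M) = (\<integral>x. (f n x - w x)\<^sup>2 + 2 * (f n x * w x) - (w x)\<^sup>2 \<partial>M)" for n
    by (intro Bochner_Integration.integral_cong) (auto simp: power2_eq_square algebra_simps)
  also have "\<dots> n = (\<integral>x. (f n x - w x)\<^sup>2 \<partial>M) + 2 * (\<integral>x. f n x * w x \<partial>M) - (\<integral>x. (w x)\<^sup>2 \<partial>M)" for n
    using d fw i by simp
  finally have eq: "(\<integral>x. (f n x)\<^sup>2 \<partial>M) = (\<integral>x. (f n x - w x)\<^sup>2 \<partial>M) + 2 * (\<integral>x. f n x * w x \<partial>M) - (\<integral>x. (w x)\<^sup>2 \<partial>M)" for n .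
  have "(\<lambda>n. (\<integral>x. (f n x - w x)\<^sup>2 \<partial>M) + 2 * (\<integral>x. f n x * w x \<partial>M) - (\<integral>x. (w x)\<^sup>2 \<partial>M)) \<longlonglongrightarrow>
     0 + 2 * (\<integral>x. w x * w x \<partial>M) - (\<integral>x. (w x)\<^sup>2 \<partial>M)"
    by (intro tendsto_intros lim L2_limit_integral_mult i) measurable
  then show ?thesis unfolding eq by (simp add: power2_eq_square)
qed

section \<open>Lower semicontinuity of the Dirichlet energy\<close>

lemma norm_plane_square: "(norm (y::plane))\<^sup>2 = (y $ 1)\<^sup>2 + (y $ 2)\<^sup>2"
  unfolding power2_norm_eq_inner by (simp add: inner_vec_def sum_2 power2_eq_square)

lemma integrable_component_square:
  fixes g :: "plane \<Rightarrow> plane"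
  assumes [measurable]: "g \<in> borel_measurable borel" and "integrable lborel (\<lambda>x. (norm (g x))\<^sup>2)"
  shows "integrable lborel (\<lambda>x. (g x $ i)\<^sup>2)"
proof (rule integrable_dominated[OF assms(2)])
  show "\<bar>(g x $ i)\<^sup>2\<bar> \<le> (norm (g x))\<^sup>2" for x
    using component_le_norm_cart[of "g x" i] by (metis abs_ge_zero abs_power2 power2_abs power_mono)
qed measurable

text \<open>
  Test functions and their derivatives are square integrable, so both sides of the defining equation pass
  to the limit.
\<close>

lemma is_weak_gradient_L2_limit:
  assumes [measurable]: "w \<in> borel_measurable borel" "g \<in> borel_measurable borel"
    and w: "integrable lborel (\<lambda>x. (w x)\<^sup>2)" and g: "integrable lborel (\<lambda>x. (norm (g x))\<^sup>2)"
    and h: "\<And>n. h n \<in> H1"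
    and lim: "(\<lambda>n. sqdist (h n) w) \<longlonglongrightarrow> 0"
    and glim: "\<And>i. (\<lambda>n. LBINT x. (weak_grad (h n) x $ i - g x $ i)\<^sup>2) \<longlonglongrightarrow> 0"
  shows "is_weak_gradient w g"
  unfolding is_weak_gradient_def
proof (intro conjI allI impI)
  show "locally_integrable w" "locally_integrable g" using w g by (auto intro!: locally_integrable_L2)
  note [measurable] = H1_D(1,5)[OF h]
  fix \<phi> i assume t: "test_function \<phi>"
  note [measurable] = test_functionD(4,5)[OF t]
  obtain K R where *: "\<And>x. R < norm x \<Longrightarrow> \<phi> x = 0" "\<And>x. R < norm x \<Longrightarrow> partial i \<phi> x = 0"
      "\<And>x. \<bar>\<phi> x\<bar> \<le> K" "\<And>x. \<bar>partial i \<phi> x\<bar> \<le> K"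
    using test_function_bounded[OF t] by metis
  have b: "integrable lborel (\<lambda>x. (f x)\<^sup>2)" if [measurable]: "f \<in> borel_measurable borel"
    and f: "\<And>x. \<bar>f x\<bar> \<le> K" "\<And>x. R < norm x \<Longrightarrow> f x = 0" for f :: "plane \<Rightarrow> real"
  proof (rule integrable_dominated)
    show "integrable lborel (\<lambda>x::plane. K\<^sup>2 * indicator (cball 0 R) x :: real)"
      using emeasure_bounded_finite[of "cball 0 R :: plane set"] by (intro integrable_mult_right integrable_real_indicator) auto
    show "\<bar>(f x)\<^sup>2\<bar> \<le> K\<^sup>2 * indicator (cball 0 R) x" for x
      using f(2)[of x] power_mono[OF f(1)[of x], of 2] by (auto simp: indicator_def)
  qed measurable
  have "(\<lambda>n. LBINT x. h n x * partial i \<phi> x) \<longlonglongrightarrow> (LBINT x. w x * partial i \<phi> x)"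
    by (rule L2_limit_integral_mult[OF _ _ _ H1_D(2)[OF h] w b[OF test_functionD(5)[OF t] *(4,2)] lim]) measurable
  moreover have "(\<lambda>n. LBINT x. weak_grad (h n) x $ i * \<phi> x) \<longlonglongrightarrow> (LBINT x. g x $ i * \<phi> x)"
    by (rule L2_limit_integral_mult[OF _ _ _ integrable_component_square[OF H1_D(5,4)[OF h]]
          integrable_component_square[OF _ g] b[OF test_functionD(4)[OF t] *(3,1)] glim]) measurable
  then have "(\<lambda>n. LBINT x. h n x * partial i \<phi> x) \<longlonglongrightarrow> - (LBINT x. g x $ i * \<phi> x)"
    using is_weak_gradientD[OF H1_D(3)[OF h] t, of _ i] by (simp add: tendsto_minus)
  ultimately show "(LBINT x. w x * partial i \<phi> x) = - (LBINT x. g x $ i * \<phi> x)"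
    by (rule LIMSEQ_unique)
qed

lemma A_diff:
  assumes "u \<in> H1" "v \<in> H1"
  shows "A (\<lambda>x. u x - v x) = (LBINT x. (weak_grad u x $ 1 - weak_grad v x $ 1)\<^sup>2) + (LBINT x. (weak_grad u x $ 2 - weak_grad v x $ 2)\<^sup>2)"
proof -
  note [measurable] = H1_D(5)[OF assms(1)] H1_D(5)[OF assms(2)]
  have "A (\<lambda>x. u x - v x) = (LBINT x. (weak_grad u x $ 1 - weak_grad v x $ 1)\<^sup>2 + (weak_grad u x $ 2 - weak_grad v x $ 2)\<^sup>2)"
    by (simp add: H1_diff(2)[OF assms] norm_plane_square)
  also have "\<dots> = (LBINT x. (weak_grad u x $ 1 - weak_grad v x $ 1)\<^sup>2) + (LBINT x. (weak_grad u x $ 2 - weak_grad v x $ 2)\<^sup>2)"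
    using integrable_component_square[OF _ H1_diff(3)[OF assms], of 1] integrable_component_square[OF _ H1_diff(3)[OF assms], of 2]
    by (intro Bochner_Integration.integral_add) auto
  finally show ?thesis .
qed

text \<open>
  Let \<open>a j\<close> be the infimum of \<open>A\<close> over the functions of \<open>H1\<close> in a ball around \<open>w\<close> whose radius tends to
  zero. If \<open>h j\<close> nearly attains \<open>a j\<close>, then by the parallelogram identity and convexity of the balls the
  gradients of the \<open>h j\<close> form a Cauchy sequence. Their limit is a weak gradient of \<open>w\<close>, and its energy
  is the limit of the numbers \<open>a j\<close>.
\<close>

theorem H1_closed_lsc:
  assumes w[measurable]: "w \<in> borel_measurable borel" and w2: "integrable lborel (\<lambda>x. (w x)\<^sup>2)"
    and v: "\<And>n. v n \<in> H1" and AM: "\<And>n. A (v n) \<le> B"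
    and lim: "(\<lambda>n. sqdist (v n) w) \<longlonglongrightarrow> 0"
  shows "w \<in> H1" "A w \<le> B"
proof -
  define \<K> where "\<K> j = {u \<in> H1. sqdist u w \<le> 1 / real (Suc j)}" for j
  \<comment> \<open>The infima increase as the balls shrink, and the given sequence bounds them by \<open>B\<close>.\<close>
  define a where "a j = (INF u\<in>\<K> j. A u)" for j
  have bdd: "bdd_below (A ` T)" for T using A_nonneg by (intro bdd_belowI2[of _ 0]) auto
  have dw: "integrable lborel (\<lambda>x. (u x - w x)\<^sup>2)" if "u \<in> H1" for u
    using H1_D[OF that] w2 by (intro square_add_integrable) auto
  have ex: "\<exists>n. v n \<in> \<K> j" for j
  proof -
    have "eventually (\<lambda>n. sqdist (v n) w < 1 / real (Suc j)) sequentially"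
      using lim by (rule order_tendstoD) simp
    then obtain n where "sqdist (v n) w < 1 / real (Suc j)"
      unfolding eventually_sequentially by blast
    then show ?thesis using v by (intro exI[of _ n]) (simp add: \<K>_def)
  qed
  have aB: "a j \<le> B" for j
    using ex[of j] AM cINF_lower2[OF bdd, of _ "\<K> j" B] by (auto simp: a_def)
  have Kmono: "\<K> i \<subseteq> \<K> j" if "j \<le> i" for i j
  proof -
    have "1 / real (Suc i) \<le> 1 / real (Suc j)" using that by (intro divide_left_mono) auto
    then show ?thesis by (force simp: \<K>_def)
  qed
  have mono: "incseq a"
  proof -
    have "\<K> j \<noteq> {}" for j using ex[of j] by auto
    then show ?thesis
      unfolding incseq_def a_def by (intro allI impI cINF_superset_mono bdd Kmono) auto
  qed
  then have "convergent a" using aB by (metis incseq_convergent convergentI)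
  then have Ca: "Cauchy a" by (rule convergent_Cauchy)
  have "\<exists>u\<in>\<K> j. A u < a j + 1 / real (Suc j)" for j
  proof -
    have "\<K> j \<noteq> {}" using ex[of j] by auto
    then show ?thesis using cINF_less_iff[OF _ bdd, of "\<K> j" "a j + 1 / real (Suc j)"] by (simp add: a_def)
  qed
  then have "\<forall>j. \<exists>u. u \<in> \<K> j \<and> A u < a j + 1 / real (Suc j)" by blast
  from choice[OF this] obtain h where h: "\<And>j. h j \<in> \<K> j" "\<And>j. A (h j) < a j + 1 / real (Suc j)" by blast
  have hH: "h j \<in> H1" for j using h(1) by (auto simp: \<K>_def)
  note [measurable] = H1_D(1,5)[OF hH]
  have key: "A (\<lambda>x. h i x - h j x) \<le> 2 * \<bar>a i - a j\<bar> + 4 / real (Suc j)" if "j \<le> i" for i j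
  proof -
    have i1: "integrable lborel (\<lambda>x. (h i x - w x)\<^sup>2)" "integrable lborel (\<lambda>x. (h j x - w x)\<^sup>2)" using dw hH by auto
    \<comment> \<open>The ball is convex, so the midpoint of two near-minimizers competes for the same infimum.\<close>
    let ?mid = "\<lambda>x. (1/2) * (h i x + h j x)"
    have mH: "?mid \<in> H1" "A ?mid = (1/2)\<^sup>2 * A (\<lambda>x. h i x + h j x)" by (rule H1_scale[OF H1_add(1)[OF hH hH]])+
    have "(LBINT x. (?mid x - w x)\<^sup>2) \<le> (LBINT x. 1/2 * (h i x - w x)\<^sup>2 + 1/2 * (h j x - w x)\<^sup>2)"
    proof (rule integral_mono)
      have "((1/2) * (p + q) - r)\<^sup>2 \<le> 1/2 * (p - r)\<^sup>2 + 1/2 * (q - r)\<^sup>2" for p q r :: real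
        using zero_le_power2[of "p - q"] by (simp add: power2_eq_square field_simps)
      then show "(?mid x - w x)\<^sup>2 \<le> 1/2 * (h i x - w x)\<^sup>2 + 1/2 * (h j x - w x)\<^sup>2" for x .
    qed (use dw[OF mH(1)] i1 in auto)
    also have "\<dots> = 1/2 * sqdist (h i) w + 1/2 * sqdist (h j) w"
      using i1 by simp
    also have "\<dots> \<le> 1 / real (Suc j)" using h(1)[of j] h(1)[of i] Kmono[OF that] by (auto simp: \<K>_def subset_iff)
    finally have "?mid \<in> \<K> j" using mH by (simp add: \<K>_def)
    then have "a j \<le> A ?mid" unfolding a_def by (intro cINF_lower bdd)
    then have "4 * a j \<le> A (\<lambda>x. h i x + h j x)" using mH(2) by (simp add: power2_eq_square)
    moreover have "a j \<le> a i" using mono that by (simp add: incseq_def)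
    moreover have "1 / real (Suc i) \<le> 1 / real (Suc j)" using that by (intro divide_left_mono) auto
    ultimately show ?thesis using A_parallelogram[OF hH hH, of i j] h(2)[of i] h(2)[of j] by simp
  qed
  have AC: "\<exists>N. \<forall>m\<ge>N. \<forall>n\<ge>N. A (\<lambda>x. h m x - h n x) < e" if e: "0 < e" for e
  proof -
    obtain N1 where N1: "\<And>m n. m \<ge> N1 \<Longrightarrow> n \<ge> N1 \<Longrightarrow> \<bar>a m - a n\<bar> < e / 4"
    proof -
      have "0 < e / 4" using e by simp
      then show ?thesis using Ca that unfolding Cauchy_def dist_real_def by blast
    qed
    obtain N2 :: nat where N2: "8 / e < real N2" using reals_Archimedean2 by blast
    have main: "A (\<lambda>x. h m x - h n x) < e" if "m \<ge> max N1 N2" "n \<ge> max N1 N2" "n \<le> m" for m n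
    proof -
      have "8 / e < real (Suc n)" using N2 that by linarith
      then have "4 / real (Suc n) < e / 2" using e by (simp add: field_simps)
      moreover have "2 * \<bar>a m - a n\<bar> < e / 2" using N1[of m n] that by simp
      ultimately show ?thesis using key[OF that(3)] by linarith
    qed
    have sym: "A (\<lambda>x. h m x - h n x) = A (\<lambda>x. h n x - h m x)" for m n
      unfolding A_diff[OF hH hH] by (simp add: power2_commute)
    have "A (\<lambda>x. h m x - h n x) < e" if "m \<ge> max N1 N2" "n \<ge> max N1 N2" for m n
      using main[of m n] main[of n m] sym[of m n] that by (cases "n \<le> m") auto
    then show ?thesis by blast
  qed
  have gi: "integrable lborel (\<lambda>x. (weak_grad (h n) x $ i)\<^sup>2)" for n i
    using H1_D[OF hH] by (intro integrable_component_square) auto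
  have "\<exists>G. G \<in> borel_measurable lborel \<and> integrable lborel (\<lambda>x. (G x)\<^sup>2) \<and>
     (\<lambda>n. LBINT x. (weak_grad (h n) x $ i - G x)\<^sup>2) \<longlonglongrightarrow> 0" for i
  proof -
    have le: "(LBINT x. (weak_grad (h m) x $ i - weak_grad (h n) x $ i)\<^sup>2) \<le> A (\<lambda>x. h m x - h n x)" for m n
      unfolding A_diff[OF hH hH] using exhaust_2[of i] by (auto simp: add_increasing add_increasing2)
    have "\<exists>N. \<forall>m\<ge>N. \<forall>n\<ge>N. (LBINT x. (weak_grad (h m) x $ i - weak_grad (h n) x $ i)\<^sup>2) < e" if e: "0 < e" for e
    proof -
      obtain N where N: "\<And>m n. m \<ge> N \<Longrightarrow> n \<ge> N \<Longrightarrow> A (\<lambda>x. h m x - h n x) < e" using AC[OF e] by blast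
      show ?thesis by (intro exI[of _ N] allI impI le_less_trans[OF le N])
    qed
    then obtain G r where "G \<in> borel_measurable lborel" "integrable lborel (\<lambda>x. (G x)\<^sup>2)" "strict_mono (r :: nat \<Rightarrow> nat)"
      "AE x in lborel. (\<lambda>k. weak_grad (h (r k)) x $ i) \<longlonglongrightarrow> G x"
      "(\<lambda>n. LBINT x. (weak_grad (h n) x $ i - G x)\<^sup>2) \<longlonglongrightarrow> 0"
      by (rule L2_complete[of "\<lambda>n x. weak_grad (h n) x $ i" lborel, rotated 2]) (use gi in auto)
    then show ?thesis by blast
  qed
  then have "\<forall>i. \<exists>G. G \<in> borel_measurable lborel \<and> integrable lborel (\<lambda>x. (G x)\<^sup>2) \<and>
     (\<lambda>n. LBINT x. (weak_grad (h n) x $ i - G x)\<^sup>2) \<longlonglongrightarrow> 0" by blast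
  from choice[OF this] obtain G where G: "\<And>i. G i \<in> borel_measurable lborel" "\<And>i. integrable lborel (\<lambda>x. (G i x)\<^sup>2)"
    "\<And>i. (\<lambda>n. LBINT x. (weak_grad (h n) x $ i - G i x)\<^sup>2) \<longlonglongrightarrow> 0" by blast
  define g where "g x = (\<chi> i. G i x)" for x
  have G': "G i \<in> borel_measurable borel" for i using G(1)[of i] by simp
  have g[measurable]: "g \<in> borel_measurable borel"
    unfolding g_def using G' by (subst borel_measurable_euclidean_space) (auto simp: Basis_vec_def inner_axis)
  have g2: "integrable lborel (\<lambda>x. (norm (g x))\<^sup>2)" using G(2) by (simp add: norm_plane_square g_def)
  have hlim: "(\<lambda>n. sqdist (h n) w) \<longlonglongrightarrow> 0"
  proof (rule tendsto_sandwich[of "\<lambda>_. 0"])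
    show "(\<lambda>n. 1 / real (Suc n)) \<longlonglongrightarrow> 0" using LIMSEQ_inverse_real_of_nat by (simp add: inverse_eq_divide)
    show "eventually (\<lambda>n. sqdist (h n) w \<le> 1 / real (Suc n)) sequentially"
      using h(1) by (intro always_eventually) (simp add: \<K>_def)
  qed auto
  have wg: "is_weak_gradient w g"
    by (rule is_weak_gradient_L2_limit[OF w g w2 g2 hH hlim]) (use G(3) in \<open>simp add: g_def\<close>)
  show "w \<in> H1" by (rule H1_I(1)[OF w w2 wg g2])
  have "A w = mass (G 1) + mass (G 2)"
    using H1_I(2)[OF w w2 wg g2] G(2) by (simp add: norm_plane_square g_def)
  moreover have "(\<lambda>n. (LBINT x. (weak_grad (h n) x $ 1)\<^sup>2) + (LBINT x. (weak_grad (h n) x $ 2)\<^sup>2)) \<longlonglongrightarrow>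
     mass (G 1) + mass (G 2)"
    by (intro tendsto_intros L2_limit_integral_square gi G) measurable
  moreover have "(LBINT x. (weak_grad (h n) x $ 1)\<^sup>2) + (LBINT x. (weak_grad (h n) x $ 2)\<^sup>2) = A (h n)" for n
    using gi by (simp add: A_def norm_plane_square)
  ultimately have "(\<lambda>n. A (h n)) \<longlonglongrightarrow> A w" by simp
  moreover have "(\<lambda>n. B + 1 / real (Suc n)) \<longlonglongrightarrow> B + 0"
    using LIMSEQ_inverse_real_of_nat by (intro tendsto_intros) (simp add: inverse_eq_divide)
  moreover have "A (h n) \<le> B + 1 / real (Suc n)" for n using h(2)[of n] aB[of n] by linarith
  ultimately have "A w \<le> B + 0" by (intro LIMSEQ_le[of "\<lambda>n. A (h n)" _ "\<lambda>n. B + 1 / real (Suc n)"]) blast+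
  then show "A w \<le> B" by simp
qed

lemma A_lower:
  assumes w: "w \<in> borel_measurable borel" "integrable lborel (\<lambda>x. (w x)\<^sup>2)"
    and v: "\<And>n. v n \<in> H1"
    and lim: "(\<lambda>n. sqdist (v n) w) \<longlonglongrightarrow> 0" and e: "0 < e"
  shows "eventually (\<lambda>n. A w - e < A (v n)) sequentially"
proof (rule ccontr)
  assume "\<not> ?thesis"
  then obtain r where r: "strict_mono (r :: nat \<Rightarrow> nat)" "\<And>n. \<not> A w - e < A (v (r n))"
    using not_eventually_subsequence by metis
  have "A w \<le> A w - e"
    by (rule H1_closed_lsc(2)[OF w, of "\<lambda>n. v (r n)"])
      (use v r(2) LIMSEQ_subseq_LIMSEQ[OF lim r(1)] in \<open>auto simp: comp_def not_less\<close>)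
  with e show False by simp
qed

section \<open>Compactness\<close>

lemma weak_gradient_L2_shift_signed:
  assumes wg: "is_weak_gradient u g"
  shows "(\<integral>\<^sup>+x. ennreal ((u (x + t *\<^sub>R axis i 1) - u x)\<^sup>2) \<partial>lborel) \<le> ennreal (t\<^sup>2) * (\<integral>\<^sup>+x. ennreal ((norm (g x))\<^sup>2) \<partial>lborel)"
proof (cases "0 \<le> t")
  case True
  then show ?thesis by (rule weak_gradient_L2_shift[OF wg])
next
  case False
  note [measurable] = is_weak_gradient_measurable[OF wg]
  have "(\<integral>\<^sup>+x. ennreal ((u (x + t *\<^sub>R axis i 1) - u x)\<^sup>2) \<partial>lborel) =
     (\<integral>\<^sup>+x. ennreal ((u (x + (- t) *\<^sub>R axis i 1) - u x)\<^sup>2) \<partial>lborel)"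
    using nn_integral_shift[of "\<lambda>x. ennreal ((u (x + t *\<^sub>R axis i 1) - u x)\<^sup>2)" "(- t) *\<^sub>R axis i 1"]
    by (simp add: power2_commute)
  also have "\<dots> \<le> ennreal ((- t)\<^sup>2) * (\<integral>\<^sup>+x. ennreal ((norm (g x))\<^sup>2) \<partial>lborel)"
    using False by (intro weak_gradient_L2_shift[OF wg]) simp
  finally show ?thesis by simp
qed

lemma plane_decompose: "(h::plane) = h $ 1 *\<^sub>R axis 1 1 + h $ 2 *\<^sub>R axis 2 1"
  by (simp add: vec_eq_iff forall_2 axis_def)

text \<open>
  A shift is carried out in the two coordinate directions one after the other.
\<close>

lemma H1_shift_estimate:
  assumes u: "u \<in> H1" and h: "\<bar>h $ 1\<bar> \<le> l" "\<bar>h $ 2\<bar> \<le> l"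
  shows "(\<integral>\<^sup>+x. ennreal ((u (x + h) - u x)\<^sup>2) \<partial>lborel) \<le> ennreal (4 * l\<^sup>2 * A u)"
proof -
  note [measurable] = H1_D(1)[OF u]
  note wg = H1_D(3)[OF u]
  let ?h1 = "h $ 1 *\<^sub>R axis 1 1 :: plane" and ?h2 = "h $ 2 *\<^sub>R axis 2 1 :: plane"
  have G: "(\<integral>\<^sup>+x. ennreal ((norm (weak_grad u x))\<^sup>2) \<partial>lborel) = ennreal (A u)"
    unfolding A_def by (rule nn_integral_eq_integral[OF H1_D(4)[OF u]]) simp
  have "(\<integral>\<^sup>+x. ennreal ((u (x + h) - u x)\<^sup>2) \<partial>lborel) \<le>
      (\<integral>\<^sup>+x. 2 * ennreal ((u ((x + ?h1) + ?h2) - u (x + ?h1))\<^sup>2) + 2 * ennreal ((u (x + ?h1) - u x)\<^sup>2) \<partial>lborel)"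
  proof (rule nn_integral_mono)
    fix x
    have "(p - r)\<^sup>2 \<le> 2 * (p - q)\<^sup>2 + 2 * (q - r)\<^sup>2" for p q r :: real
      using zero_le_power2[of "p - 2 * q + r"] by (simp add: power2_eq_square algebra_simps)
    then have "(u (x + h) - u x)\<^sup>2 \<le> 2 * (u (x + h) - u (x + ?h1))\<^sup>2 + 2 * (u (x + ?h1) - u x)\<^sup>2" .
    then have "ennreal ((u (x + h) - u x)\<^sup>2) \<le> ennreal (2 * (u (x + h) - u (x + ?h1))\<^sup>2 + 2 * (u (x + ?h1) - u x)\<^sup>2)"
      by (rule ennreal_leI)
    moreover have "u (x + h) = u ((x + ?h1) + ?h2)" by (metis plane_decompose add.assoc)
    ultimately show "ennreal ((u (x + h) - u x)\<^sup>2) \<le> 2 * ennreal ((u ((x + ?h1) + ?h2) - u (x + ?h1))\<^sup>2) + 2 * ennreal ((u (x + ?h1) - u x)\<^sup>2)"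
      by (simp add: ennreal_mult')
  qed
  also have "\<dots> = 2 * (\<integral>\<^sup>+x. ennreal ((u ((x + ?h1) + ?h2) - u (x + ?h1))\<^sup>2) \<partial>lborel) + 2 * (\<integral>\<^sup>+x. ennreal ((u (x + ?h1) - u x)\<^sup>2) \<partial>lborel)"
    by (simp add: nn_integral_add nn_integral_cmult)
  also have "(\<integral>\<^sup>+x. ennreal ((u ((x + ?h1) + ?h2) - u (x + ?h1))\<^sup>2) \<partial>lborel) = (\<integral>\<^sup>+x. ennreal ((u (x + ?h2) - u x)\<^sup>2) \<partial>lborel)"
    by (rule nn_integral_shift[of "\<lambda>x. ennreal ((u (x + ?h2) - u x)\<^sup>2)" ?h1]) measurable
  also have "2 * (\<integral>\<^sup>+x. ennreal ((u (x + ?h2) - u x)\<^sup>2) \<partial>lborel) + 2 * (\<integral>\<^sup>+x. ennreal ((u (x + ?h1) - u x)\<^sup>2) \<partial>lborel) \<le>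
     2 * (ennreal ((h $ 2)\<^sup>2) * ennreal (A u)) + 2 * (ennreal ((h $ 1)\<^sup>2) * ennreal (A u))"
    using weak_gradient_L2_shift_signed[OF wg] unfolding G by (intro add_mono mult_left_mono) auto
  also have "\<dots> = ennreal ((2 * (h $ 2)\<^sup>2 + 2 * (h $ 1)\<^sup>2) * A u)"
  proof -
    have "(2 * (h $ 2)\<^sup>2 + 2 * (h $ 1)\<^sup>2) * A u = 2 * ((h $ 2)\<^sup>2 * A u) + 2 * ((h $ 1)\<^sup>2 * A u)" by (simp add: algebra_simps)
    then show ?thesis by (simp add: ennreal_mult A_nonneg)
  qed
  also have "\<dots> \<le> ennreal (4 * l\<^sup>2 * A u)"
  proof (intro ennreal_leI mult_right_mono A_nonneg)
    have "(h $ 2)\<^sup>2 \<le> l\<^sup>2" "(h $ 1)\<^sup>2 \<le> l\<^sup>2" using h by (metis abs_ge_zero power2_abs power_mono)+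
    then show "2 * (h $ 2)\<^sup>2 + 2 * (h $ 1)\<^sup>2 \<le> 4 * l\<^sup>2" by simp
  qed
  finally show ?thesis .
qed

definition cell :: "real \<Rightarrow> int \<times> int \<Rightarrow> plane set" where
  "cell l q = {x. \<lfloor>x $ 1 / l\<rfloor> = fst q \<and> \<lfloor>x $ 2 / l\<rfloor> = snd q}"

lemma cell_sets [measurable]: "cell l q \<in> sets borel"
proof -
  have "(\<lambda>x::plane. \<lfloor>x $ i / l\<rfloor>) \<in> measurable borel (count_space UNIV)" for i by measurable
  then show ?thesis unfolding cell_def by measurable
qed

lemma emeasure_cell:
  assumes l: "0 < l"
  shows "emeasure lborel (cell l q) = ennreal (l\<^sup>2)"
proof -
  have "\<lfloor>a / l\<rfloor> = i \<longleftrightarrow> a \<in> {of_int i * l..<(of_int i + 1) * l}" for a i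
    using l by (auto simp: floor_eq_iff field_simps)
  then have "cell l q = {x. x $ 1 \<in> {of_int (fst q) * l..<(of_int (fst q) + 1) * l} \<and>
      x $ 2 \<in> {of_int (snd q) * l..<(of_int (snd q) + 1) * l}}"
    by (simp add: cell_def)
  then have "emeasure lborel (cell l q) = ennreal l * ennreal l"
    using l emeasure_rectangle[of "{of_int (fst q) * l..<(of_int (fst q) + 1) * l}" "{of_int (snd q) * l..<(of_int (snd q) + 1) * l}"]
    by (simp add: algebra_simps)
  then show ?thesis using l by (simp add: ennreal_mult[symmetric] power2_eq_square)
qed

lemma cell_unique: "x \<in> cell l q \<longleftrightarrow> q = (\<lfloor>x $ 1 / l\<rfloor>, \<lfloor>x $ 2 / l\<rfloor>)"
  by (cases q) (auto simp: cell_def)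

lemma cell_close:
  assumes "x \<in> cell l q" "y \<in> cell l q" "0 < l"
  shows "\<bar>(y - x) $ i\<bar> \<le> l"
proof -
  have "\<lfloor>x $ i / l\<rfloor> = \<lfloor>y $ i / l\<rfloor>" using assms exhaust_2[of i] by (auto simp: cell_def)
  then have "\<bar>y $ i / l - x $ i / l\<bar> \<le> 1" by linarith
  then show ?thesis using assms(3) by (simp add: diff_divide_distrib[symmetric] abs_divide)
qed

text \<open>
  The first equation expands the square in the double integral over \<open>Q \<times> Q\<close>.
\<close>

lemma set_variance_identity:
  fixes f :: "plane \<Rightarrow> real"
  assumes [measurable]: "f \<in> borel_measurable borel" "Q \<in> sets borel"
    and \<mu>: "emeasure lborel Q = ennreal \<mu>" "0 \<le> \<mu>" and f2: "integrable lborel (\<lambda>x. (f x)\<^sup>2)"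
  shows "(\<integral>\<^sup>+x. indicator Q x * (\<integral>\<^sup>+y. indicator Q y * ennreal ((f x - f y)\<^sup>2) \<partial>lborel) \<partial>lborel) =
    ennreal (2 * \<mu> * (LBINT x. indicator Q x * (f x)\<^sup>2) - 2 * (LBINT x. indicator Q x * f x)\<^sup>2)"
    and "(LBINT x. indicator Q x * f x)\<^sup>2 \<le> \<mu> * mass f"
    and "integrable lborel (\<lambda>x. indicator Q x * f x)"
proof -
  define I where "I = (LBINT x. indicator Q x * f x)"
  define J where "J = (LBINT x. indicator Q x * (f x)\<^sup>2)"
  have iQ: "integrable lborel (indicator Q :: plane \<Rightarrow> real)" using \<mu> by (intro integrable_real_indicator) auto
  have iQ2: "integrable lborel (\<lambda>x. (indicator Q x :: real)\<^sup>2)"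
    by (rule Bochner_Integration.integrable_cong[THEN iffD1, OF refl _ iQ]) (auto simp: indicator_def)
  have mQ: "(LBINT x. indicator Q x) = \<mu>" using \<mu> by (simp add: measure_def)
  have i1: "integrable lborel (\<lambda>x. indicator Q x * f x)" by (rule Cauchy_Schwarz_integral(1)[OF _ _ iQ2 f2]) auto
  have i2: "integrable lborel (\<lambda>x. indicator Q x * (f x)\<^sup>2)"
    using integrable_mult_indicator[OF _ f2, of Q] by simp
  show "integrable lborel (\<lambda>x. indicator Q x * f x)" by fact
  have "(LBINT x. (indicator Q x :: real)\<^sup>2) = \<mu>"
    unfolding mQ[symmetric] by (intro Bochner_Integration.integral_cong) (auto simp: indicator_def)
  then show "(LBINT x. indicator Q x * f x)\<^sup>2 \<le> \<mu> * mass f"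
    using Cauchy_Schwarz_integral(2)[OF _ _ iQ2 f2] by simp
  have inner: "(\<integral>\<^sup>+y. indicator Q y * ennreal ((f x - f y)\<^sup>2) \<partial>lborel) = ennreal ((f x)\<^sup>2 * \<mu> - 2 * f x * I + J)" for x
  proof -
    have eq: "indicator Q y * (f x - f y)\<^sup>2 = (f x)\<^sup>2 * indicator Q y - 2 * f x * (indicator Q y * f y) + indicator Q y * (f y)\<^sup>2" for y
      by (simp add: power2_eq_square algebra_simps)
    have i: "integrable lborel (\<lambda>y. indicator Q y * (f x - f y)\<^sup>2)"
      unfolding eq using iQ i1 i2 by simp
    have "(\<integral>\<^sup>+y. indicator Q y * ennreal ((f x - f y)\<^sup>2) \<partial>lborel) = (\<integral>\<^sup>+y. ennreal (indicator Q y * (f x - f y)\<^sup>2) \<partial>lborel)"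
      by (intro nn_integral_cong) (auto simp: indicator_def)
    also have "\<dots> = ennreal (LBINT y. indicator Q y * (f x - f y)\<^sup>2)"
      by (rule nn_integral_eq_integral[OF i]) simp
    also have "(LBINT y. indicator Q y * (f x - f y)\<^sup>2) = (f x)\<^sup>2 * \<mu> - 2 * f x * I + J"
      unfolding eq I_def J_def mQ[symmetric] using iQ i1 i2 by simp
    finally show ?thesis .
  qed
  have nn: "0 \<le> (f x)\<^sup>2 * \<mu> - 2 * f x * I + J" for x
  proof -
    have "(LBINT y. indicator Q y * (f x - f y)\<^sup>2) = (LBINT y. (f x)\<^sup>2 * indicator Q y - 2 * f x * (indicator Q y * f y) + indicator Q y * (f y)\<^sup>2)"
      by (intro Bochner_Integration.integral_cong) (auto simp: power2_eq_square algebra_simps)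
    also have "\<dots> = (f x)\<^sup>2 * \<mu> - 2 * f x * I + J"
      unfolding I_def J_def mQ[symmetric] using iQ i1 i2 by simp
    finally have "(LBINT y. indicator Q y * (f x - f y)\<^sup>2) = (f x)\<^sup>2 * \<mu> - 2 * f x * I + J" .
    moreover have "0 \<le> (LBINT y. indicator Q y * (f x - f y)\<^sup>2)" by simp
    ultimately show ?thesis by linarith
  qed
  have eq: "indicator Q x * ((f x)\<^sup>2 * \<mu> - 2 * f x * I + J) = \<mu> * (indicator Q x * (f x)\<^sup>2) - 2 * I * (indicator Q x * f x) + J * indicator Q x" for x
    by (simp add: algebra_simps)
  have i: "integrable lborel (\<lambda>x. indicator Q x * ((f x)\<^sup>2 * \<mu> - 2 * f x * I + J))"
    unfolding eq using iQ i1 i2 by simp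
  have "(\<integral>\<^sup>+x. indicator Q x * (\<integral>\<^sup>+y. indicator Q y * ennreal ((f x - f y)\<^sup>2) \<partial>lborel) \<partial>lborel) =
     (\<integral>\<^sup>+x. ennreal (indicator Q x * ((f x)\<^sup>2 * \<mu> - 2 * f x * I + J)) \<partial>lborel)"
    unfolding inner by (intro nn_integral_cong) (auto simp: indicator_def)
  also have "\<dots> = ennreal (LBINT x. indicator Q x * ((f x)\<^sup>2 * \<mu> - 2 * f x * I + J))"
    by (rule nn_integral_eq_integral[OF i]) (simp add: nn)
  also have "(LBINT x. indicator Q x * ((f x)\<^sup>2 * \<mu> - 2 * f x * I + J)) = \<mu> * J - 2 * I * I + J * \<mu>"
    unfolding eq using iQ i1 i2 mQ by (simp add: I_def[symmetric] J_def[symmetric])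
  also have "\<dots> = 2 * \<mu> * J - 2 * I\<^sup>2" by (simp add: power2_eq_square)
  finally show "(\<integral>\<^sup>+x. indicator Q x * (\<integral>\<^sup>+y. indicator Q y * ennreal ((f x - f y)\<^sup>2) \<partial>lborel) \<partial>lborel) =
    ennreal (2 * \<mu> * (LBINT x. indicator Q x * (f x)\<^sup>2) - 2 * (LBINT x. indicator Q x * f x)\<^sup>2)"
    by (simp add: I_def J_def)
qed

text \<open>
  On each cell the integral of \<open>u\<^sup>2\<close> is the square of the integral of \<open>u\<close> divided by the area, plus half
  the double integral of \<open>(u x - u y)\<^sup>2\<close> divided by the area. Two points of one cell differ by a vector
  \<open>h\<close> in the square \<open>B\<close> of side \<open>2 * l\<close>. Hence the sum of the double integrals is at most the integral
  over \<open>h\<close> in \<open>B\<close>, which has area \<open>4 * l\<^sup>2\<close>, of the squared \<open>L\<^sup>2\<close> distance between \<open>u\<close> and its shift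
  by \<open>h\<close>, and that is at most \<open>4 * l\<^sup>2 * A u\<close>.
\<close>

theorem cells_poincare:
  assumes u: "u \<in> H1" and l: "0 < l" and I: "finite I"
  shows "(\<Sum>q\<in>I. LBINT x. indicator (cell l q) x * (u x)\<^sup>2) \<le>
    (\<Sum>q\<in>I. (LBINT x. indicator (cell l q) x * u x)\<^sup>2) / l\<^sup>2 + 8 * l\<^sup>2 * A u"
proof -
  note [measurable] = H1_D(1)[OF u]
  define J where "J q = (LBINT x. indicator (cell l q) x * (u x)\<^sup>2)" for q
  define E where "E q = (LBINT x. indicator (cell l q) x * u x)" for q
  define B :: "plane set" where "B = {h. h $ 1 \<in> {-l..l} \<and> h $ 2 \<in> {-l..l}}"
  have [measurable]: "B \<in> sets borel" unfolding B_def by measurable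
  have B: "h \<in> B \<longleftrightarrow> \<bar>h $ 1\<bar> \<le> l \<and> \<bar>h $ 2\<bar> \<le> l" for h
    by (auto simp: B_def)
  have mB: "emeasure lborel B = ennreal (4 * l\<^sup>2)"
    unfolding B_def using l by (subst emeasure_rectangle) (auto simp: ennreal_mult[symmetric] power2_eq_square)
  note var = set_variance_identity[OF H1_D(1)[OF u] cell_sets emeasure_cell[OF l] zero_le_power2 H1_D(2)[OF u]]
  have pos: "0 \<le> 2 * l\<^sup>2 * J q - 2 * (E q)\<^sup>2" for q
  proof -
    have "(\<lambda>x. indicator (cell l q) x * u x) \<in> borel_measurable borel" by measurable
    moreover have "integrable lborel (\<lambda>x. (indicator (cell l q) x * u x)\<^sup>2)"
    proof -
      have "integrable lborel (\<lambda>x. indicator (cell l q) x *\<^sub>R (u x)\<^sup>2)"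
        by (rule integrable_mult_indicator[OF _ H1_D(2)[OF u]]) simp
      moreover have "(indicator (cell l q) x * u x)\<^sup>2 = indicator (cell l q) x *\<^sub>R (u x)\<^sup>2" for x
        by (simp add: indicator_def)
      ultimately show ?thesis by simp
    qed
    ultimately have "(LBINT x. indicator (cell l q) x * (indicator (cell l q) x * u x))\<^sup>2 \<le> l\<^sup>2 * (LBINT x. (indicator (cell l q) x * u x)\<^sup>2)"
      by (rule set_variance_identity(2)[OF _ cell_sets emeasure_cell[OF l] zero_le_power2])
    moreover have "(LBINT x. indicator (cell l q) x * (indicator (cell l q) x * u x)) = E q"
      unfolding E_def by (intro Bochner_Integration.integral_cong) (auto simp: indicator_def)
    moreover have "(LBINT x. (indicator (cell l q) x * u x)\<^sup>2) = J q"
      unfolding J_def by (intro Bochner_Integration.integral_cong) (auto simp: indicator_def)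
    ultimately show ?thesis by simp
  qed
  have "ennreal (\<Sum>q\<in>I. 2 * l\<^sup>2 * J q - 2 * (E q)\<^sup>2) =
     (\<Sum>q\<in>I. \<integral>\<^sup>+x. indicator (cell l q) x * (\<integral>\<^sup>+y. indicator (cell l q) y * ennreal ((u x - u y)\<^sup>2) \<partial>lborel) \<partial>lborel)"
    unfolding var(1) J_def[symmetric] E_def[symmetric] using pos by (simp add: sum_ennreal)
  also have "\<dots> = (\<integral>\<^sup>+x. (\<Sum>q\<in>I. indicator (cell l q) x * (\<integral>\<^sup>+y. indicator (cell l q) y * ennreal ((u x - u y)\<^sup>2) \<partial>lborel)) \<partial>lborel)"
    by (rule nn_integral_sum[symmetric]) measurable
  also have "\<dots> \<le> (\<integral>\<^sup>+x. (\<integral>\<^sup>+h. indicator B h * ennreal ((u (x + h) - u x)\<^sup>2) \<partial>lborel) \<partial>lborel)"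
  proof (rule nn_integral_mono)
    fix x :: plane
    define q0 where "q0 = (\<lfloor>x $ 1 / l\<rfloor>, \<lfloor>x $ 2 / l\<rfloor>)"
    have q0: "x \<in> cell l q \<longleftrightarrow> q = q0" for q by (simp add: cell_unique q0_def)
    have "(\<Sum>q\<in>I. indicator (cell l q) x * (\<integral>\<^sup>+y. indicator (cell l q) y * ennreal ((u x - u y)\<^sup>2) \<partial>lborel)) \<le>
       (\<integral>\<^sup>+y. indicator (cell l q0) y * ennreal ((u x - u y)\<^sup>2) \<partial>lborel)"
    proof -
      have "(\<Sum>q\<in>I. indicator (cell l q) x * (\<integral>\<^sup>+y. indicator (cell l q) y * ennreal ((u x - u y)\<^sup>2) \<partial>lborel)) =
        (\<Sum>q\<in>I. if q = q0 then (\<integral>\<^sup>+y. indicator (cell l q0) y * ennreal ((u x - u y)\<^sup>2) \<partial>lborel) else 0)"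
        by (intro sum.cong) (auto simp: indicator_def q0)
      then show ?thesis using I by (simp add: sum.delta)
    qed
    also have "\<dots> = (\<integral>\<^sup>+h. indicator (cell l q0) (h + x) * ennreal ((u x - u (h + x))\<^sup>2) \<partial>lborel)"
      by (rule nn_integral_shift[symmetric]) measurable
    also have "\<dots> \<le> (\<integral>\<^sup>+h. indicator B h * ennreal ((u (x + h) - u x)\<^sup>2) \<partial>lborel)"
    proof (rule nn_integral_mono)
      fix h
      have "h \<in> B" if "h + x \<in> cell l q0"
        using cell_close[of x l q0 "h + x"] that q0 l unfolding B by auto
      then show "indicator (cell l q0) (h + x) * ennreal ((u x - u (h + x))\<^sup>2) \<le> indicator B h * ennreal ((u (x + h) - u x)\<^sup>2)"
        by (auto simp: indicator_def power2_commute add.commute)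
    qed
    finally show "(\<Sum>q\<in>I. indicator (cell l q) x * (\<integral>\<^sup>+y. indicator (cell l q) y * ennreal ((u x - u y)\<^sup>2) \<partial>lborel)) \<le>
       (\<integral>\<^sup>+h. indicator B h * ennreal ((u (x + h) - u x)\<^sup>2) \<partial>lborel)" .
  qed
  also have "\<dots> = (\<integral>\<^sup>+h. (\<integral>\<^sup>+x. indicator B h * ennreal ((u (x + h) - u x)\<^sup>2) \<partial>lborel) \<partial>lborel)"
    by (rule lborel_pair.Fubini') measurable
  also have "\<dots> \<le> (\<integral>\<^sup>+h. indicator B h * ennreal (4 * l\<^sup>2 * A u) \<partial>lborel)"
  proof (rule nn_integral_mono)
    fix h
    show "(\<integral>\<^sup>+x. indicator B h * ennreal ((u (x + h) - u x)\<^sup>2) \<partial>lborel) \<le> indicator B h * ennreal (4 * l\<^sup>2 * A u)"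
      using H1_shift_estimate[OF u, of h l] B[of h] by (auto simp: indicator_def)
  qed
  also have "\<dots> = ennreal (4 * l\<^sup>2) * ennreal (4 * l\<^sup>2 * A u)"
    by (simp add: nn_integral_multc mB)
  also have "\<dots> = ennreal (4 * l\<^sup>2 * (4 * l\<^sup>2 * A u))"
    by (rule ennreal_mult[symmetric]) (auto intro!: mult_nonneg_nonneg A_nonneg)
  finally have "(\<Sum>q\<in>I. 2 * l\<^sup>2 * J q - 2 * (E q)\<^sup>2) \<le> 4 * l\<^sup>2 * (4 * l\<^sup>2 * A u)"
    by (subst (asm) ennreal_le_iff) (auto intro!: mult_nonneg_nonneg A_nonneg)
  then have "l\<^sup>2 * (\<Sum>q\<in>I. J q) \<le> (\<Sum>q\<in>I. (E q)\<^sup>2) + l\<^sup>2 * (8 * l\<^sup>2 * A u)"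
    by (simp add: sum_subtractf sum_distrib_left[symmetric] mult.assoc power2_eq_square power4_eq_xxxx)
  then have "(\<Sum>q\<in>I. J q) \<le> ((\<Sum>q\<in>I. (E q)\<^sup>2) + l\<^sup>2 * (8 * l\<^sup>2 * A u)) / l\<^sup>2"
    using l by (simp add: pos_le_divide_eq mult.commute)
  also have "\<dots> = (\<Sum>q\<in>I. (E q)\<^sup>2) / l\<^sup>2 + 8 * l\<^sup>2 * A u" using l by (simp add: add_divide_distrib)
  finally show ?thesis by (simp add: J_def E_def)
qed

text \<open>
  A countable power of a compact interval is compact by Tychonoff's theorem and metrizable, so it is
  sequentially compact.
\<close>

lemma bounded_functionals_subsequence:
  fixes c :: "nat \<Rightarrow> 'i::countable \<Rightarrow> real"
  assumes "\<And>n i. \<bar>c n i\<bar> \<le> B"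
  obtains r L where "strict_mono (r :: nat \<Rightarrow> nat)" "\<And>i. (\<lambda>n. c (r n) i) \<longlonglongrightarrow> L i"
proof -
  have "compactin (product_topology (\<lambda>i::'i. euclideanreal) UNIV) (PiE UNIV (\<lambda>_. {-B..B}))"
    by (subst compactin_PiE) auto
  then have "compact (PiE UNIV (\<lambda>_::'i. {-B..B}))"
    by (simp add: euclidean_product_topology)
  then have "seq_compact (PiE UNIV (\<lambda>_::'i. {-B..B}))" by (rule compact_imp_seq_compact)
  moreover have "\<forall>n. c n \<in> PiE UNIV (\<lambda>_::'i. {-B..B})" using assms by (auto simp: abs_le_iff PiE_def) (metis minus_le_iff)
  ultimately obtain L r where L: "strict_mono (r :: nat \<Rightarrow> nat)" "(c \<circ> r) \<longlonglongrightarrow> L" unfolding seq_compact_def by metis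
  have "(\<lambda>n. c (r n) i) \<longlonglongrightarrow> L i" for i
  proof -
    have "continuous_on UNIV (\<lambda>f::'i \<Rightarrow> real. f i)" by (rule continuous_on_product_coordinates)
    then have "isCont (\<lambda>f::'i \<Rightarrow> real. f i) L" using continuous_on_eq_continuous_at[OF open_UNIV] by blast
    from isCont_tendsto_compose[OF this L(2)] show ?thesis by (simp add: comp_def)
  qed
  with L(1) show ?thesis by (rule that)
qed

lemma X_D:
  assumes "u \<in> X"
  shows "u \<in> H1" "u \<in> borel_measurable borel" "integrable lborel (\<lambda>x. (u x)\<^sup>2)"
    "integrable lborel (\<lambda>x. ln (1 + norm x) * (u x)\<^sup>2)"
  using assms H1_D(1,2)[of u] by (auto simp: X_def)

lemma log_weight_diff_le:
  "ln (1 + norm x) * (a - b)\<^sup>2 \<le> 2 * (ln (1 + norm x) * a\<^sup>2) + 2 * (ln (1 + norm x) * b\<^sup>2)" for x :: plane and a b :: real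
  using mult_left_mono[OF square_diff_le, of "ln (1 + norm x)" a b] by (simp add: algebra_simps)

lemma X_diff:
  assumes "u \<in> X" "v \<in> X"
  shows "(\<lambda>x. u x - v x) \<in> X"
    and "(LBINT x. ln (1 + norm x) * (u x - v x)\<^sup>2) \<le> 2 * log_moment u + 2 * log_moment v"
proof -
  note [measurable] = X_D(2)[OF assms(1)] X_D(2)[OF assms(2)]
  have i: "integrable lborel (\<lambda>x. 2 * (ln (1 + norm x) * (u x)\<^sup>2) + 2 * (ln (1 + norm x) * (v x)\<^sup>2))"
    using X_D(4)[OF assms(1)] X_D(4)[OF assms(2)] by simp
  then have d: "integrable lborel (\<lambda>x. ln (1 + norm x) * (u x - v x)\<^sup>2)"
    by (rule integrable_dominated) (use log_weight_diff_le in \<open>auto simp: abs_mult\<close>)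
  then show "(\<lambda>x. u x - v x) \<in> X" using H1_diff(1)[OF X_D(1)[OF assms(1)] X_D(1)[OF assms(2)]] by (simp add: X_def)
  have "(LBINT x. ln (1 + norm x) * (u x - v x)\<^sup>2) \<le> (LBINT x. 2 * (ln (1 + norm x) * (u x)\<^sup>2) + 2 * (ln (1 + norm x) * (v x)\<^sup>2))"
    by (rule integral_mono[OF d i log_weight_diff_le])
  also have "\<dots> = 2 * log_moment u + 2 * log_moment v"
    using X_D(4)[OF assms(1)] X_D(4)[OF assms(2)] by simp
  finally show "(LBINT x. ln (1 + norm x) * (u x - v x)\<^sup>2) \<le> 2 * log_moment u + 2 * log_moment v" .
qed

text \<open>
  Rellich's theorem with tightness. The logarithmic moment makes the mass outside a large ball small.
  Inside, the Poincare inequality on a fine grid reduces the mass of a difference to finitely many cell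
  integrals. Those of all grids with mesh \<open>1 / (k + 1)\<close> form a countable family of bounded sequences,
  which converge along a common subsequence.
\<close>

theorem bounded_in_X_L2_Cauchy_subsequence:
  assumes v: "\<And>n. v n \<in> X" and AB: "\<And>n. A (v n) \<le> B" and v2: "\<And>n. mass (v n) \<le> B"
    and vl: "\<And>n. log_moment (v n) \<le> B"
  obtains r where "strict_mono (r :: nat \<Rightarrow> nat)"
    "\<And>e. 0 < e \<Longrightarrow> \<exists>N. \<forall>m\<ge>N. \<forall>n\<ge>N. sqdist (v (r m)) (v (r n)) < e"
proof -
  have vH: "v n \<in> H1" for n using v[of n] by (auto simp: X_def)
  note [measurable] = H1_D(1)[OF vH]
  have B0: "0 \<le> B" using AB[of 0] A_nonneg[of "v 0"] by linarith
  define l where "l k = 1 / real (Suc k)" for k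
  have l: "0 < l k" "l k \<le> 1" for k by (auto simp: l_def)
  define c where "c n i = (case i of (k, q) \<Rightarrow> \<integral>x. indicator (cell (l k) q) x * v n x \<partial>lborel)" for n and i :: "nat \<times> int \<times> int"
  have cb: "\<bar>c n i\<bar> \<le> 1 + B" for n i
  proof -
    obtain k q where i: "i = (k, q)" by (cases i)
    have "(c n i)\<^sup>2 \<le> (l k)\<^sup>2 * mass (v n)"
      unfolding c_def i using set_variance_identity(2)[OF H1_D(1)[OF vH] cell_sets emeasure_cell[OF l(1)] zero_le_power2 H1_D(2)[OF vH]] by simp
    also have "\<dots> \<le> 1 * B" using l[of k] v2[of n] B0 by (intro mult_mono) (auto simp: power_le_one)
    also have "\<dots> \<le> (1 + B)\<^sup>2" using B0 by (simp add: power2_eq_square algebra_simps)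
    finally show ?thesis using B0 by (metis abs_le_square_iff abs_of_nonneg add_nonneg_nonneg zero_le_one)
  qed
  obtain r L where r: "strict_mono (r :: nat \<Rightarrow> nat)" and L: "\<And>i. (\<lambda>n. c (r n) i) \<longlonglongrightarrow> L i"
    using bounded_functionals_subsequence[of c, OF cb] by blast
  show ?thesis
  proof (rule that[OF r])
    fix e :: real assume e: "0 < e"
    \<comment> \<open>Outside the ball of radius \<open>R\<close> the weight \<open>ln (1 + norm x)\<close> is at least \<open>T\<close>, which makes the mass of a difference there at most \<open>4 * B / T < e / 3\<close>.\<close>
    define T where "T = 12 * B / e + 1"
    define R where "R = exp T - 1"
    have T0: "0 < T" using B0 e by (simp add: T_def add_nonneg_pos)
    then have R0: "0 < R" by (simp add: R_def)
    have T: "4 * B / T < e / 3"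
    proof -
      have "12 * B < e * T" using e by (simp add: T_def field_simps)
      then show ?thesis using T0 by (simp add: field_simps)
    qed
    \<comment> \<open>The mesh is so fine that the gradient term of the Poincare inequality is below \<open>e / 3\<close>.\<close>
    obtain k :: nat where "96 * B / e < real k" using reals_Archimedean2 by blast
    then have k: "32 * B * l k < e / 3"
      using e B0 by (simp add: l_def field_simps)
    define M where "M = \<lceil>R / l k\<rceil> + 1"
    define I where "I = {-M..M} \<times> {-M..M}"
    have cover: "\<exists>q\<in>I. x \<in> cell (l k) q" if "norm x \<le> R" for x :: plane
    proof -
      have "\<bar>x $ i / l k\<bar> \<le> R / l k" for i
        using component_le_norm_cart[of x i] that l[of k] by (simp add: divide_right_mono)
      then have "\<bar>x $ i / l k\<bar> \<le> of_int (M - 1)" for i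
        unfolding M_def by (simp add: order.trans[OF _ le_of_int_ceiling])
      then have fl: "\<lfloor>x $ i / l k\<rfloor> \<in> {-M..M}" for i
      proof -
        assume "\<And>i. \<bar>x $ i / l k\<bar> \<le> of_int (M - 1)"
        from this[of i] have "- real_of_int M \<le> x $ i / l k" "x $ i / l k < real_of_int M"
          unfolding of_int_diff of_int_1 by linarith+
        then have "-M \<le> \<lfloor>x $ i / l k\<rfloor>" "\<lfloor>x $ i / l k\<rfloor> < M" by (simp_all add: le_floor_iff floor_less_iff)
        then show ?thesis by simp
      qed
      then show ?thesis by (intro bexI[of _ "(\<lfloor>x $ 1 / l k\<rfloor>, \<lfloor>x $ 2 / l k\<rfloor>)"]) (auto simp: I_def cell_unique)
    qed
    \<comment> \<open>What remains is a finite sum over cells, where the cell integrals converge.\<close>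
    define s where "s n = (\<Sum>q\<in>I. (c (r n) (k, q) - L (k, q))\<^sup>2)" for n
    have "s \<longlonglongrightarrow> (\<Sum>q\<in>I. (L (k, q) - L (k, q))\<^sup>2)"
      unfolding s_def by (intro tendsto_intros L)
    then have "s \<longlonglongrightarrow> 0" by simp
    then have "eventually (\<lambda>n. s n < e * (l k)\<^sup>2 / 12) sequentially"
      using e l(1)[of k] by (intro order_tendstoD) auto
    then obtain N where N: "\<And>n. n \<ge> N \<Longrightarrow> s n < e * (l k)\<^sup>2 / 12" unfolding eventually_sequentially by blast
    have "sqdist (v (r m)) (v (r n)) < e" if mn: "m \<ge> N" "n \<ge> N" for m n
    proof -
      define f where "f x = v (r m) x - v (r n) x" for x
      have fH: "f \<in> H1" unfolding f_def by (rule H1_diff(1)[OF vH vH])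
      note [measurable] = H1_D(1)[OF fH]
      have Af: "A f \<le> 4 * B"
        using A_parallelogram[OF vH vH, of "r m" "r n"] AB[of "r m"] AB[of "r n"] A_nonneg[of "\<lambda>x. v (r m) x + v (r n) x"]
        unfolding f_def[abs_def] by linarith
      have fX: "f \<in> X" unfolding f_def by (rule X_diff[OF v v])
      note fwi = X_D(4)[OF fX]
      have fw: "log_moment f \<le> 4 * B"
        using X_diff(2)[OF v v, of "r m" "r n"] vl[of "r m"] vl[of "r n"] by (simp add: f_def)
      have ic: "integrable lborel (\<lambda>x. indicator (cell (l k) q) x * (f x)\<^sup>2)" for q
        using integrable_mult_indicator[OF _ H1_D(2)[OF fH], of "cell (l k) q"] by simp
      have pt: "(f x)\<^sup>2 \<le> (\<Sum>q\<in>I. indicator (cell (l k) q) x * (f x)\<^sup>2) + ln (1 + norm x) * (f x)\<^sup>2 / T" for x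
      proof (cases "norm x \<le> R")
        case True
        then obtain q where q: "q \<in> I" "x \<in> cell (l k) q" using cover by blast
        have "(f x)\<^sup>2 = indicator (cell (l k) q) x * (f x)\<^sup>2" using q by simp
        also have "\<dots> \<le> (\<Sum>q\<in>I. indicator (cell (l k) q) x * (f x)\<^sup>2)"
          using q(1) by (intro member_le_sum) (auto simp: I_def)
        finally show ?thesis using T0 by (simp add: add_increasing2)
      next
        case False
        then have "T \<le> ln (1 + norm x)" using T0 by (subst ln_ge_iff) (auto simp: R_def intro: add_pos_nonneg)
        then have "1 * (f x)\<^sup>2 \<le> (ln (1 + norm x) / T) * (f x)\<^sup>2" using T0 by (intro mult_right_mono) auto
        then show ?thesis by (simp add: add_increasing sum_nonneg)
      qed
      have "mass f \<le> (LBINT x. (\<Sum>q\<in>I. indicator (cell (l k) q) x * (f x)\<^sup>2) + ln (1 + norm x) * (f x)\<^sup>2 / T)"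
        by (intro integral_mono H1_D(2)[OF fH] pt Bochner_Integration.integrable_add Bochner_Integration.integrable_sum ic integrable_divide fwi)
      also have "\<dots> = (\<Sum>q\<in>I. LBINT x. indicator (cell (l k) q) x * (f x)\<^sup>2) + log_moment f / T"
        using ic fwi by (simp add: Bochner_Integration.integrable_sum)
      also have "\<dots> \<le> ((\<Sum>q\<in>I. (LBINT x. indicator (cell (l k) q) x * f x)\<^sup>2) / (l k)\<^sup>2 + 8 * (l k)\<^sup>2 * A f) + 4 * B / T"
        using T0 fw by (intro add_mono cells_poincare fH l divide_right_mono) (auto simp: I_def)
      also have "\<dots> < (e / 3 + e / 3) + e / 3"
      proof (intro add_strict_mono T)
        have d: "(LBINT x. indicator (cell (l k) q) x * f x) = c (r m) (k, q) - c (r n) (k, q)" for q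
          unfolding c_def f_def
          using set_variance_identity(3)[OF H1_D(1)[OF vH] cell_sets emeasure_cell[OF l(1)] zero_le_power2 H1_D(2)[OF vH]]
          by (simp add: right_diff_distrib)
        have "(p - q)\<^sup>2 \<le> 2 * (p - z)\<^sup>2 + 2 * (q - z)\<^sup>2" for p q z :: real
          using zero_le_power2[of "p + q - 2 * z"] by (simp add: power2_eq_square algebra_simps)
        then have "(\<Sum>q\<in>I. (c (r m) (k, q) - c (r n) (k, q))\<^sup>2) \<le> (\<Sum>q\<in>I. 2 * (c (r m) (k, q) - L (k, q))\<^sup>2 + 2 * (c (r n) (k, q) - L (k, q))\<^sup>2)"
          by (intro sum_mono)
        also have "\<dots> = 2 * s m + 2 * s n" by (simp add: s_def sum.distrib sum_distrib_left)
        also have "\<dots> < e / 3 * (l k)\<^sup>2" using N[OF mn(1)] N[OF mn(2)] by simp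
        finally show "(\<Sum>q\<in>I. (LBINT x. indicator (cell (l k) q) x * f x)\<^sup>2) / (l k)\<^sup>2 < e / 3"
          using l(1)[of k] by (simp add: d pos_divide_less_eq)
        have "8 * (l k)\<^sup>2 * A f \<le> 8 * l k * (4 * B)"
        proof (rule mult_mono[OF _ Af])
          have "l k * l k \<le> l k * 1" using l[of k] by (intro mult_left_mono) auto
          then show "8 * (l k)\<^sup>2 \<le> 8 * l k" by (simp add: power2_eq_square)
        qed (use l[of k] A_nonneg in auto)
        then show "8 * (l k)\<^sup>2 * A f < e / 3" using k by (simp add: mult_ac)
      qed
      finally show ?thesis by (simp add: f_def)
    qed
    then show "\<exists>N. \<forall>m\<ge>N. \<forall>n\<ge>N. sqdist (v (r m)) (v (r n)) < e" by blast
  qed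
qed

section \<open>The logarithmic energy\<close>

definition ln_pos :: "plane \<Rightarrow> real" where "ln_pos z = max 0 (ln (norm z))"
definition ln_neg :: "plane \<Rightarrow> real" where "ln_neg z = max 0 (- ln (norm z))"

lemma ln_pos_neg_measurable [measurable]: "ln_pos \<in> borel_measurable borel" "ln_neg \<in> borel_measurable borel"
  unfolding ln_pos_def[abs_def] ln_neg_def[abs_def] by measurable

lemma ln_pos_nonneg [simp]: "0 \<le> ln_pos z" and ln_neg_nonneg [simp]: "0 \<le> ln_neg z"
  by (auto simp: ln_pos_def ln_neg_def)

lemma ln_eq_ln_pos_minus_ln_neg: "ln (norm z) = ln_pos z - ln_neg z"
  by (auto simp: ln_pos_def ln_neg_def max_def)

lemma ln_one_plus_norm_nonneg [simp]: "0 \<le> ln (1 + norm z)"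
  by simp

lemma ln_one_plus_norm_add: "ln (1 + norm (x + y)) \<le> ln (1 + norm x) + ln (1 + norm y)"
proof -
  have "1 + norm (x + y) \<le> (1 + norm x) * (1 + norm y)"
  proof -
    have "(1 + norm x) * (1 + norm y) = 1 + norm x + norm y + norm x * norm y" by (simp add: algebra_simps)
    moreover have "0 \<le> norm x * norm y" by simp
    ultimately show ?thesis using norm_triangle_ineq[of x y] by linarith
  qed
  then have "ln (1 + norm (x + y)) \<le> ln ((1 + norm x) * (1 + norm y))"
    by (subst ln_le_cancel_iff) (auto intro!: add_pos_nonneg mult_pos_pos)
  also have "\<dots> = ln (1 + norm x) + ln (1 + norm y)"
    by (rule ln_mult_pos) (auto intro!: add_pos_nonneg)
  finally show ?thesis .
qed

lemma ln_pos_le: "ln_pos z \<le> ln (1 + norm z)"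
proof (cases "z = 0")
  case False
  then have "ln (norm z) \<le> ln (1 + norm z)" by (subst ln_le_cancel_iff) (auto intro: add_pos_nonneg)
  then show ?thesis by (simp add: ln_pos_def)
qed (simp add: ln_pos_def)

lemma ln_one_plus_le_ln_pos: "ln (1 + norm z) \<le> ln 2 + ln_pos z"
proof (cases "norm z \<le> 1")
  case True
  then have "ln (1 + norm z) \<le> ln 2" by (subst ln_le_cancel_iff) (auto intro: add_pos_nonneg)
  then show ?thesis by (simp add: add_increasing2)
next
  case False
  then have "ln (1 + norm z) \<le> ln (2 * norm z)" by (subst ln_le_cancel_iff) auto
  also have "\<dots> = ln 2 + ln (norm z)" using False by (intro ln_mult_pos) auto
  finally show ?thesis by (simp add: ln_pos_def)
qed

text \<open>
  For a point of the unit disc the norm is at least \<open>\<bar>a\<bar>\<close>, and \<open>- ln r \<le> 4 * r powr (- 1 / 4)\<close>. So the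
  square is dominated by a function with the integrable singularity \<open>\<bar>a\<bar> powr (- 1 / 2)\<close> in the first
  coordinate alone.
\<close>

lemma ln_neg_square_bound:
  assumes "a \<noteq> 0"
  shows "(ln_neg (vec2 a b))\<^sup>2 \<le> 16 * (indicator {0..1} a * a powr (-1/2) + indicator {0..1} (- a) * (- a) powr (-1/2)) * indicator {-1..1} b"
proof (cases "norm (vec2 a b) < 1")
  case False
  then have "ln_neg (vec2 a b) = 0" by (simp add: ln_neg_def)
  then show ?thesis by (simp add: indicator_def)
next
  case True
  have a: "\<bar>a\<bar> \<le> norm (vec2 a b)" "\<bar>b\<bar> \<le> norm (vec2 a b)"
    using component_le_norm_cart[of "vec2 a b" 1] component_le_norm_cart[of "vec2 a b" 2] by auto
  have np: "0 < norm (vec2 a b)" using a(1) assms by linarith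
  then have "0 \<le> - ln (norm (vec2 a b))" using True by simp
  then have "ln_neg (vec2 a b) = - ln (norm (vec2 a b))" by (simp add: ln_neg_def)
  also have "\<dots> \<le> - ln \<bar>a\<bar>" using a(1) assms np by (simp add: ln_le_cancel_iff del: zero_less_norm_iff)
  also have "\<dots> = ln (1 / \<bar>a\<bar>)" using assms by (simp add: ln_div)
  also have "\<dots> \<le> (1 / \<bar>a\<bar>) powr (1/4) / (1/4)"
    using a True assms by (intro ln_powr_bound) (auto simp: field_simps)
  finally have "(ln_neg (vec2 a b))\<^sup>2 \<le> ((1 / \<bar>a\<bar>) powr (1/4) / (1/4))\<^sup>2" by (intro power_mono) auto
  also have "\<dots> = 16 * ((1 / \<bar>a\<bar>) powr (1/4) * (1 / \<bar>a\<bar>) powr (1/4))" by (simp add: power2_eq_square)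
  also have "\<dots> = 16 * \<bar>a\<bar> powr (-1/2)" using assms by (simp add: powr_add[symmetric] powr_minus_divide powr_divide)
  finally have "(ln_neg (vec2 a b))\<^sup>2 \<le> 16 * \<bar>a\<bar> powr (-1/2)" .
  moreover have "\<bar>a\<bar> \<le> 1" "\<bar>b\<bar> \<le> 1" using a True by auto
  ultimately show ?thesis using assms by (cases "0 \<le> a") (auto simp: indicator_def)
qed

theorem ln_neg_square_integrable: "integrable lborel (\<lambda>z. (ln_neg z)\<^sup>2)"
proof (rule integrableI_bounded)
  define \<phi> where "\<phi> a = ennreal (indicator {0..1} a * a powr (-1/2))" for a :: real
  have [measurable]: "\<phi> \<in> borel_measurable borel" unfolding \<phi>_def by measurable
  have fin: "(\<integral>\<^sup>+a. \<phi> a \<partial>lborel) < \<infinity>"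
  proof -
    have "((\<lambda>x. x powr (-1/2)) has_integral (1 powr (-1/2 + 1) / (-1/2 + 1))) {0..1::real}"
      by (rule has_integral_powr_from_0) auto
    moreover have "(\<lambda>x. indicator {0..1} x * x powr (-1/2)) = (\<lambda>x::real. if x \<in> {0..1} then x powr (-1/2) else 0)"
      by (auto simp: indicator_def)
    ultimately have "((\<lambda>x. indicator {0..1} x * x powr (-1/2)) has_integral (1 powr (-1/2 + 1) / (-1/2 + 1))) (UNIV :: real set)"
      by (simp only: has_integral_restrict_UNIV)
    then have "(\<integral>\<^sup>+a. ennreal (indicator {0..1} a * a powr (-1/2)) \<partial>lborel) = ennreal (1 powr (-1/2 + 1) / (-1/2 + 1))"
      by (intro nn_integral_has_integral_lborel) auto
    then show ?thesis by (simp add: \<phi>_def)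
  qed
  have refl: "(\<integral>\<^sup>+a. \<phi> (- a) \<partial>lborel) = (\<integral>\<^sup>+a. \<phi> a \<partial>lborel)"
    using nn_integral_real_affine[of \<phi> "-1" 0] by simp
  have "(\<integral>\<^sup>+z. ennreal (norm ((ln_neg z)\<^sup>2)) \<partial>lborel) = (\<integral>\<^sup>+a. \<integral>\<^sup>+b. ennreal (norm ((ln_neg (vec2 a b))\<^sup>2)) \<partial>lborel \<partial>lborel)"
    by (rule nn_integral_vec2) measurable
  also have "\<dots> \<le> (\<integral>\<^sup>+a. \<integral>\<^sup>+b. 16 * (\<phi> a + \<phi> (- a)) * indicator {-1..1::real} b \<partial>lborel \<partial>lborel)"
  proof (rule nn_integral_mono_AE)
    have "AE a in lborel. a \<noteq> (0::real)" by (rule AE_lborel_singleton)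
    then show "AE a in lborel. (\<integral>\<^sup>+b. ennreal (norm ((ln_neg (vec2 a b))\<^sup>2)) \<partial>lborel) \<le> (\<integral>\<^sup>+b. 16 * (\<phi> a + \<phi> (- a)) * indicator {-1..1::real} b \<partial>lborel)"
    proof eventually_elim
      case (elim a)
      show ?case
      proof (rule nn_integral_mono)
        fix b
        have "ennreal (norm ((ln_neg (vec2 a b))\<^sup>2)) \<le>
          ennreal (16 * (indicator {0..1} a * a powr (-1/2) + indicator {0..1} (- a) * (- a) powr (-1/2)) * indicator {-1..1} b)"
          using ln_neg_square_bound[OF elim] by (simp add: ennreal_leI)
        also have "\<dots> = 16 * (\<phi> a + \<phi> (- a)) * indicator {-1..1::real} b"
          unfolding \<phi>_def by (auto simp: ennreal_mult indicator_def)
        finally show "ennreal (norm ((ln_neg (vec2 a b))\<^sup>2)) \<le> 16 * (\<phi> a + \<phi> (- a)) * indicator {-1..1::real} b" .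
      qed
    qed
  qed
  also have "\<dots> = (\<integral>\<^sup>+a. 32 * (\<phi> a + \<phi> (- a)) \<partial>lborel)"
  proof (rule nn_integral_cong)
    fix a
    have "(\<integral>\<^sup>+b. 16 * (\<phi> a + \<phi> (- a)) * indicator {-1..1::real} b \<partial>lborel) = 16 * (\<phi> a + \<phi> (- a)) * ennreal 2"
      by (simp add: nn_integral_cmult)
    also have "\<dots> = (16 * 2) * (\<phi> a + \<phi> (- a))"
      by (simp only: mult_ac ennreal_numeral)
    also have "(16 * 2 :: ennreal) = 32" by simp
    finally show "(\<integral>\<^sup>+b. 16 * (\<phi> a + \<phi> (- a)) * indicator {-1..1::real} b \<partial>lborel) = 32 * (\<phi> a + \<phi> (- a))" .
  qed
  also have "\<dots> = 32 * ((\<integral>\<^sup>+a. \<phi> a \<partial>lborel) + (\<integral>\<^sup>+a. \<phi> (- a) \<partial>lborel))"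
    by (simp add: nn_integral_cmult nn_integral_add)
  also have "\<dots> < \<infinity>" using fin unfolding refl by (simp add: ennreal_mult_less_top)
  finally show "(\<integral>\<^sup>+z. ennreal (norm ((ln_neg z)\<^sup>2)) \<partial>lborel) < \<infinity>" .
qed measurable

lemma integrable_kernel:
  fixes f k :: "plane \<Rightarrow> real"
  assumes f: "integrable lborel f" and k: "integrable lborel k"
  shows "integrable (lborel \<Otimes>\<^sub>M lborel) (\<lambda>(x, y). f x * k (y - x))"
    and "(\<integral>(x, y). f x * k (y - x) \<partial>(lborel \<Otimes>\<^sub>M lborel)) = (LBINT x. f x) * (LBINT y. k y)"
proof -
  have [measurable]: "f \<in> borel_measurable borel" "k \<in> borel_measurable borel" using assms by auto
  have s: "(LBINT y. \<bar>k (y - x)\<bar>) = (LBINT y. \<bar>k y\<bar>)" for x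
    using integral_shift[of "\<lambda>y. \<bar>k y\<bar>" "- x"] by simp
  have s': "(LBINT y. k (y - x)) = (LBINT y. k y)" for x
    using integral_shift[of k "- x"] by simp
  show *: "integrable (lborel \<Otimes>\<^sub>M lborel) (\<lambda>(x, y). f x * k (y - x))"
  proof (rule lborel_pair.Fubini_integrable)
    show "AE x in lborel. integrable lborel (\<lambda>y. case (x, y) of (x, y) \<Rightarrow> f x * k (y - x))"
      using integrable_shift[OF k] by (intro AE_I2) (auto simp: diff_conv_add_uminus simp del: add_uminus_conv_diff)
    show "integrable lborel (\<lambda>x. LBINT y. norm (case (x, y) of (x, y) \<Rightarrow> f x * k (y - x)))"
      using f by (simp add: abs_mult s)
  qed measurable
  show "(\<integral>(x, y). f x * k (y - x) \<partial>(lborel \<Otimes>\<^sub>M lborel)) = (LBINT x. f x) * (LBINT y. k y)"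
    using lborel_pair.integral_fst'[OF *] by (simp add: s')
qed

text \<open>
  The functional \<open>V\<close> with the logarithm of the distance replaced by a kernel \<open>k\<close>.
\<close>

definition energy :: "(plane \<Rightarrow> real) \<Rightarrow> (plane \<Rightarrow> real) \<Rightarrow> real" where
  "energy k u = (\<integral>(x, y). (u x)\<^sup>2 * (u y)\<^sup>2 * k (x - y) \<partial>(lborel \<Otimes>\<^sub>M lborel))"

lemma energy_ln_pos_integrable:
  assumes u: "u \<in> X"
  shows "integrable (lborel \<Otimes>\<^sub>M lborel) (\<lambda>(x, y). (u x)\<^sup>2 * (u y)\<^sup>2 * ln_pos (x - y))"
proof -
  note [measurable] = X_D(2)[OF u]
  have i: "integrable (lborel \<Otimes>\<^sub>M lborel) (\<lambda>p. (case p of (x, y) \<Rightarrow> (ln (1 + norm x) * (u x)\<^sup>2) * (u y)\<^sup>2) +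
      (case p of (x, y) \<Rightarrow> (u x)\<^sup>2 * (ln (1 + norm y) * (u y)\<^sup>2)))"
    by (intro Bochner_Integration.integrable_add integrable_tensor X_D[OF u])
  show ?thesis
  proof (rule integrable_dominated[OF i])
    have "ln_pos (x - y) \<le> ln (1 + norm x) + ln (1 + norm y)" for x y
      using ln_pos_le[of "x - y"] ln_one_plus_norm_add[of x "- y"] by simp
    then have "(u x)\<^sup>2 * (u y)\<^sup>2 * ln_pos (x - y) \<le> (u x)\<^sup>2 * (u y)\<^sup>2 * (ln (1 + norm x) + ln (1 + norm y))" for x y
      by (intro mult_left_mono) auto
    then show "\<bar>case p of (x, y) \<Rightarrow> (u x)\<^sup>2 * (u y)\<^sup>2 * ln_pos (x - y)\<bar> \<le>
      (case p of (x, y) \<Rightarrow> (ln (1 + norm x) * (u x)\<^sup>2) * (u y)\<^sup>2) + (case p of (x, y) \<Rightarrow> (u x)\<^sup>2 * (ln (1 + norm y) * (u y)\<^sup>2))" for p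
      by (cases p) (auto simp: algebra_simps abs_mult)
  qed measurable
qed

text \<open>
  Young's inequality. The parameter \<open>d\<close> allows the part with the fourth power to be made small; the
  other part is a convolution of integrable functions.
\<close>

lemma energy_ln_neg_pointwise:
  assumes "0 < d"
  shows "s\<^sup>2 * t\<^sup>2 * ln_neg (x - y) \<le> (d / 2) * (s\<^sup>2 * t ^ 4) + (1 / (2 * d)) * (s\<^sup>2 * (ln_neg (y - x))\<^sup>2)"
proof -
  have "ln_neg (x - y) = ln_neg (y - x)" by (simp add: ln_neg_def norm_minus_commute)
  moreover have "t\<^sup>2 * z \<le> (d / 2) * t ^ 4 + (1 / (2 * d)) * z\<^sup>2" for z
  proof -
    have "0 \<le> (d * t\<^sup>2 - z)\<^sup>2 / (2 * d)" using assms by simp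
    also have "\<dots> = (d / 2) * t ^ 4 + (1 / (2 * d)) * z\<^sup>2 - t\<^sup>2 * z"
      using assms by (simp add: power2_eq_square power4_eq_xxxx field_simps)
    finally show ?thesis by simp
  qed
  then have "s\<^sup>2 * (t\<^sup>2 * ln_neg (y - x)) \<le> s\<^sup>2 * ((d / 2) * t ^ 4 + (1 / (2 * d)) * (ln_neg (y - x))\<^sup>2)"
    by (intro mult_left_mono) auto
  ultimately show ?thesis by (simp add: algebra_simps)
qed

lemma energy_ln_neg_majorant:
  assumes u: "u \<in> H1"
  shows "integrable (lborel \<Otimes>\<^sub>M lborel) (\<lambda>(x, y). (d / 2) * ((u x)\<^sup>2 * (u y) ^ 4) + (1 / (2 * d)) * ((u x)\<^sup>2 * (ln_neg (y - x))\<^sup>2))"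
    and "(\<integral>(x, y). (d / 2) * ((u x)\<^sup>2 * (u y) ^ 4) + (1 / (2 * d)) * ((u x)\<^sup>2 * (ln_neg (y - x))\<^sup>2) \<partial>(lborel \<Otimes>\<^sub>M lborel)) =
      (d / 2) * (mass u * (LBINT x. (u x) ^ 4)) + (1 / (2 * d)) * (mass u * (LBINT z. (ln_neg z)\<^sup>2))"
proof -
  note t = integrable_tensor[OF H1_D(2)[OF u] H1_fourth_moment(1)[OF u]]
  note k = integrable_kernel[OF H1_D(2)[OF u] ln_neg_square_integrable]
  have eq: "(\<lambda>(x, y). (d / 2) * ((u x)\<^sup>2 * (u y) ^ 4) + (1 / (2 * d)) * ((u x)\<^sup>2 * (ln_neg (y - x))\<^sup>2)) =
     (\<lambda>p. (d / 2) * (case p of (x, y) \<Rightarrow> (u x)\<^sup>2 * (u y) ^ 4) + (1 / (2 * d)) * (case p of (x, y) \<Rightarrow> (u x)\<^sup>2 * (ln_neg (y - x))\<^sup>2))"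
    by (auto simp: case_prod_unfold)
  show "integrable (lborel \<Otimes>\<^sub>M lborel) (\<lambda>(x, y). (d / 2) * ((u x)\<^sup>2 * (u y) ^ 4) + (1 / (2 * d)) * ((u x)\<^sup>2 * (ln_neg (y - x))\<^sup>2))"
    unfolding eq by (intro Bochner_Integration.integrable_add integrable_mult_right t k)
  show "(\<integral>(x, y). (d / 2) * ((u x)\<^sup>2 * (u y) ^ 4) + (1 / (2 * d)) * ((u x)\<^sup>2 * (ln_neg (y - x))\<^sup>2) \<partial>(lborel \<Otimes>\<^sub>M lborel)) =
      (d / 2) * (mass u * (LBINT x. (u x) ^ 4)) + (1 / (2 * d)) * (mass u * (LBINT z. (ln_neg z)\<^sup>2))"
    unfolding eq
    by (subst Bochner_Integration.integral_add; (intro integrable_mult_right t(1) k(1))?) (simp only: integral_mult_right_zero t(2) k(2))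
qed

lemma energy_ln_neg_integrable:
  assumes u: "u \<in> H1"
  shows "integrable (lborel \<Otimes>\<^sub>M lborel) (\<lambda>(x, y). (u x)\<^sup>2 * (u y)\<^sup>2 * ln_neg (x - y))"
proof -
  note [measurable] = H1_D(1)[OF u]
  show ?thesis
    by (rule integrable_dominated[OF energy_ln_neg_majorant(1)[OF u, of 1]])
      (use energy_ln_neg_pointwise[of 1] in \<open>auto simp: abs_mult\<close>)
qed

lemma energy_ln_neg_bound:
  assumes u: "u \<in> H1" and d: "0 < d"
  shows "energy ln_neg u \<le> (d / 2) * (mass u * (LBINT x. (u x) ^ 4)) +
    (1 / (2 * d)) * (mass u * (LBINT z. (ln_neg z)\<^sup>2))"
  unfolding energy_def energy_ln_neg_majorant(2)[OF u, symmetric]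
proof (intro integral_mono energy_ln_neg_integrable energy_ln_neg_majorant u)
  fix q :: "plane \<times> plane"
  show "(case q of (x, y) \<Rightarrow> (u x)\<^sup>2 * (u y)\<^sup>2 * ln_neg (x - y)) \<le>
     (case q of (x, y) \<Rightarrow> (d / 2) * ((u x)\<^sup>2 * (u y) ^ 4) + (1 / (2 * d)) * ((u x)\<^sup>2 * (ln_neg (y - x))\<^sup>2))"
    using energy_ln_neg_pointwise[OF d, of "u (fst q)" "u (snd q)" "fst q" "snd q"] unfolding case_prod_unfold .
qed

lemma V_eq:
  assumes u: "u \<in> X"
  shows "V u = energy ln_pos u - energy ln_neg u"
proof -
  have "V u = (\<integral>p. (case p of (x, y) \<Rightarrow> (u x)\<^sup>2 * (u y)\<^sup>2 * ln_pos (x - y)) - (case p of (x, y) \<Rightarrow> (u x)\<^sup>2 * (u y)\<^sup>2 * ln_neg (x - y)) \<partial>(lborel \<Otimes>\<^sub>M lborel))"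
    unfolding V_def by (intro Bochner_Integration.integral_cong) (auto simp: ln_eq_ln_pos_minus_ln_neg right_diff_distrib)
  also have "\<dots> = energy ln_pos u - energy ln_neg u"
    unfolding energy_def using energy_ln_pos_integrable[OF u] energy_ln_neg_integrable[OF X_D(1)[OF u]]
    by (rule Bochner_Integration.integral_diff)
  finally show ?thesis .
qed

lemma energy_nonneg: "(\<And>z. 0 \<le> k z) \<Longrightarrow> 0 \<le> energy k u"
  unfolding energy_def by (intro Bochner_Integration.integral_nonneg) auto

section \<open>Translation invariance and nonemptiness of the constraint set\<close>

lemma X_shift:
  assumes u: "u \<in> X"
  shows "(\<lambda>x. u (x + z)) \<in> X"
proof -
  note [measurable] = X_D(2)[OF u]
  have "integrable lborel (\<lambda>x. ln (1 + norm (x - z)) * (u x)\<^sup>2)"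
  proof (rule integrable_dominated)
    show "integrable lborel (\<lambda>x. ln (1 + norm x) * (u x)\<^sup>2 + ln (1 + norm z) * (u x)\<^sup>2)"
      using X_D[OF u] by simp
    show "\<bar>ln (1 + norm (x - z)) * (u x)\<^sup>2\<bar> \<le> ln (1 + norm x) * (u x)\<^sup>2 + ln (1 + norm z) * (u x)\<^sup>2" for x
      using mult_right_mono[OF ln_one_plus_norm_add[of x "- z"], of "(u x)\<^sup>2"] by (simp add: distrib_right abs_mult)
  qed measurable
  from integrable_shift[OF this, of z] have "integrable lborel (\<lambda>x. ln (1 + norm x) * (u (x + z))\<^sup>2)" by simp
  then show ?thesis using H1_shift(1)[OF X_D(1)[OF u]] by (simp add: X_def)
qed

lemma energy_shift:
  assumes [measurable]: "u \<in> borel_measurable borel" "k \<in> borel_measurable borel"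
  shows "energy k (\<lambda>x. u (x + z)) = energy k u"
proof -
  define \<Phi> where "\<Phi> p = (case p of (x, y) \<Rightarrow> (u x)\<^sup>2 * (u y)\<^sup>2 * k (x - y))" for p :: "plane \<times> plane"
  have m: "\<Phi> \<in> borel_measurable borel" unfolding \<Phi>_def borel_prod[symmetric] by measurable
  have "energy k (\<lambda>x. u (x + z)) = (LBINT p. \<Phi> (p + (z, z)))"
    unfolding energy_def lborel_prod by (intro Bochner_Integration.integral_cong) (auto simp: \<Phi>_def)
  also have "\<dots> = (LBINT p. \<Phi> p)" by (rule integral_shift[OF m])
  also have "\<dots> = energy k u" unfolding energy_def lborel_prod \<Phi>_def ..
  finally show ?thesis .
qed

lemma F_shift:
  assumes u: "u \<in> X"
  shows "F \<gamma> a p (\<lambda>x. u (x + z)) = F \<gamma> a p u"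
proof -
  note [measurable] = X_D(2)[OF u]
  have "C p (\<lambda>x. u (x + z)) = C p u"
    unfolding C_def using integral_shift[of "\<lambda>x. \<bar>u x\<bar> powr p" z] by simp
  moreover have "V (\<lambda>x. u (x + z)) = V u"
    by (simp add: V_eq[OF u] V_eq[OF X_shift[OF u]] energy_shift)
  ultimately show ?thesis by (simp add: F_def H1_shift(2)[OF X_D(1)[OF u]])
qed

lemma S_shift:
  assumes "u \<in> S c"
  shows "(\<lambda>x. u (x + z)) \<in> S c"
proof -
  have u: "u \<in> X" using assms by (simp add: S_def)
  note [measurable] = X_D(2)[OF u]
  show ?thesis using assms integral_shift[of "\<lambda>x. (u x)\<^sup>2" z] X_shift[OF u] by (simp add: S_def)
qed

lemma X_scale:
  assumes u: "u \<in> X"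
  shows "(\<lambda>x. d * u x) \<in> X"
proof -
  have "integrable lborel (\<lambda>x. d\<^sup>2 * (ln (1 + norm x) * (u x)\<^sup>2))" using X_D(4)[OF u] by simp
  then have "integrable lborel (\<lambda>x. ln (1 + norm x) * (d * u x)\<^sup>2)" by (simp add: power_mult_distrib mult.left_commute)
  then show ?thesis using H1_scale(1)[OF X_D(1)[OF u]] by (simp add: X_def)
qed

lemma compact_support_integrable:
  fixes f :: "plane \<Rightarrow> real"
  assumes f: "continuous_on UNIV f" "\<And>x. R < norm x \<Longrightarrow> f x = 0"
  shows "integrable lborel f"
proof -
  have "integrable lborel (\<lambda>x. indicator (cball 0 R) x *\<^sub>R f x)"
    by (rule borel_integrable_compact[OF compact_cball continuous_on_subset[OF f(1)]]) simp
  moreover have "(\<lambda>x. indicator (cball 0 R) x *\<^sub>R f x) = f"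
  proof
    show "indicator (cball 0 R) x *\<^sub>R f x = f x" for x
      using f(2)[of x] by (cases "norm x \<le> R") auto
  qed
  ultimately show ?thesis by simp
qed

lemma test_function_in_X:
  assumes "test_function u"
  shows "u \<in> X"
proof -
  obtain K R where *: "\<And>x. R < norm x \<Longrightarrow> u x = 0" "\<And>x i. R < norm x \<Longrightarrow> partial i u x = 0"
    using test_function_bounded[OF assms] by metis
  note c = test_functionD(2,3)[OF assms]
  have i: "integrable lborel (\<lambda>x. (u x)\<^sup>2)"
    by (rule compact_support_integrable[of _ R]) (use * in \<open>auto intro!: continuous_intros c\<close>)
  have ig: "integrable lborel (\<lambda>x. (norm (\<chi> i. partial i u x))\<^sup>2)"
    unfolding norm_plane_square
    by (rule compact_support_integrable[of _ R]) (use * in \<open>auto intro!: continuous_intros c\<close>)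
  have "u \<in> H1" by (rule H1_I(1)[OF test_functionD(4)[OF assms] i test_function_weak_gradient[OF assms] ig])
  moreover have "integrable lborel (\<lambda>x. ln (1 + norm x) * (u x)\<^sup>2)"
  proof (rule compact_support_integrable[of _ R])
    have "1 + norm x \<noteq> 0" for x :: plane by (smt (verit) norm_ge_zero)
    then show "continuous_on UNIV (\<lambda>x. ln (1 + norm x) * (u x)\<^sup>2)" by (intro continuous_intros c) auto
  qed (use * in auto)
  ultimately show ?thesis by (simp add: X_def)
qed

text \<open>
  A bump function, scaled to mass \<open>c\<close>.
\<close>

lemma S_nonempty:
  assumes "0 < c"
  shows "S c \<noteq> {}"
proof -
  let ?a = "vec2 0 0" and ?b = "vec2 1 1"
  obtain \<phi> :: "nat \<Rightarrow> plane \<Rightarrow> real" where \<phi>: "\<And>n. test_function (\<phi> n)" "\<And>n x. x \<in> box ?a ?b \<Longrightarrow> 0 < \<phi> n x"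
    using box_indicator_approx[of ?a ?b] by metis
  define u where "u = \<phi> 0"
  have u: "u \<in> X" using \<phi>(1) by (simp add: u_def test_function_in_X)
  note [measurable] = X_D(2)[OF u]
  define s where "s = mass u"
  have "s \<noteq> 0"
  proof
    assume "s = 0"
    then have "AE x in lborel. (u x)\<^sup>2 = 0"
      using integral_nonneg_eq_0_iff_AE[of lborel "\<lambda>x. (u x)\<^sup>2"] X_D(3)[OF u] by (simp add: s_def)
    then have "AE x in lborel. x \<notin> box ?a ?b"
    proof eventually_elim
      case (elim x)
      then have "\<phi> 0 x = 0" by (simp add: u_def)
      then show ?case using \<phi>(2)[of x 0] by auto
    qed
    then have "emeasure lborel (box ?a ?b) = 0" by (subst (asm) AE_iff_measurable[OF _ refl]) auto
    moreover have "box ?a ?b = {x. x $ 1 \<in> {0<..<1} \<and> x $ 2 \<in> {0<..<1}}"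
      by (auto simp: mem_box_cart forall_2)
    then have "emeasure lborel (box ?a ?b) = 1" by (simp only:) (subst emeasure_rectangle, auto)
    ultimately show False by simp
  qed
  then have "0 < s" unfolding s_def by (simp add: less_le)
  define d where "d = sqrt (c / s)"
  have "(LBINT x. (d * u x)\<^sup>2) = d\<^sup>2 * s" by (simp add: power_mult_distrib s_def)
  also have "\<dots> = c" using \<open>0 < s\<close> assms by (simp add: d_def)
  finally have "(\<lambda>x. d * u x) \<in> S c" using X_scale[OF u] by (simp add: S_def)
  then show ?thesis by blast
qed

section \<open>Coercivity\<close>

lemma powr_le_fourth_plus_square:
  fixes p \<epsilon> :: real
  assumes "2 < p" "p < 4" "0 < \<epsilon>"
  obtains K where "0 \<le> K" "\<And>y::real. \<bar>y\<bar> powr p \<le> \<epsilon> * y ^ 4 + K * y\<^sup>2"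
proof
  \<comment> \<open>Above the threshold \<open>T\<close> the quotient \<open>\<bar>y\<bar> powr p / y ^ 4\<close> is at most \<open>\<epsilon>\<close>.\<close>
  define T where "T = \<epsilon> powr (1 / (p - 4))"
  have T0: "0 < T" using assms by (simp add: T_def)
  have T: "T powr (p - 4) = \<epsilon>" using assms by (simp add: T_def powr_powr)
  show "0 \<le> T powr (p - 2)" by simp
  show "\<bar>y\<bar> powr p \<le> \<epsilon> * y ^ 4 + T powr (p - 2) * y\<^sup>2" for y :: real
  proof (cases "y = 0")
    case False
    then have y: "\<bar>y\<bar> powr p = y\<^sup>2 * \<bar>y\<bar> powr (p - 2)" "\<bar>y\<bar> powr p = y ^ 4 * \<bar>y\<bar> powr (p - 4)"
      by (simp_all add: powr_diff powr_numeral)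
    show ?thesis
    proof (cases "\<bar>y\<bar> \<le> T")
      case True
      then have "\<bar>y\<bar> powr (p - 2) \<le> T powr (p - 2)" using assms by (intro powr_mono2) auto
      then have "y\<^sup>2 * \<bar>y\<bar> powr (p - 2) \<le> y\<^sup>2 * T powr (p - 2)" by (intro mult_left_mono) auto
      then show ?thesis using assms by (simp add: y(1) mult.commute add_increasing)
    next
      case False
      then have "\<bar>y\<bar> powr (p - 4) \<le> T powr (p - 4)" using assms T0 by (intro powr_mono2') auto
      then have "y ^ 4 * \<bar>y\<bar> powr (p - 4) \<le> y ^ 4 * \<epsilon>" unfolding T by (intro mult_left_mono) auto
      then show ?thesis by (simp add: y(2) mult.commute add_increasing2)
    qed
  qed simp
qed

lemma C_nonneg: "0 \<le> C p u"
  by (simp add: C_def)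

text \<open>
  The three alternatives for the nonlinear term: it has the favourable sign, or it is subcritical and is
  absorbed by a small multiple of the fourth moment, or it is critical and the Gagliardo--Nirenberg
  inequality applies with \<open>\<theta> = a * K * c / 4\<close> for a constant \<open>K\<close> close to the best one.
\<close>

lemma C_relative_bound:
  assumes c: "0 < c" and p: "2 < p"
    and cases: "a \<le> 0 \<or> (a > 0 \<and> p < 4) \<or> (a > 0 \<and> p = 4 \<and> c < 2 / (a * K_GN p))"
  obtains \<theta> K where "\<theta> < 1 / 2" "\<And>u. u \<in> S c \<Longrightarrow> a / p * C p u \<le> \<theta> * A u + K"
proof -
  consider "a \<le> 0" | "a > 0" "p < 4" | "a > 0" "p = 4" "c < 2 / (a * K_GN p)" using cases by blast
  then show ?thesis
  proof cases
    case 1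
    then have "a / p * C p u \<le> 0 * A u + 0" for u
      using p by (simp add: mult_nonpos_nonneg divide_nonpos_pos C_nonneg)
    then show ?thesis by (intro that[of 0 0]) auto
  next
    case 2
    define \<epsilon> where "\<epsilon> = p / (16 * a * c)"
    have "0 < \<epsilon>" using 2 c p by (simp add: \<epsilon>_def)
    then obtain K where K: "0 \<le> K" "\<And>y::real. \<bar>y\<bar> powr p \<le> \<epsilon> * y ^ 4 + K * y\<^sup>2"
      using powr_le_fourth_plus_square[OF p 2(2)] by metis
    have "a / p * C p u \<le> 1 / 4 * A u + a / p * (K * c)" if "u \<in> S c" for u
    proof -
      have u: "u \<in> H1" "mass u = c" using that by (auto simp: S_def X_def)
      obtain k where k: "p \<le> 2 * real (Suc k)" using exists_even_exponent by blast
      have "C p u \<le> (LBINT x. \<epsilon> * (u x) ^ 4 + K * (u x)\<^sup>2)"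
        unfolding C_def using p
        by (intro integral_mono K H1_powr_moment(1)[OF u(1) _ k]) (auto intro!: H1_fourth_moment H1_D u)
      also have "\<dots> = \<epsilon> * (LBINT x. (u x) ^ 4) + K * c"
        using H1_fourth_moment(1)[OF u(1)] H1_D(2)[OF u(1)] u(2) by simp
      also have "\<dots> \<le> \<epsilon> * (4 * A u * c) + K * c"
        using H1_fourth_moment(2)[OF u(1)] u(2) \<open>0 < \<epsilon>\<close> by (intro add_right_mono mult_left_mono) auto
      finally have "a / p * C p u \<le> a / p * (\<epsilon> * (4 * A u * c) + K * c)"
        using 2 p by (intro mult_left_mono) auto
      also have "\<dots> = 1 / 4 * A u + a / p * (K * c)" using 2 p c by (simp add: \<epsilon>_def field_simps)
      finally show ?thesis .
    qed
    then show ?thesis by (intro that[of "1/4" "a / p * (K * c)"]) auto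
  next
    case 3
    have ne: "{K. GN_inequality p K} \<noteq> {}" using GN_inequality_4 3(2) by auto
    \<comment> \<open>Otherwise \<open>2 / (a * K_GN p) \<le> 0\<close>, including the value \<open>2 / 0 = 0\<close>.\<close>
    have pos: "0 < K_GN p"
    proof (rule ccontr)
      assume "\<not> 0 < K_GN p"
      then have "a * K_GN p \<le> 0" using 3(1) by (simp add: mult_nonneg_nonpos)
      then have "2 / (a * K_GN p) \<le> 0" by (intro divide_nonneg_nonpos) auto
      then show False using 3(3) c by linarith
    qed
    then have "Inf {K. GN_inequality p K} < 2 / (a * c)"
      using 3(1,3) c by (simp add: K_GN_def field_simps)
    then obtain K where K: "GN_inequality p K" "K < 2 / (a * c)" using cInf_lessD[OF ne] by auto
    have "a / p * C p u \<le> a * K * c / 4 * A u + 0" if "u \<in> S c" for u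
    proof -
      have u: "u \<in> H1" "mass u = c" using that by (auto simp: S_def X_def)
      have "sqrt (A u) powr (4 - 2) = A u"
        using A_nonneg[of u] by (cases "A u = 0") (auto simp: powr_numeral)
      moreover have "C p u \<le> K * sqrt (A u) powr (p - 2) * (sqrt c)\<^sup>2"
        using K(1) u unfolding GN_inequality_def C_def A_def by blast
      ultimately have "C p u \<le> K * A u * c" using 3(2) c by simp
      then have "a / p * C p u \<le> a / p * (K * A u * c)" using 3 by (intro mult_left_mono) auto
      then show ?thesis using 3(2) by (simp add: mult_ac)
    qed
    moreover have "a * K * c / 4 < 1 / 2" using K(2) 3(1) c by (simp add: field_simps)
    ultimately show ?thesis by (intro that[of "a * K * c / 4" 0]) auto
  qed
qed

theorem F_coercive:
  assumes c: "0 < c" and g: "0 < \<gamma>" and p: "2 < p"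
    and cases: "a \<le> 0 \<or> (a > 0 \<and> p < 4) \<or> (a > 0 \<and> p = 4 \<and> c < 2 / (a * K_GN p))"
  obtains \<delta> K where "0 < \<delta>" "\<And>u. u \<in> S c \<Longrightarrow> \<delta> * A u + \<gamma> / 4 * energy ln_pos u \<le> F \<gamma> a p u + K"
proof -
  obtain \<theta> K where \<theta>: "\<theta> < 1 / 2" and K: "\<And>u. u \<in> S c \<Longrightarrow> a / p * C p u \<le> \<theta> * A u + K"
    using C_relative_bound[OF c p cases] by blast
  \<comment> \<open>Half of the gap \<open>1 / 2 - \<theta>\<close> absorbs \<open>energy ln_neg\<close>, and the other half is the coercivity constant.\<close>
  define \<eta> where "\<eta> = (1 / 2 - \<theta>) / 2"
  have \<eta>: "0 < \<eta>" using \<theta> by (simp add: \<eta>_def)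
  define d where "d = 2 * \<eta> / (\<gamma> * c\<^sup>2)"
  have d: "0 < d" using \<eta> g c by (simp add: d_def)
  define K2 where "K2 = (LBINT z. (ln_neg z)\<^sup>2)"
  define N0 where "N0 = \<gamma> / 4 * ((1 / (2 * d)) * (c * K2))"
  have "\<eta> * A u + \<gamma> / 4 * energy ln_pos u \<le> F \<gamma> a p u + (N0 + K)" if "u \<in> S c" for u
  proof -
    have u: "u \<in> X" "u \<in> H1" "mass u = c" using that by (auto simp: S_def X_def)
    have "energy ln_neg u \<le> (d / 2) * (c * (LBINT x. (u x) ^ 4)) + (1 / (2 * d)) * (c * K2)"
      using energy_ln_neg_bound[OF u(2) d] unfolding u(3) K2_def .
    also have "\<dots> \<le> (d / 2) * (c * (4 * A u * c)) + (1 / (2 * d)) * (c * K2)"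
      using H1_fourth_moment(2)[OF u(2)] u(3) d c by (intro add_right_mono mult_left_mono) auto
    finally have "\<gamma> / 4 * energy ln_neg u \<le> \<gamma> / 4 * ((d / 2) * (c * (4 * A u * c)) + (1 / (2 * d)) * (c * K2))"
      using g by (intro mult_left_mono) auto
    also have "\<dots> = \<eta> * A u + N0"
    proof -
      have "\<gamma> / 4 * ((d / 2) * (c * (4 * A u * c))) = \<eta> * A u"
        using g c by (simp add: d_def power2_eq_square field_simps)
      then show ?thesis by (simp add: N0_def distrib_left)
    qed
    finally have "\<gamma> / 4 * energy ln_neg u \<le> \<eta> * A u + N0" .
    moreover have "\<gamma> / 4 * V u = \<gamma> / 4 * energy ln_pos u - \<gamma> / 4 * energy ln_neg u"
      by (simp add: V_eq[OF u(1)] right_diff_distrib diff_divide_distrib)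
    moreover have "2 * (\<eta> * A u) = 1 / 2 * A u - \<theta> * A u" by (simp add: \<eta>_def field_simps)
    ultimately show ?thesis using K[OF that] unfolding F_def by linarith
  qed
  with \<eta> show ?thesis by (rule that)
qed

section \<open>Convergence of minimizing sequences\<close>

lemma AE_pair_both:
  assumes "AE x in (lborel :: plane measure). P x"
  shows "AE p in (lborel :: plane measure) \<Otimes>\<^sub>M (lborel :: plane measure). P (fst p) \<and> P (snd p)"
proof -
  obtain N where N: "{x \<in> space lborel. \<not> P x} \<subseteq> N" "N \<in> null_sets (lborel :: plane measure)"
    using assms by (auto elim!: AE_E simp: null_sets_def)
  have 1: "N \<times> UNIV \<in> null_sets ((lborel :: plane measure) \<Otimes>\<^sub>M (lborel :: plane measure))"
    using lborel.times_in_null_sets1[OF N(2), of UNIV] by simp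
  have 2: "UNIV \<times> N \<in> null_sets ((lborel :: plane measure) \<Otimes>\<^sub>M (lborel :: plane measure))"
    by (rule lborel.times_in_null_sets2[OF _ N(2)]) simp
  from AE_not_in[OF 1] AE_not_in[OF 2] show ?thesis
  proof eventually_elim
    case (elim q)
    then have "fst q \<notin> N" "snd q \<notin> N" by (auto simp: mem_Times_iff)
    then show ?case using N(1) by auto
  qed
qed

text \<open>
  The value \<open>energy ln_pos u\<close> is the integral of the potential \<open>\<Phi>\<close> against the density \<open>(u x)\<^sup>2\<close> of mass
  \<open>c\<close>, so \<open>\<Phi>\<close> cannot be large everywhere. Around a point where it is small the logarithmic moment is
  small.
\<close>

lemma exists_good_center:
  assumes u: "u \<in> S c" and c: "0 < c" and P: "energy ln_pos u \<le> M"
  shows "\<exists>z. (LBINT x. ln (1 + norm x) * (u (x + z))\<^sup>2) \<le> ln 2 * c + (M + 1) / c"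
proof -
  have uX: "u \<in> X" and uc: "mass u = c" using u by (auto simp: S_def)
  note [measurable] = X_D(2)[OF uX]
  define \<Phi> where "\<Phi> x = (LBINT y. (u y)\<^sup>2 * ln_pos (x - y))" for x
  note i = energy_ln_pos_integrable[OF uX]
  have e: "energy ln_pos u = (LBINT x. (u x)\<^sup>2 * \<Phi> x)"
    using lborel_pair.integral_fst'[OF i] unfolding energy_def \<Phi>_def by (simp add: mult.assoc)
  have ie: "integrable lborel (\<lambda>x. (u x)\<^sup>2 * \<Phi> x)"
    using lborel_pair.integrable_fst'[OF i] unfolding \<Phi>_def by (simp add: mult.assoc)
  \<comment> \<open>A potential above \<open>(M + 1) / c\<close> everywhere would integrate to at least \<open>M + 1\<close>.\<close>
  have "\<exists>z. \<Phi> z \<le> (M + 1) / c"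
  proof (rule ccontr)
    assume "\<not> ?thesis"
    then have "(u x)\<^sup>2 * ((M + 1) / c) \<le> (u x)\<^sup>2 * \<Phi> x" for x
      by (intro mult_left_mono) (auto simp: not_le less_imp_le)
    then have "(LBINT x. (u x)\<^sup>2 * ((M + 1) / c)) \<le> energy ln_pos u"
      unfolding e using X_D(3)[OF uX] by (intro integral_mono ie) auto
    then show False using P c by (simp add: uc)
  qed
  then obtain z where z: "\<Phi> z \<le> (M + 1) / c" by blast
  have eq: "(LBINT x. ln (1 + norm x) * (u (x + z))\<^sup>2) = (LBINT x. ln (1 + norm (x - z)) * (u x)\<^sup>2)"
    using integral_shift[of "\<lambda>x. ln (1 + norm (x - z)) * (u x)\<^sup>2" z] by simp
  have il: "integrable lborel (\<lambda>x. ln (1 + norm (x - z)) * (u x)\<^sup>2)"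
    using integrable_shift[OF X_D(4)[OF X_shift[OF uX, of z]], of "- z"] by simp
  have ip: "integrable lborel (\<lambda>y. (u y)\<^sup>2 * ln_pos (z - y))"
  proof (rule integrable_dominated[OF il])
    show "\<bar>(u y)\<^sup>2 * ln_pos (z - y)\<bar> \<le> ln (1 + norm (y - z)) * (u y)\<^sup>2" for y
      using mult_left_mono[OF ln_pos_le[of "z - y"], of "(u y)\<^sup>2"] by (simp add: mult.commute norm_minus_commute abs_mult)
  qed measurable
  have "(LBINT x. ln (1 + norm (x - z)) * (u x)\<^sup>2) \<le> (LBINT x. ln 2 * (u x)\<^sup>2 + (u x)\<^sup>2 * ln_pos (z - x))"
  proof (rule integral_mono[OF il])
    show "integrable lborel (\<lambda>x. ln 2 * (u x)\<^sup>2 + (u x)\<^sup>2 * ln_pos (z - x))" using X_D(3)[OF uX] ip by simp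
    show "ln (1 + norm (x - z)) * (u x)\<^sup>2 \<le> ln 2 * (u x)\<^sup>2 + (u x)\<^sup>2 * ln_pos (z - x)" for x
      using mult_right_mono[OF ln_one_plus_le_ln_pos[of "z - x"], of "(u x)\<^sup>2"]
      by (simp add: norm_minus_commute algebra_simps)
  qed
  also have "\<dots> = ln 2 * c + \<Phi> z" using X_D(3)[OF uX] ip by (simp add: uc \<Phi>_def)
  finally show ?thesis using z unfolding eq[symmetric] by (intro exI[of _ z]) linarith
qed

lemma powr_sum_le:
  fixes y z q :: real
  assumes "0 \<le> q"
  shows "\<bar>y\<bar> powr q \<le> 2 powr q * (\<bar>y - z\<bar> powr q + \<bar>z\<bar> powr q)"
proof -
  have "\<bar>y\<bar> \<le> \<bar>y - z\<bar> + \<bar>z\<bar>" by linarith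
  also have "\<dots> \<le> max \<bar>y - z\<bar> \<bar>z\<bar> + max \<bar>y - z\<bar> \<bar>z\<bar>" by (intro add_mono) auto
  finally have "\<bar>y\<bar> \<le> 2 * max \<bar>y - z\<bar> \<bar>z\<bar>" by simp
  then have "\<bar>y\<bar> powr q \<le> (2 * max \<bar>y - z\<bar> \<bar>z\<bar>) powr q" using assms by (intro powr_mono2) auto
  also have "\<dots> = 2 powr q * (max \<bar>y - z\<bar> \<bar>z\<bar>) powr q" by (rule powr_mult)
  also have "\<dots> \<le> 2 powr q * (\<bar>y - z\<bar> powr q + \<bar>z\<bar> powr q)"
    by (intro mult_left_mono) (auto simp: max_def)
  finally show ?thesis .
qed

text \<open>
  The moment of the difference tends to zero, because its mass does and its energy stays bounded. This
  provides the convergent majorant \<open>2 powr q * (\<bar>v k - w\<bar> powr q + \<bar>w\<bar> powr q)\<close>.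
\<close>

lemma C_convergence:
  assumes v: "\<And>k. v k \<in> H1" and w: "w \<in> H1" and AB: "\<And>k. A (v k) \<le> B" and q: "2 \<le> q"
    and lim: "AE x in lborel. (\<lambda>k. v k x) \<longlonglongrightarrow> w x"
    and L2: "(\<lambda>k. sqdist (v k) w) \<longlonglongrightarrow> 0"
  shows "(\<lambda>k. C q (v k)) \<longlonglongrightarrow> C q w"
proof -
  note [measurable] = H1_D(1)[OF v] H1_D(1)[OF w]
  obtain j where j: "q \<le> 2 * real (Suc j)" using exists_even_exponent by blast
  have z: "(\<lambda>x. v k x - w x) \<in> H1" for k by (rule H1_diff(1)[OF v w])
  have Az: "A (\<lambda>x. v k x - w x) \<le> 2 * B + 2 * A w" for k
    using A_parallelogram[OF v w, of k] AB[of k] A_nonneg[of "\<lambda>x. v k x + w x"] by linarith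
  have "(\<lambda>k. C q (\<lambda>x. v k x - w x)) \<longlonglongrightarrow> 0"
  proof (rule tendsto_sandwich[of "\<lambda>_. 0"])
    have "(\<lambda>k. (1 + (fact (Suc j))\<^sup>2 * (2 * B + 2 * A w) ^ j) * sqdist (v k) w) \<longlonglongrightarrow>
      (1 + (fact (Suc j))\<^sup>2 * (2 * B + 2 * A w) ^ j) * 0"
      by (intro tendsto_intros L2)
    then show "(\<lambda>k. (1 + (fact (Suc j))\<^sup>2 * (2 * B + 2 * A w) ^ j) * sqdist (v k) w) \<longlonglongrightarrow> 0" by simp
    have "C q (\<lambda>x. v k x - w x) \<le> (1 + (fact (Suc j))\<^sup>2 * (2 * B + 2 * A w) ^ j) * sqdist (v k) w" for k
      by (rule order.trans[OF H1_powr_moment(2)[OF z q j]])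
        (intro mult_right_mono add_left_mono mult_left_mono power_mono Az A_nonneg; simp)
    then show "\<forall>\<^sub>F k in sequentially. C q (\<lambda>x. v k x - w x) \<le> (1 + (fact (Suc j))\<^sup>2 * (2 * B + 2 * A w) ^ j) * sqdist (v k) w"
      by (intro always_eventually) blast
  qed (auto simp: C_nonneg)
  then have "(\<lambda>k. 2 powr q * (C q (\<lambda>x. v k x - w x) + C q w)) \<longlonglongrightarrow> 2 powr q * (0 + C q w)"
    by (intro tendsto_intros)
  moreover have "2 powr q * (C q (\<lambda>x. v k x - w x) + C q w) = (LBINT x. 2 powr q * (\<bar>v k x - w x\<bar> powr q + \<bar>w x\<bar> powr q))" for k
    using H1_powr_moment(1)[OF z q j] H1_powr_moment(1)[OF w q j] by (simp add: C_def)
  ultimately have hl: "(\<lambda>k. LBINT x. 2 powr q * (\<bar>v k x - w x\<bar> powr q + \<bar>w x\<bar> powr q)) \<longlonglongrightarrow> (LBINT x. 2 powr q * \<bar>w x\<bar> powr q)"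
    by (simp add: C_def)
  show ?thesis
    unfolding C_def
  proof (rule Pratt_convergence(3)[OF _ _ _ _ _ _ _ hl])
    show "\<bar>\<bar>v k x\<bar> powr q\<bar> \<le> 2 powr q * (\<bar>v k x - w x\<bar> powr q + \<bar>w x\<bar> powr q)" for k x
      using powr_sum_le[of q "v k x" "w x"] q by simp
    show "integrable lborel (\<lambda>x. 2 powr q * (\<bar>v k x - w x\<bar> powr q + \<bar>w x\<bar> powr q))" for k
      using H1_powr_moment(1)[OF z q j] H1_powr_moment(1)[OF w q j] by simp
    show "integrable lborel (\<lambda>x. 2 powr q * \<bar>w x\<bar> powr q)" using H1_powr_moment(1)[OF w q j] by simp
    show "AE x in lborel. (\<lambda>k. \<bar>v k x\<bar> powr q) \<longlonglongrightarrow> \<bar>w x\<bar> powr q"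
      using lim by eventually_elim (use q in \<open>intro tendsto_powr' tendsto_intros; simp\<close>)
    show "AE x in lborel. (\<lambda>k. 2 powr q * (\<bar>v k x - w x\<bar> powr q + \<bar>w x\<bar> powr q)) \<longlonglongrightarrow> 2 powr q * \<bar>w x\<bar> powr q"
      using lim
    proof eventually_elim
      case (elim x)
      have "(\<lambda>k. \<bar>v k x - w x\<bar>) \<longlonglongrightarrow> \<bar>w x - w x\<bar>" by (intro tendsto_intros elim)
      from tendsto_powr'[OF this tendsto_const, of q]
      have "(\<lambda>k. \<bar>v k x - w x\<bar> powr q) \<longlonglongrightarrow> \<bar>w x - w x\<bar> powr q" using q by simp
      then have "(\<lambda>k. 2 powr q * (\<bar>v k x - w x\<bar> powr q + \<bar>w x\<bar> powr q)) \<longlonglongrightarrow> 2 powr q * (\<bar>w x - w x\<bar> powr q + \<bar>w x\<bar> powr q)"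
        by (rule tendsto_mult[OF tendsto_const tendsto_add[OF _ tendsto_const]])
      then show ?case by simp
    qed
  qed measurable
qed

text \<open>
  The integral of the majorant from Young's inequality is a combination of products of masses and fourth
  moments, which converge.
\<close>

lemma energy_ln_neg_convergence:
  assumes v: "\<And>k. v k \<in> H1" and w: "w \<in> H1" and AB: "\<And>k. A (v k) \<le> B"
    and lim: "AE x in lborel. (\<lambda>k. v k x) \<longlonglongrightarrow> w x"
    and L2: "(\<lambda>k. sqdist (v k) w) \<longlonglongrightarrow> 0"
  shows "(\<lambda>k. energy ln_neg (v k)) \<longlonglongrightarrow> energy ln_neg w"
proof -
  note [measurable] = H1_D(1)[OF v] H1_D(1)[OF w]
  have p4: "\<bar>y\<bar> powr 4 = y ^ 4" for y :: real by (cases "y = 0") (auto simp: powr_numeral)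
  have l4: "(\<lambda>k. LBINT x. (v k x) ^ 4) \<longlonglongrightarrow> (LBINT x. (w x) ^ 4)"
    using C_convergence[OF v w AB _ lim L2, of 4] unfolding C_def p4 by simp
  have l2: "(\<lambda>k. mass (v k)) \<longlonglongrightarrow> mass w"
    using H1_D[OF v] H1_D[OF w] by (intro L2_limit_integral_square L2) auto
  let ?h = "\<lambda>u. \<lambda>(x, y). (1 / 2) * ((u x)\<^sup>2 * (u y) ^ 4) + (1 / (2 * 1)) * ((u x)\<^sup>2 * (ln_neg (y - x))\<^sup>2)"
  have hl: "(\<lambda>k. \<integral>p. ?h (v k) p \<partial>(lborel \<Otimes>\<^sub>M lborel)) \<longlonglongrightarrow> (\<integral>p. ?h w p \<partial>(lborel \<Otimes>\<^sub>M lborel))"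
    unfolding energy_ln_neg_majorant(2)[OF v] energy_ln_neg_majorant(2)[OF w]
    by (intro tendsto_intros l4 l2)
  show ?thesis
    unfolding energy_def
  proof (rule Pratt_convergence(3)[OF _ _ _ _ _ _ _ hl])
    show "\<bar>case p of (x, y) \<Rightarrow> (v k x)\<^sup>2 * (v k y)\<^sup>2 * ln_neg (x - y)\<bar> \<le> ?h (v k) p" for k p
      using energy_ln_neg_pointwise[of 1 "v k (fst p)" "v k (snd p)" "fst p" "snd p"]
      by (simp add: case_prod_unfold abs_mult)
    show "integrable (lborel \<Otimes>\<^sub>M lborel) (?h (v k))" for k by (rule energy_ln_neg_majorant(1)[OF v])
    show "integrable (lborel \<Otimes>\<^sub>M lborel) (?h w)" by (rule energy_ln_neg_majorant(1)[OF w])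
    show "AE p in lborel \<Otimes>\<^sub>M lborel. (\<lambda>k. case p of (x, y) \<Rightarrow> (v k x)\<^sup>2 * (v k y)\<^sup>2 * ln_neg (x - y)) \<longlonglongrightarrow> (case p of (x, y) \<Rightarrow> (w x)\<^sup>2 * (w y)\<^sup>2 * ln_neg (x - y))"
      using AE_pair_both[OF lim] unfolding case_prod_unfold by eventually_elim (intro tendsto_intros; simp)
    show "AE p in lborel \<Otimes>\<^sub>M lborel. (\<lambda>k. ?h (v k) p) \<longlonglongrightarrow> ?h w p"
      using AE_pair_both[OF lim] unfolding case_prod_unfold by eventually_elim (intro tendsto_intros; simp)
  qed measurable
qed

text \<open>
  If the limit of a sum does not exceed the sum of lower bounds for the limits of the summands, then no
  summand can stay above its bound.
\<close>

lemma tendsto_split_sum: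
  fixes x y :: "nat \<Rightarrow> real"
  assumes s: "(\<lambda>n. x n + y n) \<longlonglongrightarrow> L" and L: "L \<le> a + b"
    and x: "\<And>e. 0 < e \<Longrightarrow> eventually (\<lambda>n. a - e < x n) sequentially"
    and y: "\<And>e. 0 < e \<Longrightarrow> eventually (\<lambda>n. b - e < y n) sequentially"
  shows "x \<longlonglongrightarrow> a" "y \<longlonglongrightarrow> b" "L = a + b"
proof -
  have *: "eventually (\<lambda>n. \<bar>x n - a\<bar> < e \<and> \<bar>y n - b\<bar> < e) sequentially" if e: "0 < e" for e
  proof -
    have "eventually (\<lambda>n. x n + y n < L + e / 2) sequentially"
      using order_tendstoD(2)[OF s, of "L + e / 2"] e by simp
    moreover have "eventually (\<lambda>n. a - e / 2 < x n) sequentially" "eventually (\<lambda>n. b - e / 2 < y n) sequentially"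
      using x y e by auto
    ultimately show ?thesis
    proof eventually_elim
      case (elim n)
      then show ?case using L e unfolding abs_less_iff by (intro conjI) linarith+
    qed
  qed
  show x': "x \<longlonglongrightarrow> a"
  proof (rule tendstoI)
    fix e :: real assume "0 < e"
    from *[OF this] show "\<forall>\<^sub>F n in sequentially. dist (x n) a < e" by eventually_elim (simp add: dist_real_def)
  qed
  show y': "y \<longlonglongrightarrow> b"
  proof (rule tendstoI)
    fix e :: real assume "0 < e"
    from *[OF this] show "\<forall>\<^sub>F n in sequentially. dist (y n) b < e" by eventually_elim (simp add: dist_real_def)
  qed
  show "L = a + b" by (rule LIMSEQ_unique[OF s tendsto_add[OF x' y']])
qed

text \<open>
  By the parallelogram identity the energy of the difference is \<open>2 * A (v k) + 2 * A w\<close> minus the energy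
  of the sum, and the sum tends to \<open>2 * w\<close>, so that lower semicontinuity bounds the subtracted term from
  below by nearly \<open>4 * A w\<close>.
\<close>

lemma A_diff_tendsto_zero:
  assumes v: "\<And>k. v k \<in> H1" and w: "w \<in> H1"
    and L2: "(\<lambda>k. sqdist (v k) w) \<longlonglongrightarrow> 0"
    and Al: "(\<lambda>k. A (v k)) \<longlonglongrightarrow> A w"
  shows "(\<lambda>k. A (\<lambda>x. v k x - w x)) \<longlonglongrightarrow> 0"
proof (rule tendstoI)
  fix e :: real assume e: "0 < e"
  have w2: "(\<lambda>x. 2 * w x) \<in> H1" "A (\<lambda>x. 2 * w x) = 4 * A w" using H1_scale[OF w, of 2] by auto
  have "eventually (\<lambda>k. A (\<lambda>x. 2 * w x) - e / 2 < A (\<lambda>x. v k x + w x)) sequentially"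
  proof (rule A_lower)
    show "(\<lambda>k. LBINT x. (v k x + w x - 2 * w x)\<^sup>2) \<longlonglongrightarrow> 0" using L2 by simp
  qed (use H1_D(1,2)[OF w2(1)] H1_add(1)[OF v w] e in auto)
  moreover have "eventually (\<lambda>k. A (v k) < A w + e / 4) sequentially"
    using order_tendstoD(2)[OF Al, of "A w + e / 4"] e by simp
  ultimately show "\<forall>\<^sub>F k in sequentially. dist (A (\<lambda>x. v k x - w x)) 0 < e"
  proof eventually_elim
    case (elim k)
    then show ?case using A_parallelogram[OF v w, of k] A_nonneg[of "\<lambda>x. v k x - w x"] w2(2)
      by (simp add: dist_real_def)
  qed
qed

text \<open>
  The triangle inequality for \<open>ln (1 + norm y)\<close> produces a term \<open>ln (1 + norm x)\<close>, which the damping factor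
  compensates.
\<close>

lemma log_weight_bound:
  fixes x y :: plane
  shows "1 / (1 + ln (1 + norm x)) * ln (1 + norm y) \<le> 1 + ln 2 + ln_pos (x - y)"
proof -
  define E where "E = 1 + ln (1 + norm x)"
  have E: "1 \<le> E" by (simp add: E_def)
  have "ln (1 + norm y) \<le> ln (1 + norm x) + ln (1 + norm (x - y))"
    using ln_one_plus_norm_add[of x "y - x"] by (simp add: norm_minus_commute)
  also have "\<dots> \<le> E * 1 + E * (ln 2 + ln_pos (x - y))"
  proof (rule add_mono)
    have "ln (1 + norm (x - y)) \<le> 1 * (ln 2 + ln_pos (x - y))" using ln_one_plus_le_ln_pos by simp
    also have "\<dots> \<le> E * (ln 2 + ln_pos (x - y))" using E by (intro mult_right_mono) auto
    finally show "ln (1 + norm (x - y)) \<le> E * (ln 2 + ln_pos (x - y))" .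
  qed (simp add: E_def)
  also have "\<dots> = E * (1 + ln 2 + ln_pos (x - y))" by (simp add: algebra_simps)
  finally show ?thesis using E unfolding E_def[symmetric] by (simp add: field_simps)
qed

text \<open>
  Damped by \<open>E x = 1 / (1 + ln (1 + norm x))\<close>, the product of \<open>(v x)\<^sup>2\<close> and \<open>ln (1 + norm y) * (v y)\<^sup>2\<close> is
  dominated by the integrand of \<open>energy ln_pos\<close> and a multiple of \<open>(v x)\<^sup>2 * (v y)\<^sup>2\<close>, whose integrals
  converge. The integral of the product is a product of integrals. Its first factor converges to a
  positive number because \<open>w\<close> has positive mass, and so the second factor converges too.
\<close>

lemma log_weight_convergence:
  assumes v: "\<And>k. v k \<in> S c" and w: "w \<in> S c" and c: "0 < c"
    and lim: "AE x in lborel. (\<lambda>k. v k x) \<longlonglongrightarrow> w x"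
    and P: "(\<lambda>k. energy ln_pos (v k)) \<longlonglongrightarrow> energy ln_pos w"
  shows "(\<lambda>k. LBINT x. ln (1 + norm x) * (v k x - w x)\<^sup>2) \<longlonglongrightarrow> 0"
proof -
  have X: "v k \<in> X" "w \<in> X" and mass: "mass (v k) = c" "mass w = c" for k
    using v[of k] w by (auto simp: S_def)
  note [measurable] = X_D(2)[OF X(1)] X_D(2)[OF X(2)]
  note i = X_D(3,4)[OF X(1)] X_D(3,4)[OF X(2)]
  define E where "E x = 1 / (1 + ln (1 + norm x))" for x :: plane
  have [measurable]: "E \<in> borel_measurable borel" unfolding E_def by measurable
  have E: "0 < E x" "E x \<le> 1" for x
    unfolding E_def by (auto simp: divide_le_eq_1_pos add_pos_nonneg intro!: divide_pos_pos)
  have Eb: "\<bar>E x * (u x)\<^sup>2\<bar> \<le> (u x)\<^sup>2" for u :: "plane \<Rightarrow> real" and x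
    using mult_right_mono[OF E(2)[of x], of "(u x)\<^sup>2"] E(1)[of x] by (simp add: abs_mult)
  have c2: "(\<lambda>k. mass (v k)) \<longlonglongrightarrow> mass w" by (simp add: mass)
  have lim2: "AE x in lborel. (\<lambda>k. (v k x)\<^sup>2) \<longlonglongrightarrow> (w x)\<^sup>2" using lim by eventually_elim (intro tendsto_intros)
  have limE: "AE x in lborel. (\<lambda>k. E x * (v k x)\<^sup>2) \<longlonglongrightarrow> E x * (w x)\<^sup>2" using lim by eventually_elim (intro tendsto_intros)
  note PE = Pratt_convergence[of "\<lambda>k x. E x * (v k x)\<^sup>2" lborel "\<lambda>x. E x * (w x)\<^sup>2" "\<lambda>k x. (v k x)\<^sup>2" "\<lambda>x. (w x)\<^sup>2"]
  have iE: "integrable lborel (\<lambda>x. E x * (v k x)\<^sup>2)" "integrable lborel (\<lambda>x. E x * (w x)\<^sup>2)" for k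
    by (rule PE(1) PE(2); (rule Eb i(1) i(3) limE lim2 c2 | measurable))+
  have cE: "(\<lambda>k. LBINT x. E x * (v k x)\<^sup>2) \<longlonglongrightarrow> (LBINT x. E x * (w x)\<^sup>2)"
    by (rule PE(3); (rule Eb i(1) i(3) limE lim2 c2 | measurable))
  have posE: "0 < (LBINT x. E x * (u x)\<^sup>2)" if [measurable]: "u \<in> borel_measurable borel" and "integrable lborel (\<lambda>x. E x * (u x)\<^sup>2)"
    and uc: "mass u = c" for u
  proof (rule ccontr)
    assume "\<not> ?thesis"
    moreover have "0 \<le> (LBINT x. E x * (u x)\<^sup>2)" using E by (intro Bochner_Integration.integral_nonneg) (simp add: less_imp_le)
    ultimately have "(LBINT x. E x * (u x)\<^sup>2) = 0" by simp
    then have "AE x in lborel. E x * (u x)\<^sup>2 = 0"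
      using that(2) E by (subst (asm) integral_nonneg_eq_0_iff_AE) (auto simp: less_imp_le)
    then have "AE x in lborel. (u x)\<^sup>2 = 0"
    proof eventually_elim
      case (elim x)
      then show ?case using E(1)[of x] by auto
    qed
    then have "mass u = 0" by (rule integral_eq_zero_AE)
    then show False using uc c by simp
  qed
  let ?f = "\<lambda>u. \<lambda>(x, y). (E x * (u x)\<^sup>2) * (ln (1 + norm y) * (u y)\<^sup>2)"
  let ?h = "\<lambda>u. \<lambda>p. (1 + ln 2) * (case p of (x, y) \<Rightarrow> (u x)\<^sup>2 * (u y)\<^sup>2) + (case p of (x, y) \<Rightarrow> (u x)\<^sup>2 * (u y)\<^sup>2 * ln_pos (x - y))"
  have fi: "(\<integral>p. ?f u p \<partial>(lborel \<Otimes>\<^sub>M lborel)) = (LBINT x. E x * (u x)\<^sup>2) * log_moment u"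
    if "integrable lborel (\<lambda>x. E x * (u x)\<^sup>2)" "u \<in> X" for u
    by (rule integrable_tensor(2)[OF that(1) X_D(4)[OF that(2)]])
  have hi: "integrable (lborel \<Otimes>\<^sub>M lborel) (?h u)" "(\<integral>p. ?h u p \<partial>(lborel \<Otimes>\<^sub>M lborel)) = (1 + ln 2) * (c * c) + energy ln_pos u"
    if u: "u \<in> X" and uc: "mass u = c" for u
  proof -
    note t = integrable_tensor[OF X_D(3)[OF u] X_D(3)[OF u]]
    show "integrable (lborel \<Otimes>\<^sub>M lborel) (?h u)"
      by (intro Bochner_Integration.integrable_add integrable_mult_right t(1) energy_ln_pos_integrable[OF u])
    show "(\<integral>p. ?h u p \<partial>(lborel \<Otimes>\<^sub>M lborel)) = (1 + ln 2) * (c * c) + energy ln_pos u"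
      by (subst Bochner_Integration.integral_add[OF integrable_mult_right[OF t(1)] energy_ln_pos_integrable[OF u]])
        (simp only: integral_mult_right_zero t(2) uc energy_def)
  qed
  have hl: "(\<lambda>k. \<integral>p. ?h (v k) p \<partial>(lborel \<Otimes>\<^sub>M lborel)) \<longlonglongrightarrow> (\<integral>p. ?h w p \<partial>(lborel \<Otimes>\<^sub>M lborel))"
    unfolding hi(2)[OF X(1) mass(1)] hi(2)[OF X(2) mass(2)] by (intro tendsto_intros P)
  have "(\<lambda>k. \<integral>p. ?f (v k) p \<partial>(lborel \<Otimes>\<^sub>M lborel)) \<longlonglongrightarrow> (\<integral>p. ?f w p \<partial>(lborel \<Otimes>\<^sub>M lborel))"
  proof (rule Pratt_convergence(3)[OF _ _ _ _ _ _ _ hl])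
    show "\<bar>?f (v k) p\<bar> \<le> ?h (v k) p" for k p
    proof -
      obtain x y where p: "p = (x, y)" by (cases p)
      have "(v k x)\<^sup>2 * (v k y)\<^sup>2 * (E x * ln (1 + norm y)) \<le> (v k x)\<^sup>2 * (v k y)\<^sup>2 * (1 + ln 2 + ln_pos (x - y))"
        unfolding E_def by (intro mult_left_mono log_weight_bound) auto
      moreover have "0 \<le> (E x * (v k x)\<^sup>2) * (ln (1 + norm y) * (v k y)\<^sup>2)"
        using E(1)[of x] by (intro mult_nonneg_nonneg) auto
      ultimately show ?thesis by (simp add: p algebra_simps)
    qed
    show "integrable (lborel \<Otimes>\<^sub>M lborel) (?h (v k))" for k by (rule hi(1)[OF X(1) mass(1)])
    show "integrable (lborel \<Otimes>\<^sub>M lborel) (?h w)" by (rule hi(1)[OF X(2) mass(2)])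
    show "AE p in lborel \<Otimes>\<^sub>M lborel. (\<lambda>k. ?f (v k) p) \<longlonglongrightarrow> ?f w p"
      using AE_pair_both[OF lim] unfolding case_prod_unfold by eventually_elim (intro tendsto_intros; simp)
    show "AE p in lborel \<Otimes>\<^sub>M lborel. (\<lambda>k. ?h (v k) p) \<longlonglongrightarrow> ?h w p"
      using AE_pair_both[OF lim] unfolding case_prod_unfold by eventually_elim (intro tendsto_intros; simp)
  qed measurable
  then have "(\<lambda>k. (LBINT x. E x * (v k x)\<^sup>2) * log_moment (v k) / (LBINT x. E x * (v k x)\<^sup>2)) \<longlonglongrightarrow>
     (LBINT x. E x * (w x)\<^sup>2) * log_moment w / (LBINT x. E x * (w x)\<^sup>2)"
    unfolding fi[OF iE(1) X(1)] fi[OF iE(2) X(2)]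
    using posE[OF X_D(2)[OF X(2)] iE(2) mass(2)] by (intro tendsto_divide cE) auto
  moreover have "(LBINT x. E x * (v k x)\<^sup>2) \<noteq> 0" "(LBINT x. E x * (w x)\<^sup>2) \<noteq> 0" for k
    using posE[OF X_D(2)[OF X(2)] iE(2) mass(2)] posE[OF X_D(2)[OF X(1)] iE(1) mass(1), of k] by auto
  ultimately have W: "(\<lambda>k. LBINT y. ln (1 + norm y) * (v k y)\<^sup>2) \<longlonglongrightarrow> log_moment w"
    by (simp add: nonzero_mult_div_cancel_left)
  let ?H = "\<lambda>u x. 2 * (ln (1 + norm x) * (u x)\<^sup>2) + 2 * (ln (1 + norm x) * (w x)\<^sup>2)"
  have "(\<lambda>k. 2 * log_moment (v k) + 2 * log_moment w) \<longlonglongrightarrow>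
     2 * log_moment w + 2 * log_moment w"
    by (intro tendsto_intros W)
  then have Hl: "(\<lambda>k. LBINT x. ?H (v k) x) \<longlonglongrightarrow> (LBINT x. ?H w x)"
    using i by simp
  have "(\<lambda>k. LBINT x. ln (1 + norm x) * (v k x - w x)\<^sup>2) \<longlonglongrightarrow> (LINT x|(lborel :: plane measure). 0)"
  proof (rule Pratt_convergence(3)[OF _ _ _ _ _ _ _ Hl])
    show "\<bar>ln (1 + norm x) * (v k x - w x)\<^sup>2\<bar> \<le> ?H (v k) x" for k x
      using log_weight_diff_le[of x "v k x" "w x"] by (simp add: abs_mult)
    show "integrable lborel (?H (v k))" "integrable lborel (?H w)" for k using i by auto
    show "AE x in lborel. (\<lambda>k. ln (1 + norm x) * (v k x - w x)\<^sup>2) \<longlonglongrightarrow> 0"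
      using lim
    proof eventually_elim
      case (elim x)
      have "(\<lambda>k. ln (1 + norm x) * (v k x - w x)\<^sup>2) \<longlonglongrightarrow> ln (1 + norm x) * (w x - w x)\<^sup>2"
        by (intro tendsto_intros elim)
      then show ?case by simp
    qed
    show "AE x in lborel. (\<lambda>k. ?H (v k) x) \<longlonglongrightarrow> ?H w x"
      using lim by eventually_elim (intro tendsto_intros)
  qed measurable
  then show ?thesis by simp
qed

lemma X_norm_eq:
  assumes u: "u \<in> X"
  shows "X_norm u = sqrt (A u + mass u + log_moment u)"
  using H1_D(4)[OF X_D(1)[OF u]] X_D(3)[OF u] by (simp add: X_norm_def A_def)

text \<open>
  Here \<open>\<mu>\<close> is the infimum. After translation a subsequence \<open>s\<close> converges in \<open>L\<^sup>2\<close> to some \<open>w\<close> in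
  \<open>S c\<close>. The sum \<open>1 / 2 * A + \<gamma> / 4 * energy ln_pos\<close> converges along \<open>s\<close> to a limit that is not larger
  than its value at \<open>w\<close>, since \<open>F \<gamma> a p w \<ge> \<mu>\<close>. By lower semicontinuity both summands converge to
  their values at \<open>w\<close>.
\<close>

theorem minimizing_sequence_compact:
  fixes u :: "nat \<Rightarrow> plane \<Rightarrow> real"
  assumes c: "0 < c" and g: "0 < \<gamma>" and p: "2 < p"
    and cases: "a \<le> 0 \<or> (a > 0 \<and> p < 4) \<or> (a > 0 \<and> p = 4 \<and> c < 2 / (a * K_GN p))"
    and u: "\<And>n. u n \<in> S c" and ulim: "(\<lambda>n. F \<gamma> a p (u n)) \<longlonglongrightarrow> \<mu>"
    and min: "\<And>v. v \<in> S c \<Longrightarrow> \<mu> \<le> F \<gamma> a p v"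
  obtains x r w where "strict_mono (r :: nat \<Rightarrow> nat)" "w \<in> S c" "F \<gamma> a p w = \<mu>"
    "converges_in_X (\<lambda>k. translate (x (r k)) (u (r k))) w"
proof -
  obtain \<delta> K where \<delta>: "0 < \<delta>" and K: "\<And>u. u \<in> S c \<Longrightarrow> \<delta> * A u + \<gamma> / 4 * energy ln_pos u \<le> F \<gamma> a p u + K"
    using F_coercive[OF c g p cases] by blast
  obtain Fb where Fb: "\<And>n. F \<gamma> a p (u n) \<le> Fb"
    using convergent_imp_Bseq[OF convergentI[OF ulim]] by (auto simp: Bseq_def abs_le_iff)
  have P0: "0 \<le> energy ln_pos v" for v by (rule energy_nonneg) simp
  have bA: "A (u n) \<le> (Fb + K) / \<delta>" and bP: "energy ln_pos (u n) \<le> 4 * (Fb + K) / \<gamma>" for n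
  proof -
    have "\<delta> * A (u n) + \<gamma> / 4 * energy ln_pos (u n) \<le> Fb + K" using K[OF u[of n]] Fb[of n] by linarith
    moreover have "0 \<le> \<delta> * A (u n)" "0 \<le> \<gamma> / 4 * energy ln_pos (u n)" using \<delta> g A_nonneg P0 by simp_all
    ultimately have "\<delta> * A (u n) \<le> Fb + K" "\<gamma> / 4 * energy ln_pos (u n) \<le> Fb + K" by linarith+
    then show "A (u n) \<le> (Fb + K) / \<delta>" "energy ln_pos (u n) \<le> 4 * (Fb + K) / \<gamma>"
      using \<delta> g by (simp_all add: field_simps)
  qed
  have "\<forall>n. \<exists>z. (LBINT x. ln (1 + norm x) * (u n (x + z))\<^sup>2) \<le> ln 2 * c + (4 * (Fb + K) / \<gamma> + 1) / c"
    using exists_good_center[OF u c bP] by blast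
  from choice[OF this] obtain z
    where z: "\<And>n. (LBINT x. ln (1 + norm x) * (u n (x + z n))\<^sup>2) \<le> ln 2 * c + (4 * (Fb + K) / \<gamma> + 1) / c" by blast
  define v where "v n x = u n (x + z n)" for n x
  have vS: "v n \<in> S c" for n unfolding v_def by (rule S_shift[OF u])
  have vX: "v n \<in> X" and vH: "v n \<in> H1" and v2: "integrable lborel (\<lambda>x. (v n x)\<^sup>2)" and vc: "mass (v n) = c"
    and vl: "integrable lborel (\<lambda>x. ln (1 + norm x) * (v n x)\<^sup>2)" for n
    using vS[of n] X_D[of "v n"] by (auto simp: S_def)
  note [measurable] = H1_D(1)[OF vH]
  have uX: "u n \<in> X" for n using u[of n] by (simp add: S_def)
  have Fv: "F \<gamma> a p (v n) = F \<gamma> a p (u n)" for n unfolding v_def by (rule F_shift[OF uX])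
  have Av: "A (v n) \<le> (Fb + K) / \<delta>" for n
    unfolding v_def using H1_shift(2)[OF X_D(1)[OF uX]] bA by simp
  define W where "W = ln 2 * c + (4 * (Fb + K) / \<gamma> + 1) / c"
  define B where "B = max ((Fb + K) / \<delta>) (max c W)"
  have vb: "A (v n) \<le> B" "mass (v n) \<le> B" "log_moment (v n) \<le> B" for n
    using Av[of n] vc[of n] z[of n] by (simp_all add: B_def le_max_iff_disj W_def v_def)
  obtain r1 where r1: "strict_mono (r1 :: nat \<Rightarrow> nat)"
    and Cau: "\<And>e. 0 < e \<Longrightarrow> \<exists>N. \<forall>m\<ge>N. \<forall>n\<ge>N. sqdist (v (r1 m)) (v (r1 n)) < e"
    by (rule bounded_in_X_L2_Cauchy_subsequence[OF vX vb(1) vb(2) vb(3)]) (rule that)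
  obtain w r2 where w[measurable]: "w \<in> borel_measurable lborel" and w2: "integrable lborel (\<lambda>x. (w x)\<^sup>2)"
    and r2: "strict_mono (r2 :: nat \<Rightarrow> nat)"
    and lim0: "AE x in lborel. (\<lambda>k. v (r1 (r2 k)) x) \<longlonglongrightarrow> w x"
    and L20: "(\<lambda>n. sqdist (v (r1 n)) w) \<longlonglongrightarrow> 0"
  proof (rule L2_complete[of "\<lambda>n. v (r1 n)" lborel])
    show "v (r1 n) \<in> borel_measurable lborel" for n by measurable
  qed (use v2 Cau in blast)+
  define r where "r k = r1 (r2 k)" for k
  have r: "strict_mono r" using r1 r2 by (simp add: r_def[abs_def] strict_mono_def)
  define s where "s k = v (r k)" for k
  have sS: "s k \<in> S c" and sX: "s k \<in> X" and sH: "s k \<in> H1" and sA: "A (s k) \<le> B" for k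
    using vS vX vH vb by (simp_all add: s_def)
  note [measurable] = H1_D(1)[OF sH]
  have lim: "AE x in lborel. (\<lambda>k. s k x) \<longlonglongrightarrow> w x" using lim0 by (simp add: s_def r_def)
  have L2: "(\<lambda>k. sqdist (s k) w) \<longlonglongrightarrow> 0"
    using LIMSEQ_subseq_LIMSEQ[OF L20 r2] by (simp add: comp_def s_def r_def)
  have wb: "w \<in> borel_measurable borel" using w by simp
  have wH: "w \<in> H1" by (rule H1_closed_lsc(1)[OF wb w2 sH sA L2])
  have "(\<lambda>k. mass (s k)) \<longlonglongrightarrow> mass w"
    using H1_D(1,2)[OF sH] by (intro L2_limit_integral_square w2 w L2) auto
  then have wc: "mass w = c"
    by (simp add: s_def vc LIMSEQ_const_iff)
  have wl: "integrable lborel (\<lambda>x. ln (1 + norm x) * (w x)\<^sup>2)"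
  proof (rule Fatou_integrable(1))
    show "integrable lborel (\<lambda>x. ln (1 + norm x) * (s k x)\<^sup>2)" for k using vl by (simp add: s_def)
    show "AE x in lborel. (\<lambda>k. ln (1 + norm x) * (s k x)\<^sup>2) \<longlonglongrightarrow> ln (1 + norm x) * (w x)\<^sup>2"
      using lim by eventually_elim (intro tendsto_intros)
    show "eventually (\<lambda>k. log_moment (s k) \<le> B) sequentially"
      using vb(3) by (simp add: s_def)
  qed auto
  have wX: "w \<in> X" using wH wl by (simp add: X_def)
  have wS: "w \<in> S c" using wX wc by (simp add: S_def)
  have Fs: "(\<lambda>k. F \<gamma> a p (s k)) \<longlonglongrightarrow> \<mu>"
    using LIMSEQ_subseq_LIMSEQ[OF ulim r] by (simp add: comp_def s_def Fv)
  have Feq: "F \<gamma> a p h = 1 / 2 * A h + \<gamma> / 4 * energy ln_pos h - \<gamma> / 4 * energy ln_neg h - a / p * C p h" if "h \<in> X" for h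
    unfolding F_def V_eq[OF that] by (simp add: right_diff_distrib diff_divide_distrib)
  \<comment> \<open>The limit of the part of \<open>F\<close> that is only lower semicontinuous.\<close>
  define L where "L = \<mu> + \<gamma> / 4 * energy ln_neg w + a / p * C p w"
  have "(\<lambda>k. F \<gamma> a p (s k) + \<gamma> / 4 * energy ln_neg (s k) + a / p * C p (s k)) \<longlonglongrightarrow> L"
    unfolding L_def using p
    by (intro tendsto_intros Fs energy_ln_neg_convergence[OF sH wH sA lim L2] C_convergence[OF sH wH sA _ lim L2]) auto
  then have sum: "(\<lambda>k. 1 / 2 * A (s k) + \<gamma> / 4 * energy ln_pos (s k)) \<longlonglongrightarrow> L"
    by (simp add: Feq[OF sX])
  have Lle: "L \<le> 1 / 2 * A w + \<gamma> / 4 * energy ln_pos w"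
    using min[OF wS] unfolding Feq[OF wX] L_def by linarith
  have lowA: "eventually (\<lambda>k. 1 / 2 * A w - e < 1 / 2 * A (s k)) sequentially" if "0 < e" for e
  proof -
    have "eventually (\<lambda>k. A w - 2 * e < A (s k)) sequentially"
      using that by (intro A_lower[OF wb w2 sH L2]) simp
    then show ?thesis by eventually_elim simp
  qed
  have lowP: "eventually (\<lambda>k. \<gamma> / 4 * energy ln_pos w - e < \<gamma> / 4 * energy ln_pos (s k)) sequentially" if "0 < e" for e
  proof -
    have "eventually (\<lambda>k. energy ln_pos w - 4 * e / \<gamma> < energy ln_pos (s k)) sequentially"
      unfolding energy_def
    proof (rule Fatou_lower)
      show "integrable (lborel \<Otimes>\<^sub>M lborel) (\<lambda>(x, y). (s k x)\<^sup>2 * (s k y)\<^sup>2 * ln_pos (x - y))" for k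
        by (rule energy_ln_pos_integrable[OF sX])
      show "AE q in lborel \<Otimes>\<^sub>M lborel. (\<lambda>k. case q of (x, y) \<Rightarrow> (s k x)\<^sup>2 * (s k y)\<^sup>2 * ln_pos (x - y)) \<longlonglongrightarrow>
          (case q of (x, y) \<Rightarrow> (w x)\<^sup>2 * (w y)\<^sup>2 * ln_pos (x - y))"
        using AE_pair_both[OF lim] unfolding case_prod_unfold by eventually_elim (intro tendsto_intros; simp)
      show "(\<lambda>(x, y). (w x)\<^sup>2 * (w y)\<^sup>2 * ln_pos (x - y)) \<in> borel_measurable (lborel \<Otimes>\<^sub>M lborel)" by measurable
    qed (use that g in auto)
    then show ?thesis
    proof eventually_elim
      case (elim k)
      then have "\<gamma> / 4 * (energy ln_pos w - 4 * e / \<gamma>) < \<gamma> / 4 * energy ln_pos (s k)" using g by (intro mult_strict_left_mono) auto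
      then show ?case using g by (simp add: right_diff_distrib)
    qed
  qed
  note split = tendsto_split_sum[OF sum Lle lowA lowP]
  have "(\<lambda>k. 2 * (1 / 2 * A (s k))) \<longlonglongrightarrow> 2 * (1 / 2 * A w)" by (intro tendsto_intros split(1))
  then have Al: "(\<lambda>k. A (s k)) \<longlonglongrightarrow> A w" by simp
  have "(\<lambda>k. 4 / \<gamma> * (\<gamma> / 4 * energy ln_pos (s k))) \<longlonglongrightarrow> 4 / \<gamma> * (\<gamma> / 4 * energy ln_pos w)" by (intro tendsto_intros split(2))
  then have Pl: "(\<lambda>k. energy ln_pos (s k)) \<longlonglongrightarrow> energy ln_pos w" using g by simp
  have Fw: "F \<gamma> a p w = \<mu>" using split(3) unfolding Feq[OF wX] L_def by linarith
  have "(\<lambda>k. sqrt (A (\<lambda>x. s k x - w x) + sqdist (s k) w + (LBINT x. ln (1 + norm x) * (s k x - w x)\<^sup>2))) \<longlonglongrightarrow> sqrt (0 + 0 + 0)"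
    by (intro tendsto_intros A_diff_tendsto_zero[OF sH wH L2 Al] L2 log_weight_convergence[OF sS wS c lim Pl])
  then have "(\<lambda>k. X_norm (\<lambda>x. s k x - w x)) \<longlonglongrightarrow> 0"
    by (simp add: X_norm_eq[OF X_diff(1)[OF sX wX]])
  moreover have "translate (- z (r k)) (u (r k)) = s k" for k
    by (simp add: translate_def s_def v_def[abs_def])
  ultimately have "converges_in_X (\<lambda>k. translate (- z (r k)) (u (r k))) w"
    using sX wX by (simp add: converges_in_X_def)
  then show ?thesis using that[OF r wS Fw, of "\<lambda>n. - z n"] by blast
qed

theorem theorem1p1:
  fixes c \<gamma> a p :: real
  assumes "c > 0" and "\<gamma> > 0" and "p > 2"
    and "a \<le> 0 \<or> (a > 0 \<and> p < 4) \<or> (a > 0 \<and> p = 4 \<and> c < 2 / (a * K_GN p))"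
  shows "bdd_below (F \<gamma> a p ` S c) \<and>
    (\<exists>u \<in> S c. F \<gamma> a p u = m \<gamma> a p c) \<and>
    (\<forall>u :: nat \<Rightarrow> plane \<Rightarrow> real.
       (\<forall>n. u n \<in> S c) \<and> (\<lambda>n. F \<gamma> a p (u n)) \<longlonglongrightarrow> m \<gamma> a p c \<longrightarrow>
       (\<exists>(x :: nat \<Rightarrow> plane) (r :: nat \<Rightarrow> nat) w.
          strict_mono r \<and> converges_in_X (\<lambda>k. translate (x (r k)) (u (r k))) w))"
proof -
  obtain \<delta> K where \<delta>: "0 < \<delta>" and K: "\<And>u. u \<in> S c \<Longrightarrow> \<delta> * A u + \<gamma> / 4 * energy ln_pos u \<le> F \<gamma> a p u + K"
    using F_coercive[OF assms] by blast
  have bdd: "bdd_below (F \<gamma> a p ` S c)"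
  proof (rule bdd_belowI2)
    fix u assume "u \<in> S c"
    moreover have "0 \<le> \<delta> * A u" "0 \<le> \<gamma> / 4 * energy ln_pos u"
      using \<delta> assms(2) A_nonneg[of u] energy_nonneg[of ln_pos u] by simp_all
    ultimately show "- K \<le> F \<gamma> a p u" using K[of u] by linarith
  qed
  have min: "m \<gamma> a p c \<le> F \<gamma> a p v" if "v \<in> S c" for v
    unfolding m_def by (rule cINF_lower[OF bdd that])
  have "\<exists>u\<in>S c. F \<gamma> a p u < m \<gamma> a p c + 1 / real (Suc n)" for n
    using cINF_less_iff[OF S_nonempty[OF assms(1)] bdd, of "m \<gamma> a p c + 1 / real (Suc n)"] by (simp add: m_def)
  then have "\<forall>n. \<exists>u. u \<in> S c \<and> F \<gamma> a p u < m \<gamma> a p c + 1 / real (Suc n)" by blast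
  from choice[OF this] obtain u where u: "\<And>n. u n \<in> S c" "\<And>n. F \<gamma> a p (u n) < m \<gamma> a p c + 1 / real (Suc n)" by blast
  have "(\<lambda>n. F \<gamma> a p (u n)) \<longlonglongrightarrow> m \<gamma> a p c"
  proof (rule tendsto_sandwich[of "\<lambda>_. m \<gamma> a p c" _ _ "\<lambda>n. m \<gamma> a p c + 1 / real (Suc n)"])
    have "(\<lambda>n. m \<gamma> a p c + inverse (real (Suc n))) \<longlonglongrightarrow> m \<gamma> a p c + 0"
      by (intro tendsto_intros LIMSEQ_inverse_real_of_nat)
    then show "(\<lambda>n. m \<gamma> a p c + 1 / real (Suc n)) \<longlonglongrightarrow> m \<gamma> a p c" by (simp add: inverse_eq_divide)
  qed (intro always_eventually allI less_imp_le u(2) min u(1) tendsto_const)+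
  then have ex: "\<exists>u \<in> S c. F \<gamma> a p u = m \<gamma> a p c"
    by (rule minimizing_sequence_compact[OF assms u(1) _ min]) blast+
  have seq: "\<exists>(x :: nat \<Rightarrow> plane) (r :: nat \<Rightarrow> nat) w.
          strict_mono r \<and> converges_in_X (\<lambda>k. translate (x (r k)) (u (r k))) w"
    if "\<forall>n. u n \<in> S c" "(\<lambda>n. F \<gamma> a p (u n)) \<longlonglongrightarrow> m \<gamma> a p c" for u :: "nat \<Rightarrow> plane \<Rightarrow> real"
  proof (rule minimizing_sequence_compact[OF assms _ that(2) min])
    show "u n \<in> S c" for n using that(1) by blast
  qed blast+
  show ?thesis using bdd ex seq by blast
qed

end
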